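(* Let $(\mathcal{X},\ \rho^{B_1B_2}_x,\ \mathcal{H}^{B_1}\otimes\mathcal{H}^{B_2})$ be a classical-quantum broadcast channel, let $\mathcal{U}_1,\mathcal{U}_2$ be finite sets, $p(u_1,u_2)$ a distribution on $\mathcal{U}_1\times\mathcal{U}_2$ and $f:\mathcal{U}_1\times\mathcal{U}_2\to\mathcal{X}$ a deterministic function. Then every pair $(R_1,R_2)\in\mathbb{R}_+^2$ satisfying $$R_1\le I(U_1;B_1)_\theta,\qquad R_2\le I(U_2;B_2)_\theta,\qquad R_1+R_2\le I(U_1;B_1)_\theta+I(U_2;B_2)_\theta-I(U_1;U_2)_\theta$$ is achievable with no common message, i.e. the triple $(R_1,0,R_2)$ is achievable for the broadcast channel. Here $\theta^{U_1U_2B_1B_2}=\sum_{u_1,u_2}p(u_1,u_2)|u_1\rangle\langle u_1|^{U_1}\otimes|u_2\rangle\langle u_2|^{U_2}\otimes\rho^{B_1B_2}_{f(u_1,u_2)}$.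
   Context: A classical-quantum broadcast channel: finite $\mathcal{X}$, density operators $\rho^{B_1B_2}_x$ on finite-dimensional $\mathcal{H}^{B_1}\otimes\mathcal{H}^{B_2}$; Receiver $j$ holds $B_j$; $n$ uses give tensor products. An $(n,R_1,R,R_2,\epsilon)$ code: codebook $\{x^n(m_1,m,m_2)\}$ with $2^{nR_1},2^{nR},2^{nR_2}$ personal-1, common, personal-2 messages, POVM $\{\Lambda_{m_1,m}\}$ on $B_1^n$, POVM $\{\Gamma_{m,m_2}\}$ on $B_2^n$, with average (uniform over message triples) error $\mathrm{Tr}[(I-\Lambda_{m_1,m}\otimes\Gamma_{m,m_2})\rho^{B_1^nB_2^n}_{x^n(m_1,m,m_2)}]$ at most $\epsilon$. $(R_1,R,R_2)$ is achievable if $(n,R_1-\delta,R-\delta,R_2-\delta,\epsilon)$ codes exist for all $\epsilon,\delta>0$ and large $n$. Mutual informations are quantum (base 2); $I(U_1;U_2)$ is the classical mutual information of $p(u_1,u_2)$. *)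

theory Defs
  imports "Jordan_Normal_Form.Char_Poly"
begin

text \<open>Operators on a finite-dimensional Hilbert space with orthonormal basis indexed
  by 'i are represented by their matrix entries  A i j = <i|A|j>.\<close>
type_synonym 'i op = "'i \<Rightarrow> 'i \<Rightarrow> complex"

definition psd_on :: "'i set \<Rightarrow> 'i op \<Rightarrow> bool" where
  "psd_on C A \<longleftrightarrow> (\<forall>v :: 'i \<Rightarrow> complex.
      let z = (\<Sum>i\<in>C. \<Sum>j\<in>C. cnj (v i) * A i j * v j) in Im z = 0 \<and> Re z \<ge> 0)"

definition trace_on :: "'i set \<Rightarrow> 'i op \<Rightarrow> complex" where
  "trace_on C A = (\<Sum>i\<in>C. A i i)"

definition density_op :: "('i::finite) op \<Rightarrow> bool" where
  "density_op A \<longleftrightarrow> psd_on UNIV A \<and> trace_on UNIV A = 1"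

text \<open>Partial trace: the index i is identified with the pair (keep i, trc i)
  (assumed a bijection); the subsystem described by trc is traced out.\<close>
definition ptrace :: "('i \<Rightarrow> 'k) \<Rightarrow> ('i \<Rightarrow> 't) \<Rightarrow> ('i::finite) op \<Rightarrow> 'k op" where
  "ptrace keep trc A = (\<lambda>k k'. \<Sum>i\<in>UNIV. \<Sum>j\<in>UNIV.
      if keep i = k \<and> keep j = k' \<and> trc i = trc j then A i j else 0)"

text \<open>Matrix of an operator w.r.t. a fixed enumeration of the basis
  (eigenvalues do not depend on the enumeration).\<close>
definition basis_enum :: "nat \<Rightarrow> 'i::finite" where
  "basis_enum = (SOME e. bij_betw e {..<card (UNIV :: 'i set)} (UNIV :: 'i set))"

definition to_mat :: "('i::finite) op \<Rightarrow> complex mat" where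
  "to_mat A = mat (card (UNIV :: 'i set)) (card (UNIV :: 'i set)) (\<lambda>(r, c). A (basis_enum r) (basis_enum c))"

definition eta :: "real \<Rightarrow> real" where
  "eta t = (if t \<le> 0 then 0 else - t * log 2 t)"

definition vn_entropy :: "('i::finite) op \<Rightarrow> real" where
  "vn_entropy A = (let P = char_poly (to_mat A) in
      (\<Sum>z\<in>{z. poly P z = 0}. real (order z P) * eta (Re z)))"

definition qmutual_info :: "(('a::finite) \<times> ('b::finite)) op \<Rightarrow> real" where
  "qmutual_info A = vn_entropy (ptrace fst snd A) + vn_entropy (ptrace snd fst A) - vn_entropy A"

definition theta_state ::
  "('u1 \<times> 'u2 \<Rightarrow> real) \<Rightarrow> ('u1 \<Rightarrow> 'u2 \<Rightarrow> 'x) \<Rightarrow> ('x \<Rightarrow> ('b1 \<times> 'b2) op)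
    \<Rightarrow> ('u1 \<times> 'u2 \<times> ('b1 \<times> 'b2)) op" where
  "theta_state p f \<rho> = (\<lambda>(u1, u2, b) (u1', u2', b').
      if u1 = u1' \<and> u2 = u2' then complex_of_real (p (u1, u2)) * \<rho> (f u1 u2) b b' else 0)"

definition theta_U1B1 where
  "theta_U1B1 p f \<rho> = ptrace (\<lambda>(u1, u2, (b1, b2)). (u1, b1)) (\<lambda>(u1, u2, (b1, b2)). (u2, b2))
      (theta_state p f \<rho>)"

definition theta_U2B2 where
  "theta_U2B2 p f \<rho> = ptrace (\<lambda>(u1, u2, (b1, b2)). (u2, b2)) (\<lambda>(u1, u2, (b1, b2)). (u1, b1))
      (theta_state p f \<rho>)"

definition theta_U1U2 where
  "theta_U1U2 p f \<rho> = ptrace (\<lambda>(u1, u2, b). (u1, u2)) (\<lambda>(u1, u2, b). b) (theta_state p f \<rho>)"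

text \<open>n-fold channel output on B1^n \<otimes> B2^n; basis of B_j^n indexed by lists of length n.\<close>
definition chan_n :: "('x \<Rightarrow> ('b1 \<times> 'b2) op) \<Rightarrow> nat \<Rightarrow> (nat \<Rightarrow> 'x) \<Rightarrow> ('b1 list \<times> 'b2 list) op" where
  "chan_n \<rho> n xs = (\<lambda>(as, bs) (as', bs'). \<Prod>i<n. \<rho> (xs i) (as ! i, bs ! i) (as' ! i, bs' ! i))"

definition words :: "nat \<Rightarrow> 'b list set" where
  "words n = {w. length w = n}"

definition povm_on :: "'b list set \<Rightarrow> 'm set \<Rightarrow> ('m \<Rightarrow> 'b list op) \<Rightarrow> bool" where
  "povm_on C M \<Lambda> \<longleftrightarrow> (\<forall>m\<in>M. psd_on C (\<Lambda> m)) \<and>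
      (\<forall>a\<in>C. \<forall>a'\<in>C. (\<Sum>m\<in>M. \<Lambda> m a a') = (if a = a' then 1 else 0))"

definition err_prob :: "nat \<Rightarrow> 'b1 list op \<Rightarrow> 'b2 list op \<Rightarrow> ('b1 list \<times> 'b2 list) op \<Rightarrow> real" where
  "err_prob n L G R = Re (\<Sum>(a, b)\<in>words n \<times> words n. \<Sum>(a', b')\<in>words n \<times> words n.
      ((if (a, b) = (a', b') then 1 else 0) - L a a' * G b b') * R (a', b') (a, b))"

definition msg_num :: "nat \<Rightarrow> real \<Rightarrow> nat" where
  "msg_num n r = nat \<lceil>2 powr (real n * r)\<rceil>"

definition is_code :: "('x \<Rightarrow> ('b1 \<times> 'b2) op) \<Rightarrow> nat \<Rightarrow> real \<Rightarrow> real \<Rightarrow> real \<Rightarrow> real \<Rightarrow> bool" where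
  "is_code \<rho> n R1 R R2 \<epsilon> \<longleftrightarrow>
     (\<exists>(c :: nat \<Rightarrow> nat \<Rightarrow> nat \<Rightarrow> nat \<Rightarrow> 'x)
        (\<Lambda> :: nat \<times> nat \<Rightarrow> 'b1 list op) (\<Gamma> :: nat \<times> nat \<Rightarrow> 'b2 list op).
        let M1 = msg_num n R1; M = msg_num n R; M2 = msg_num n R2 in
        povm_on (words n) ({..<M1} \<times> {..<M}) \<Lambda> \<and>
        povm_on (words n) ({..<M} \<times> {..<M2}) \<Gamma> \<and>
        (\<Sum>m1<M1. \<Sum>m<M. \<Sum>m2<M2.
            err_prob n (\<Lambda> (m1, m)) (\<Gamma> (m, m2)) (chan_n \<rho> n (c m1 m m2)))
          / real (M1 * M * M2) \<le> \<epsilon>)"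

definition achievable :: "('x \<Rightarrow> ('b1 \<times> 'b2) op) \<Rightarrow> real \<Rightarrow> real \<Rightarrow> real \<Rightarrow> bool" where
  "achievable \<rho> R1 R R2 \<longleftrightarrow>
     (\<forall>\<epsilon>>0. \<forall>\<delta>>0. \<exists>N. \<forall>n\<ge>N. is_code \<rho> n (R1 - \<delta>) (R - \<delta>) (R2 - \<delta>) \<epsilon>)"

end

(* Marton's construction with weights instead of joint typicality. Two independent codebooks u(x), v(y)
   with i.i.d. letters are partitioned into bins, and a message pair selects a pair of bins. Each
   pair of codewords gets the weight w = p(u,v) / (p1(u) p2(v)), truncated at 2^(n (I(U1;U2) + d)).
   The average weight in a product bin has mean close to 1 and, by a second moment computation,
   concentrates; hence the best pair in the bin has an error at most twice the weighted average.
   Since w times the product distribution is dominated by the joint distribution, the weighted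
   average is bounded by the error of a random code for the point-to-point channel from U_j to B_j,
   whose outputs are the states of receiver j averaged over the other variable. This error is small
   at rates below I(U_j;B_j): the receiver projects onto the typical subspace of the average state
   and then tests the conditionally typical projectors one after the other, and the error of this
   sequential decoder is controlled by Gao's quantum union bound. *)
theory Submission
  imports Defs "HOL-Library.FuncSet" "HOL-Analysis.L2_Norm" "Jordan_Normal_Form.Schur_Decomposition"
begin

section \<open>Sums over words and random codebooks\<close>

text \<open>The pair sent for a message pair is selected with knowledge of both codebooks, hence of
  both decoders, so its words are no longer distributed like fixed codewords. The weights avoid an
  analysis of this bias: the error of the selected pair is bounded by an expression in the weights
  and errors of all pairs of the bin, and expectations are then taken for fixed indices. Truncation
  serves the second moment; without it, the mean of the squared weight may grow with a larger
  exponent than I(U1;U2). A sequential decoder needs only projectors acting on vectors, so no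
  inverse or root of an operator has to be formed; for the same reason positive operators are
  treated as finite sums of rank-one ones. Budget of exponents, with d = \<delta> / 4: each decoder
  spends d, the truncation spends d, and lowering the rates yields at least 4 d, which leaves d for
  the decay of the covering error. The yield is only \<delta>, not 2 \<delta>, when one lowered rate
  is negative and has to be replaced by 0. When neither lowered rate is positive it may be nothing
  at all, and that case is treated separately.\<close>

lemma sum_UNIV_Times: "(\<Sum>z\<in>UNIV. f z) = (\<Sum>a\<in>UNIV. \<Sum>b\<in>UNIV. f (a, b))"
  using sum.cartesian_product'[of f UNIV UNIV] by simp

lemma words_Suc: "words (Suc n) = (\<lambda>(a, w). a # w) ` (UNIV \<times> words n)"
  by (auto simp: words_def length_Suc_conv)

lemma words_0: "words 0 = {[]}"
  by (auto simp: words_def)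

lemma finite_words [simp]: "finite (words n :: 'a::finite list set)"
  by (induction n) (auto simp: words_Suc words_0)

lemma sum_words_Suc:
  "(\<Sum>w\<in>words (Suc n). F w) = (\<Sum>a\<in>(UNIV :: 'a::finite set). \<Sum>w\<in>words n. F (a # w))"
proof -
  have "inj_on (\<lambda>(a, w). a # w) ((UNIV :: 'a set) \<times> words n)"
    by (auto simp: inj_on_def)
  then show ?thesis
    by (simp add: words_Suc sum.reindex sum.cartesian_product case_prod_unfold o_def)
qed

text \<open>Whatever factorises over the channel uses (orthonormality, traces, marginals, averages
  of product states) reduces to this exchange. The factors depend on the position \<open>i\<close>
  so that they may refer to the letters of another, fixed word.\<close>

lemma sum_words_prod:
  fixes g :: "nat \<Rightarrow> 'a::finite \<Rightarrow> 'c::comm_semiring_1"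
  shows "(\<Sum>w\<in>words n. \<Prod>i<n. g i (w ! i)) = (\<Prod>i<n. \<Sum>a\<in>UNIV. g i a)"
proof (induction n arbitrary: g)
  case 0
  show ?case by (simp add: words_0)
next
  case (Suc n)
  show ?case
    using Suc[of "\<lambda>i. g (Suc i)"]
    by (simp add: sum_words_Suc prod.lessThan_Suc_shift del: prod.lessThan_Suc flip: sum_distrib_left sum_distrib_right)
qed

text \<open>Lets a tail estimate for i.i.d. pairs of letters be read as a double sum over two
  words.\<close>

lemma sum_words_pair:
  fixes F :: "'a::finite list \<Rightarrow> 'b::finite list \<Rightarrow> 'c::comm_monoid_add"
  shows "(\<Sum>w\<in>words n. F (map fst w) (map snd w)) = (\<Sum>u\<in>words n. \<Sum>v\<in>words n. F u v)"
proof (induction n arbitrary: F)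
  case 0
  show ?case by (simp add: words_0)
next
  case (Suc n)
  have "(\<Sum>w\<in>words (Suc n). F (map fst w) (map snd w))
      = (\<Sum>a\<in>UNIV. \<Sum>b\<in>UNIV. \<Sum>u\<in>words n. \<Sum>v\<in>words n. F (a # u) (b # v))"
  proof -
    have "(\<Sum>w\<in>words (Suc n). F (map fst w) (map snd w))
        = (\<Sum>x\<in>UNIV \<times> UNIV. \<Sum>w\<in>words n. F (fst x # map fst w) (snd x # map snd w))"
      by (simp add: sum_words_Suc)
    also have "\<dots> = (\<Sum>x\<in>UNIV \<times> UNIV. \<Sum>u\<in>words n. \<Sum>v\<in>words n. F (fst x # u) (snd x # v))"
      by (intro sum.cong refl Suc[of "\<lambda>u v. F (fst _ # u) (snd _ # v)"])
    also have "\<dots> = (\<Sum>a\<in>UNIV. \<Sum>b\<in>UNIV. \<Sum>u\<in>words n. \<Sum>v\<in>words n. F (a # u) (b # v))"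
      using sum.cartesian_product[of "\<lambda>a b. \<Sum>u\<in>words n. \<Sum>v\<in>words n. F (a # u) (b # v)" UNIV UNIV]
      by (simp add: case_prod_unfold)
    finally show ?thesis .
  qed
  also have "\<dots> = (\<Sum>u\<in>words (Suc n). \<Sum>v\<in>words (Suc n). F u v)"
    unfolding sum_words_Suc by (intro sum.cong refl sum.swap)
  finally show ?case .
qed

lemma sum_words_iid:
  fixes q :: "'a::finite \<Rightarrow> real"
  assumes "(\<Sum>a\<in>UNIV. q a) = 1"
  shows "(\<Sum>w\<in>words n. \<Prod>i<n. q (w ! i)) = 1"
  using sum_words_prod[of "\<lambda>_. q" n] assms by simp

text \<open>Markov's inequality for the exponential moment of order \<open>s\<close>, which is smaller than 1 for small
  \<open>s > 0\<close> because its logarithmic derivative at 0 is negative.\<close>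

lemma iid_tail_tendsto_0:
  fixes q g :: "'a::finite \<Rightarrow> real"
  assumes q: "\<And>a. q a \<ge> 0" "(\<Sum>a\<in>UNIV. q a) = 1"
    and g: "\<And>a. g a \<ge> 0" "\<And>a. q a > 0 \<Longrightarrow> g a > 0"
    and m: "m = (\<Sum>a\<in>UNIV. q a * log 2 (g a))" and \<delta>: "\<delta> > 0"
  shows "(\<lambda>n. \<Sum>w\<in>words n. if 2 powr (real n * (m + \<delta>)) < (\<Prod>i<n. g (w ! i))
            then \<Prod>i<n. q (w ! i) else 0) \<longlonglongrightarrow> 0"
proof -
  define y where "y a = ln (g a) - (m + \<delta>) * ln 2" for a
  define H where "H s = (\<Sum>a\<in>UNIV. q a * exp (s * y a))" for s
  have "(H has_field_derivative (\<Sum>a\<in>UNIV. q a * y a)) (at 0)"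
    unfolding H_def by (auto intro!: derivative_eq_intros sum.cong)
  moreover have "(\<Sum>a\<in>UNIV. q a * y a) = (\<Sum>a\<in>UNIV. q a * ln (g a)) - (m + \<delta>) * ln 2 * (\<Sum>a\<in>UNIV. q a)"
    by (simp add: y_def algebra_simps sum_subtractf sum.distrib flip: sum_distrib_left sum_distrib_right)
  moreover have "(\<Sum>a\<in>UNIV. q a * ln (g a)) = m * ln 2"
    by (simp add: m log_def sum_distrib_right)
  ultimately have "(H has_field_derivative (- \<delta> * ln 2)) (at 0)"
    using q by (simp add: algebra_simps)
  from DERIV_neg_dec_right[OF this] obtain d where "d > 0" "\<And>h. 0 < h \<Longrightarrow> h < d \<Longrightarrow> H h < H 0"
    using \<delta> by auto
  then have "H (d / 2) < H 0" "d / 2 > 0" by auto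
  moreover have "H 0 = 1" using q by (simp add: H_def)
  ultimately obtain s where s: "s > 0" "H s < 1" by metis
  have H0: "H s \<ge> 0"
    unfolding H_def by (intro sum_nonneg mult_nonneg_nonneg) (use q in auto)
  have le: "(\<Sum>w\<in>words n. if 2 powr (real n * (m + \<delta>)) < (\<Prod>i<n. g (w ! i))
            then \<Prod>i<n. q (w ! i) else 0) \<le> H s ^ n" for n
  proof -
    have "(\<Sum>w\<in>words n. if 2 powr (real n * (m + \<delta>)) < (\<Prod>i<n. g (w ! i))
            then \<Prod>i<n. q (w ! i) else 0)
        \<le> (\<Sum>w\<in>words n. \<Prod>i<n. q (w ! i) * exp (s * y (w ! i)))"
    proof (rule sum_mono)
      fix w :: "'a list"
      have Q: "(\<Prod>i<n. q (w ! i)) \<ge> 0"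
        using q by (simp add: prod_nonneg)
      have E: "(\<Prod>i<n. q (w ! i) * exp (s * y (w ! i)))
          = (\<Prod>i<n. q (w ! i)) * exp (s * (\<Sum>i<n. y (w ! i)))"
        by (simp add: prod.distrib exp_sum sum_distrib_left)
      show "(if 2 powr (real n * (m + \<delta>)) < (\<Prod>i<n. g (w ! i)) then \<Prod>i<n. q (w ! i) else 0)
          \<le> (\<Prod>i<n. q (w ! i) * exp (s * y (w ! i)))"
      proof (cases "2 powr (real n * (m + \<delta>)) < (\<Prod>i<n. g (w ! i))")
        case True
        \<comment> \<open>A product exceeding a nonnegative number has no zero factor, so its
          logarithm splits although \<open>g\<close> may vanish at some letters.\<close>
        have pos: "0 < (\<Prod>i<n. g (w ! i))"
          by (rule order.strict_trans1[OF powr_ge_zero True])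
        then have "g (w ! i) > 0" if "i < n" for i
          using that g(1)[of "w ! i"] by (force simp: less_le)
        then have "ln (\<Prod>i<n. g (w ! i)) = (\<Sum>i<n. ln (g (w ! i)))"
          by (intro ln_prod) (auto simp: order_less_imp_not_eq2)
        moreover have "ln (2 powr (real n * (m + \<delta>))) < ln (\<Prod>i<n. g (w ! i))"
          using True pos by (subst ln_less_cancel_iff) auto
        ultimately have "(\<Sum>i<n. y (w ! i)) \<ge> 0"
          by (simp add: y_def sum_subtractf ln_powr)
        then have "exp (s * (\<Sum>i<n. y (w ! i))) \<ge> 1"
          using s by simp
        then show ?thesis
          using True Q by (simp add: E mult_le_cancel_left1)
      next
        case False
        then show ?thesis using Q by (simp add: E)
      qed
    qed
    also have "\<dots> = H s ^ n"
      using sum_words_prod[of "\<lambda>_ a. q a * exp (s * y a)" n] by (simp add: H_def)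
    finally show ?thesis .
  qed
  show ?thesis
  proof (rule tendsto_sandwich[OF _ _ tendsto_const])
    show "(\<lambda>n. H s ^ n) \<longlonglongrightarrow> 0"
      using s H0 by (intro LIMSEQ_realpow_zero) auto
  qed (use le q in \<open>auto intro!: always_eventually sum_nonneg prod_nonneg\<close>)
qed

text \<open>Expectation over random codebooks whose codewords are drawn independently from \<open>q\<close>.\<close>

definition cbE :: "'i set \<Rightarrow> 'w set \<Rightarrow> ('w \<Rightarrow> real) \<Rightarrow> (('i \<Rightarrow> 'w) \<Rightarrow> real) \<Rightarrow> real" where
  "cbE I W q F = (\<Sum>c\<in>PiE I (\<lambda>_. W). (\<Prod>i\<in>I. q (c i)) * F c)"

definition distr_on :: "'w set \<Rightarrow> ('w \<Rightarrow> real) \<Rightarrow> bool" where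
  "distr_on W q \<longleftrightarrow> finite W \<and> (\<forall>w\<in>W. 0 \<le> q w) \<and> (\<Sum>w\<in>W. q w) = 1"

lemma cbE_cong: "(\<And>c. c \<in> PiE I (\<lambda>_. W) \<Longrightarrow> F c = G c) \<Longrightarrow> cbE I W q F = cbE I W q G"
  unfolding cbE_def by (rule sum.cong) auto

lemma cbE_add: "cbE I W q (\<lambda>c. F c + G c) = cbE I W q F + cbE I W q G"
  by (simp add: cbE_def algebra_simps sum.distrib)

lemma cbE_cmult: "cbE I W q (\<lambda>c. k * F c) = k * cbE I W q F"
  by (simp add: cbE_def sum_distrib_left mult_ac)

lemma cbE_sum: "cbE I W q (\<lambda>c. \<Sum>a\<in>A. F a c) = (\<Sum>a\<in>A. cbE I W q (F a))"
  unfolding cbE_def sum_distrib_left by (rule sum.swap)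

lemma cbE_weight_nonneg:
  "distr_on W q \<Longrightarrow> c \<in> PiE I (\<lambda>_. W) \<Longrightarrow> 0 \<le> (\<Prod>i\<in>I. q (c i))"
  by (rule prod_nonneg) (auto simp: distr_on_def PiE_def Pi_def)

lemma cbE_mono:
  "distr_on W q \<Longrightarrow> (\<And>c. c \<in> PiE I (\<lambda>_. W) \<Longrightarrow> F c \<le> G c) \<Longrightarrow> cbE I W q F \<le> cbE I W q G"
  unfolding cbE_def by (intro sum_mono mult_left_mono cbE_weight_nonneg) auto

lemma cbE_prod:
  assumes "finite I" "distr_on W q"
  shows "cbE I W q (\<lambda>c. \<Prod>i\<in>I. h i (c i)) = (\<Prod>i\<in>I. \<Sum>w\<in>W. q w * h i w)"
  using prod_sum_PiE[of I "\<lambda>_. W" "\<lambda>i w. q w * h i w"] assms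
  by (simp add: cbE_def distr_on_def prod.distrib)

lemma cbE_const:
  assumes "finite I" "distr_on W q"
  shows "cbE I W q (\<lambda>_. k) = k"
  using cbE_prod[OF assms, of "\<lambda>_ _. 1"] cbE_cmult[of I W q k "\<lambda>_. 1"] assms
  by (simp add: distr_on_def)

text \<open>\<open>g (c i) (c j)\<close> is expanded into indicators of \<open>c i = u\<close> and
  \<open>c j = v\<close>. Each of these is a product over all positions, with factor 1 away from
  \<open>i\<close> and \<open>j\<close>, and so within reach of \<open>cbE_prod\<close>.\<close>

lemma cbE_pair:
  fixes q :: "'w \<Rightarrow> real"
  assumes fin: "finite I" and d: "distr_on W q" and ij: "i \<in> I" "j \<in> I" "i \<noteq> j"
  shows "cbE I W q (\<lambda>c. g (c i) (c j)) = (\<Sum>u\<in>W. \<Sum>v\<in>W. q u * q v * g u v)"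
proof -
  define h where "h u v k w = (if k = i then (if w = u then 1 else 0) else if k = j then (if w = v then 1 else 0) else (1::real))"
    for u v :: 'w and k w
  have W: "finite W" "(\<Sum>w\<in>W. q w) = 1" using d by (auto simp: distr_on_def)
  have hp: "(\<Prod>k\<in>I. h u v k (c k)) = of_bool (c i = u) * of_bool (c j = v)" for c u v
  proof -
    have "(\<Prod>k\<in>I. h u v k (c k)) = h u v i (c i) * (h u v j (c j) * (\<Prod>k\<in>I - {i} - {j}. h u v k (c k)))"
      using fin ij by (simp add: prod.remove[of I i] prod.remove[of "I - {i}" j])
    also have "(\<Prod>k\<in>I - {i} - {j}. h u v k (c k)) = 1"
      by (rule prod.neutral) (auto simp: h_def)
    finally show ?thesis using ij by (simp add: h_def)
  qed
  have hs: "(\<Prod>k\<in>I. \<Sum>w\<in>W. q w * h u v k w) = q u * q v" if "u \<in> W" "v \<in> W" for u v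
  proof -
    have "(\<Prod>k\<in>I. \<Sum>w\<in>W. q w * h u v k w) = (\<Sum>w\<in>W. q w * h u v i w) * ((\<Sum>w\<in>W. q w * h u v j w) *
        (\<Prod>k\<in>I - {i} - {j}. \<Sum>w\<in>W. q w * h u v k w))"
      using fin ij by (simp add: prod.remove[of I i] prod.remove[of "I - {i}" j])
    also have "(\<Prod>k\<in>I - {i} - {j}. \<Sum>w\<in>W. q w * h u v k w) = 1"
      by (rule prod.neutral) (auto simp: h_def W)
    finally show ?thesis using ij that W by (simp add: h_def if_distrib[of "(*) _"] sum.delta cong: if_cong)
  qed
  have "cbE I W q (\<lambda>c. g (c i) (c j))
      = cbE I W q (\<lambda>c. \<Sum>u\<in>W. \<Sum>v\<in>W. g u v * (\<Prod>k\<in>I. h u v k (c k)))"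
  proof (rule cbE_cong)
    fix c assume "c \<in> PiE I (\<lambda>_. W)"
    then have "c i \<in> W" "c j \<in> W" using ij by auto
    then show "g (c i) (c j) = (\<Sum>u\<in>W. \<Sum>v\<in>W. g u v * (\<Prod>k\<in>I. h u v k (c k)))"
      unfolding hp using W(1) by (simp add: of_bool_def if_distrib[of "(*) _"] sum.delta sum.delta' cong: if_cong)
  qed
  also have "\<dots> = (\<Sum>u\<in>W. \<Sum>v\<in>W. g u v * (q u * q v))"
    using hs by (simp add: cbE_sum cbE_cmult cbE_prod[OF fin d])
  finally show ?thesis by (simp add: mult_ac)
qed

lemma cbE_single:
  fixes q :: "'w \<Rightarrow> real"
  assumes fin: "finite I" and d: "distr_on W q" and i: "i \<in> I"
  shows "cbE I W q (\<lambda>c. g (c i)) = (\<Sum>u\<in>W. q u * g u)"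
proof -
  define h where "h u k w = (if k = i then (if w = u then 1 else 0) else (1::real))" for u :: 'w and k w
  have W: "finite W" "(\<Sum>w\<in>W. q w) = 1" using d by (auto simp: distr_on_def)
  have hp: "(\<Prod>k\<in>I. h u k (c k)) = of_bool (c i = u)" for c u
  proof -
    have "(\<Prod>k\<in>I. h u k (c k)) = h u i (c i) * (\<Prod>k\<in>I - {i}. h u k (c k))"
      using fin i by (simp add: prod.remove[of I i])
    also have "(\<Prod>k\<in>I - {i}. h u k (c k)) = 1"
      by (rule prod.neutral) (auto simp: h_def)
    finally show ?thesis by (simp add: h_def)
  qed
  have hs: "(\<Prod>k\<in>I. \<Sum>w\<in>W. q w * h u k w) = q u" if "u \<in> W" for u
  proof -
    have "(\<Prod>k\<in>I. \<Sum>w\<in>W. q w * h u k w) = (\<Sum>w\<in>W. q w * h u i w) * (\<Prod>k\<in>I - {i}. \<Sum>w\<in>W. q w * h u k w)"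
      using fin i by (simp add: prod.remove[of I i])
    also have "(\<Prod>k\<in>I - {i}. \<Sum>w\<in>W. q w * h u k w) = 1"
      by (rule prod.neutral) (auto simp: h_def W)
    finally show ?thesis using that W by (simp add: h_def if_distrib[of "(*) _"] sum.delta cong: if_cong)
  qed
  have "cbE I W q (\<lambda>c. g (c i)) = cbE I W q (\<lambda>c. \<Sum>u\<in>W. g u * (\<Prod>k\<in>I. h u k (c k)))"
  proof (rule cbE_cong)
    fix c assume "c \<in> PiE I (\<lambda>_. W)"
    then have "c i \<in> W" using i by auto
    then show "g (c i) = (\<Sum>u\<in>W. g u * (\<Prod>k\<in>I. h u k (c k)))"
      unfolding hp using W(1) by (simp add: of_bool_def if_distrib[of "(*) _"] sum.delta sum.delta' cong: if_cong)
  qed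
  also have "\<dots> = (\<Sum>u\<in>W. g u * q u)"
    using hs by (simp add: cbE_sum cbE_cmult cbE_prod[OF fin d])
  finally show ?thesis by (simp add: mult_ac)
qed

lemma cbE_exists_le:
  assumes "finite I" "distr_on W q"
  shows "\<exists>c\<in>PiE I (\<lambda>_. W). F c \<le> cbE I W q F"
proof (rule ccontr)
  assume neg: "\<not> ?thesis"
  let ?P = "PiE I (\<lambda>_. W)" and ?w = "\<lambda>c. \<Prod>i\<in>I. q (c i)"
  have fin: "finite ?P" using assms by (auto simp: distr_on_def intro: finite_PiE)
  have one: "(\<Sum>c\<in>?P. ?w c) = 1"
    using cbE_const[OF assms, of 1] by (simp add: cbE_def)
  then obtain c where c: "c \<in> ?P" "?w c \<noteq> 0"
    by (metis (no_types, lifting) sum.neutral zero_neq_one)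
  have "(\<Sum>c\<in>?P. ?w c * cbE I W q F) < (\<Sum>c\<in>?P. ?w c * F c)"
  proof (rule sum_strict_mono_ex1[OF fin])
    show "\<forall>x\<in>?P. ?w x * cbE I W q F \<le> ?w x * F x"
      using neg cbE_weight_nonneg[OF assms(2)] by (auto intro!: mult_left_mono simp: not_le less_imp_le)
    have "?w c > 0" using c cbE_weight_nonneg[OF assms(2) c(1)] by simp
    then show "\<exists>a\<in>?P. ?w a * cbE I W q F < ?w a * F a"
      using neg c by (intro bexI[OF _ c(1)] mult_strict_left_mono) (auto simp: not_le)
  qed
  then show False
    by (simp add: one cbE_def[of I W q F] flip: sum_distrib_right)
qed

text \<open>The square is expanded into terms for two index pairs. Different pairs sharing one index
  are dependent, but averaging first over the codebook in which they differ leaves a product of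
  conditional means, each at most 1. Only the \<open>N\<close> diagonal terms involve
  \<open>K\<close>: one factor is replaced by \<open>K\<close>, the other has mean
  \<open>g \<le> 1\<close>. So the sum has second moment at most \<open>N * N + N * K\<close>. The
  deviation is measured from 1 instead of from the mean \<open>g\<close>, whence
  \<open>1 - 2 * g + 1\<close>.\<close>

lemma covering_second_moment:
  fixes w :: "'v \<Rightarrow> 'w \<Rightarrow> real"
  assumes d1: "distr_on W1 q1" and d2: "distr_on W2 q2"
    and fin: "finite I1" "finite I2" and J: "J1 \<subseteq> I1" "J2 \<subseteq> I2" "J1 \<noteq> {}" "J2 \<noteq> {}"
    and w0: "\<And>u v. u \<in> W1 \<Longrightarrow> v \<in> W2 \<Longrightarrow> 0 \<le> w u v"
    and wK: "\<And>u v. u \<in> W1 \<Longrightarrow> v \<in> W2 \<Longrightarrow> w u v \<le> K"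
    and m1: "\<And>v. v \<in> W2 \<Longrightarrow> (\<Sum>u\<in>W1. q1 u * w u v) \<le> 1"
    and m2: "\<And>u. u \<in> W1 \<Longrightarrow> (\<Sum>v\<in>W2. q2 v * w u v) \<le> 1"
    and g: "g = (\<Sum>u\<in>W1. \<Sum>v\<in>W2. q1 u * q2 v * w u v)"
    and N: "N = real (card J1) * real (card J2)"
  shows "cbE I1 W1 q1 (\<lambda>c1. cbE I2 W2 q2 (\<lambda>c2.
      ((\<Sum>a\<in>J1. \<Sum>b\<in>J2. w (c1 a) (c2 b)) / N - 1)\<^sup>2)) \<le> 2 * (1 - g) + K / N"
proof -
  define E where "E F = cbE I1 W1 q1 (\<lambda>c1. cbE I2 W2 q2 (F c1))" for F
  have E_sum: "E (\<lambda>c1 c2. \<Sum>a\<in>A. F a c1 c2) = (\<Sum>a\<in>A. E (F a))" for A :: "'z set" and F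
    by (simp add: E_def cbE_sum)
  have E_cm: "E (\<lambda>c1 c2. k * F c1 c2) = k * E F" for k F
    by (simp add: E_def cbE_cmult)
  have E_add: "E (\<lambda>c1 c2. F c1 c2 + G c1 c2) = E F + E G" for F G
    by (simp add: E_def cbE_add)
  have E_const: "E (\<lambda>_ _. k) = k" for k
    by (simp add: E_def cbE_const fin d1 d2)
  have fJ: "finite J1" "finite J2" using fin J finite_subset by auto
  have Npos: "N > 0" using J fJ by (simp add: N card_gt_0_iff)
  have q0: "\<And>u. u \<in> W1 \<Longrightarrow> 0 \<le> q1 u" "\<And>v. v \<in> W2 \<Longrightarrow> 0 \<le> q2 v"
    and qs: "(\<Sum>u\<in>W1. q1 u) = 1" "(\<Sum>v\<in>W2. q2 v) = 1"
    using d1 d2 by (auto simp: distr_on_def)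
  define h where "h u = (\<Sum>v\<in>W2. q2 v * w u v)" for u
  define k where "k v = (\<Sum>u\<in>W1. q1 u * w u v)" for v
  have h: "0 \<le> h u" "h u \<le> 1" if "u \<in> W1" for u
    using that m2 w0 q0 by (auto simp: h_def intro!: sum_nonneg)
  have k: "0 \<le> k v" "k v \<le> 1" if "v \<in> W2" for v
    using that m1 w0 q0 by (auto simp: k_def intro!: sum_nonneg)
  have gh: "g = (\<Sum>u\<in>W1. q1 u * h u)"
    by (simp add: g h_def sum_distrib_left mult.assoc)
  have gk: "g = (\<Sum>v\<in>W2. q2 v * k v)"
    unfolding g k_def sum_distrib_left by (subst sum.swap) (simp add: mult_ac)
  have g01: "0 \<le> g" "g \<le> 1"
  proof -
    show "0 \<le> g" unfolding gh using h q0 by (auto intro!: sum_nonneg)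
    have "g \<le> (\<Sum>u\<in>W1. q1 u * 1)" unfolding gh using h q0 by (intro sum_mono mult_left_mono) auto
    then show "g \<le> 1" using qs by simp
  qed
  have K0: "0 \<le> K"
  proof -
    have "W1 \<noteq> {}" "W2 \<noteq> {}" using qs by auto
    then show ?thesis using w0 wK by (meson all_not_in_conv order_trans)
  qed
  have Ew: "E (\<lambda>c1 c2. w (c1 a) (c2 b)) = g" if "a \<in> J1" "b \<in> J2" for a b
  proof -
    have "E (\<lambda>c1 c2. w (c1 a) (c2 b)) = cbE I1 W1 q1 (\<lambda>c1. h (c1 a))"
      unfolding E_def h_def using that J by (subst cbE_single[OF fin(2) d2]) auto
    also have "\<dots> = g"
      unfolding gh using that J by (subst cbE_single[OF fin(1) d1]) auto
    finally show ?thesis .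
  qed
  have Eww: "E (\<lambda>c1 c2. w (c1 a) (c2 b) * w (c1 a') (c2 b')) \<le> 1 + (if a = a' \<and> b = b' then K else 0)"
    if ab: "a \<in> J1" "b \<in> J2" "a' \<in> J1" "b' \<in> J2" for a b a' b'
  proof -
    have abI: "a \<in> I1" "b \<in> I2" "a' \<in> I1" "b' \<in> I2" using ab J by auto
    consider "b \<noteq> b'" | "b = b'" "a \<noteq> a'" | "a = a'" "b = b'" by blast
    then show ?thesis
    proof cases
      \<comment> \<open>This includes \<open>a = a'\<close>: once the second codebook is averaged
        out, only the bound \<open>h \<le> 1\<close> is used.\<close>
      case 1
      have "E (\<lambda>c1 c2. w (c1 a) (c2 b) * w (c1 a') (c2 b')) = cbE I1 W1 q1 (\<lambda>c1. h (c1 a) * h (c1 a'))"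
        unfolding E_def cbE_pair[OF fin(2) d2 abI(2,4) 1, of "\<lambda>x y. w _ x * w _ y"] h_def sum_product
        by (simp add: mult_ac)
      also have "\<dots> \<le> cbE I1 W1 q1 (\<lambda>_. 1)"
      proof (rule cbE_mono[OF d1])
        fix c assume "c \<in> PiE I1 (\<lambda>_. W1)"
        then have "c a \<in> W1" "c a' \<in> W1" using abI by auto
        then show "h (c a) * h (c a') \<le> 1" using h by (intro mult_le_one) auto
      qed
      finally show ?thesis using 1 by (simp add: cbE_const fin d1)
    next
      case 2
      have "E (\<lambda>c1 c2. w (c1 a) (c2 b) * w (c1 a') (c2 b'))
          = cbE I1 W1 q1 (\<lambda>c1. \<Sum>v\<in>W2. q2 v * (w (c1 a) v * w (c1 a') v))"
        unfolding E_def 2 cbE_single[OF fin(2) d2 abI(4), of "\<lambda>v. w _ v * w _ v"] ..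
      also have "\<dots> = (\<Sum>v\<in>W2. q2 v * (k v * k v))"
        unfolding cbE_sum cbE_cmult cbE_pair[OF fin(1) d1 abI(1,3) 2(2), of "\<lambda>x y. w x _ * w y _"]
        by (simp add: k_def sum_product mult_ac)
      also have "\<dots> \<le> (\<Sum>v\<in>W2. q2 v * 1)"
        using k q0 by (intro sum_mono mult_left_mono mult_le_one) auto
      finally show ?thesis using 2 qs by simp
    next
      case 3
      have "E (\<lambda>c1 c2. w (c1 a) (c2 b) * w (c1 a') (c2 b')) \<le> E (\<lambda>c1 c2. K * w (c1 a) (c2 b))"
        unfolding E_def 3
      proof (intro cbE_mono d1 d2 mult_right_mono)
        fix c1 c2 assume "c1 \<in> PiE I1 (\<lambda>_. W1)" "c2 \<in> PiE I2 (\<lambda>_. W2)"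
        then have "c1 a' \<in> W1" "c2 b' \<in> W2" using abI by auto
        then show "w (c1 a') (c2 b') \<le> K" "0 \<le> w (c1 a') (c2 b')" using w0 wK by auto
      qed
      also have "\<dots> = K * g" by (simp add: E_cm Ew ab)
      also have "\<dots> \<le> K" using g01 K0 by (simp add: mult_left_le)
      finally show ?thesis using 3 by simp
    qed
  qed
  define S where "S c1 c2 = (\<Sum>a\<in>J1. \<Sum>b\<in>J2. w (c1 a) (c2 b))" for c1 c2
  have ES: "E S = N * g"
    unfolding S_def E_sum by (simp add: Ew N)
  have SS: "S c1 c2 * S c1 c2 = (\<Sum>a\<in>J1. \<Sum>b\<in>J2. \<Sum>a'\<in>J1. \<Sum>b'\<in>J2. w (c1 a) (c2 b) * w (c1 a') (c2 b'))"
    for c1 c2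
    unfolding S_def sum_distrib_right unfolding sum_distrib_left ..
  have "E (\<lambda>c1 c2. S c1 c2 * S c1 c2)
      = (\<Sum>a\<in>J1. \<Sum>b\<in>J2. \<Sum>a'\<in>J1. \<Sum>b'\<in>J2. E (\<lambda>c1 c2. w (c1 a) (c2 b) * w (c1 a') (c2 b')))"
    unfolding SS E_sum ..
  also have "\<dots> \<le> (\<Sum>a\<in>J1. \<Sum>b\<in>J2. \<Sum>a'\<in>J1. \<Sum>b'\<in>J2. 1 + (if a = a' then if b = b' then K else 0 else 0))"
    by (intro sum_mono order_trans[OF Eww]) auto
  also have "\<dots> = (\<Sum>a\<in>J1. \<Sum>b\<in>J2. \<Sum>a'\<in>J1. real (card J2) + (if a = a' then K else 0))"
  proof (intro sum.cong refl)
    fix a b a' assume "b \<in> J2"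
    then show "(\<Sum>b'\<in>J2. 1 + (if a = a' then if b = b' then K else 0 else 0)) = real (card J2) + (if a = a' then K else 0)"
      using fJ by (simp add: sum.distrib sum.delta)
  qed
  also have "\<dots> = (\<Sum>a\<in>J1. \<Sum>b\<in>J2. N + K)"
    using fJ by (intro sum.cong refl) (simp add: sum.distrib sum.delta N)
  also have "\<dots> = N * N + N * K" by (simp add: N algebra_simps)
  finally have ESS: "E (\<lambda>c1 c2. S c1 c2 * S c1 c2) \<le> N * N + N * K" .
  have "(S c1 c2 / N - 1)\<^sup>2 = 1 / (N * N) * (S c1 c2 * S c1 c2) + ((- 2 / N) * S c1 c2 + 1)" for c1 c2
    using Npos by (simp add: power2_eq_square field_simps)
  then have "E (\<lambda>c1 c2. (S c1 c2 / N - 1)\<^sup>2) = 1 / (N * N) * E (\<lambda>c1 c2. S c1 c2 * S c1 c2) + ((- 2 / N) * E S + 1)"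
    by (simp only: E_add E_cm E_const)
  also have "\<dots> \<le> 1 / (N * N) * (N * N + N * K) + ((- 2 / N) * (N * g) + 1)"
    unfolding ES using ESS Npos by (intro add_right_mono mult_left_mono) auto
  also have "\<dots> = 2 * (1 - g) + K / N"
    using Npos by (simp add: field_simps)
  finally show ?thesis by (simp add: E_def S_def)
qed

section \<open>Spectral decomposition and entropy\<close>

text \<open>The carrier \<open>C\<close> is explicit because the n-fold space is spanned by the
  lists of length n only, a proper subset of its index type.\<close>

definition cinner :: "'i set \<Rightarrow> ('i \<Rightarrow> complex) \<Rightarrow> ('i \<Rightarrow> complex) \<Rightarrow> complex" where
  "cinner C u v = (\<Sum>i\<in>C. cnj (u i) * v i)"

definition nsq :: "'i set \<Rightarrow> ('i \<Rightarrow> complex) \<Rightarrow> real" where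
  "nsq C v = (\<Sum>i\<in>C. (cmod (v i))\<^sup>2)"

definition orthonormal :: "'i set \<Rightarrow> 'k set \<Rightarrow> ('k \<Rightarrow> 'i \<Rightarrow> complex) \<Rightarrow> bool" where
  "orthonormal C K e \<longleftrightarrow> (\<forall>k\<in>K. \<forall>l\<in>K. cinner C (e k) (e l) = (if k = l then 1 else 0))"

definition appl :: "'i set \<Rightarrow> 'i op \<Rightarrow> ('i \<Rightarrow> complex) \<Rightarrow> 'i \<Rightarrow> complex" where
  "appl C A v = (\<lambda>i. \<Sum>j\<in>C. A i j * v j)"

definition hermitian_on :: "'i set \<Rightarrow> 'i op \<Rightarrow> bool" where
  "hermitian_on C A \<longleftrightarrow> (\<forall>i\<in>C. \<forall>j\<in>C. A j i = cnj (A i j))"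

lemma hermitian_onD: "hermitian_on C A \<Longrightarrow> i \<in> C \<Longrightarrow> j \<in> C \<Longrightarrow> cnj (A i j) = A j i"
  unfolding hermitian_on_def by metis

lemma cinner_self: "cinner C v v = of_real (nsq C v)"
  unfolding cinner_def nsq_def of_real_sum complex_norm_square by (simp add: mult.commute)

lemma nsq_nonneg: "0 \<le> nsq C v"
  by (simp add: nsq_def sum_nonneg)

lemma cinner_commute: "cinner C u v = cnj (cinner C v u)"
  by (simp add: cinner_def mult.commute)

lemma cinner_appl:
  assumes "hermitian_on C A"
  shows "cinner C (appl C A u) v = cinner C u (appl C A v)"
proof -
  have "cinner C (appl C A u) v = (\<Sum>i\<in>C. \<Sum>j\<in>C. cnj (A i j) * cnj (u j) * v i)"
    by (simp add: cinner_def appl_def sum_distrib_right)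
  also have "\<dots> = (\<Sum>j\<in>C. \<Sum>i\<in>C. A j i * cnj (u j) * v i)"
    using assms by (subst sum.swap) (intro sum.cong refl, simp add: hermitian_onD)
  also have "\<dots> = cinner C u (appl C A v)"
    by (simp add: cinner_def appl_def sum_distrib_left mult_ac)
  finally show ?thesis .
qed

lemma psd_on_quadratic:
  "psd_on C A \<longleftrightarrow> (\<forall>v. Im (cinner C v (appl C A v)) = 0 \<and> 0 \<le> Re (cinner C v (appl C A v)))"
proof -
  have "(\<Sum>i\<in>C. \<Sum>j\<in>C. cnj (v i) * A i j * v j) = cinner C v (appl C A v)" for v
    by (simp add: cinner_def appl_def sum_distrib_left mult.assoc)
  then show ?thesis by (simp add: psd_on_def Let_def)
qed

text \<open>Polarisation with the vectors \<open>|i\<rangle> + z|j\<rangle>\<close> for \<open>z = 1\<close> and \<open>z = \<i>\<close>.\<close>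

lemma psd_on_imp_hermitian_on:
  assumes fin: "finite C" and psd: "psd_on C A"
  shows "hermitian_on C A"
  unfolding hermitian_on_def
proof (intro ballI)
  fix i j assume ij: "i \<in> C" "j \<in> C"
  define Q where "Q v = (\<Sum>i\<in>C. \<Sum>j\<in>C. cnj (v i) * A i j * v j)" for v
  have Q: "Im (Q v) = 0" for v using psd by (auto simp: psd_on_def Let_def Q_def)
  have Qs: "Q (\<lambda>k. \<Sum>l\<in>L. if k = l then z l else 0) = (\<Sum>k\<in>L. \<Sum>l\<in>L. cnj (z k) * A k l * z l)"
    if "L \<subseteq> C" for L z
  proof -
    have L: "finite L" using that fin finite_subset by auto
    have "Q (\<lambda>k. \<Sum>l\<in>L. if k = l then z l else 0)
        = (\<Sum>k\<in>C. \<Sum>l\<in>C. if k \<in> L then if l \<in> L then cnj (z k) * A k l * z l else 0 else 0)"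
      unfolding Q_def using L by (intro sum.cong refl) auto
    also have "\<dots> = (\<Sum>k\<in>C. if k \<in> L then \<Sum>l\<in>C. if l \<in> L then cnj (z k) * A k l * z l else 0 else 0)"
      by (intro sum.cong refl) auto
    also have "\<dots> = (\<Sum>k\<in>L. \<Sum>l\<in>L. cnj (z k) * A k l * z l)"
      using fin that by (simp add: Int_absorb1 flip: sum.inter_restrict)
    finally show ?thesis .
  qed
  have diag: "Im (A k k) = 0" if "k \<in> C" for k
    using Q[of "\<lambda>m. \<Sum>l\<in>{k}. if m = l then 1 else 0"] Qs[of "{k}" "\<lambda>_. 1"] that by simp
  show "A j i = cnj (A i j)"
  proof (cases "i = j")
    case True
    then show ?thesis using diag[OF ij(1)] by (simp add: complex_eq_iff)
  next
    case False
    have 1: "Im (A i j + A j i) = 0"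
      using Q[of "\<lambda>m. \<Sum>l\<in>{i,j}. if m = l then 1 else 0"] Qs[of "{i,j}" "\<lambda>_. 1"] ij False diag
      by simp
    have 2: "Im (A i j * \<i> - \<i> * A j i) = 0"
      using Q[of "\<lambda>m. \<Sum>l\<in>{i,j}. if m = l then (if l = i then 1 else \<i>) else 0"]
        Qs[of "{i,j}" "\<lambda>l. if l = i then 1 else \<i>"] ij False diag
      by (simp add: mult_ac)
    show ?thesis using 1 2 by (simp add: complex_eq_iff)
  qed
qed

section \<open>Existence of an orthonormal eigenbasis\<close>

lemma bij_betw_basis_enum:
  "bij_betw (basis_enum :: nat \<Rightarrow> 'i::finite) {..<card (UNIV :: 'i set)} UNIV"
proof -
  have "\<exists>e. bij_betw e {..<card (UNIV :: 'i set)} (UNIV :: 'i set)"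
    using ex_bij_betw_nat_finite[of "UNIV :: 'i set"] by (simp add: atLeast0LessThan)
  then show ?thesis unfolding basis_enum_def by (rule someI_ex)
qed

lemma sum_basis_enum:
  "(\<Sum>r<card (UNIV :: 'i::finite set). F (basis_enum r :: 'i)) = (\<Sum>i\<in>UNIV. F i)"
  by (rule sum.reindex_bij_betw[OF bij_betw_basis_enum])

lemma basis_enum_eq_iff:
  "r < card (UNIV :: 'i::finite set) \<Longrightarrow> s < card (UNIV :: 'i set) \<Longrightarrow>
    (basis_enum r :: 'i) = basis_enum s \<longleftrightarrow> r = s"
  using bij_betw_basis_enum[where 'i = 'i] by (auto simp: bij_betw_def inj_on_def)

lemma to_mat_carrier:
  "to_mat (A :: 'i::finite op) \<in> carrier_mat (card (UNIV :: 'i set)) (card (UNIV :: 'i set))"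
  by (simp add: to_mat_def)

lemma trace_similar_mat_wit:
  fixes A :: "'a::comm_ring_1 mat"
  assumes A: "A \<in> carrier_mat n n" and wit: "similar_mat_wit A B P Q"
  shows "(\<Sum>i<n. A $$ (i, i)) = (\<Sum>i<n. B $$ (i, i))"
proof -
  note w = similar_mat_witD2[OF A wit]
  have "(\<Sum>i<n. A $$ (i, i)) = (\<Sum>i<n. \<Sum>j<n. \<Sum>k<n. P $$ (i, k) * B $$ (k, j) * Q $$ (j, i))"
    unfolding w(3) using w by (intro sum.cong refl)
      (auto simp: scalar_prod_def atLeast0LessThan sum_distrib_right simp del: assoc_mult_mat)
  also have "\<dots> = (\<Sum>j<n. \<Sum>k<n. \<Sum>i<n. P $$ (i, k) * B $$ (k, j) * Q $$ (j, i))"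
    by (subst sum.swap) (rule sum.cong[OF refl], rule sum.swap)
  also have "\<dots> = (\<Sum>j<n. \<Sum>k<n. B $$ (k, j) * (Q * P) $$ (j, k))"
    using w(4-) by (intro sum.cong refl)
      (auto simp: scalar_prod_def atLeast0LessThan sum_distrib_left mult_ac)
  also have "\<dots> = (\<Sum>j<n. \<Sum>k<n. if k = j then B $$ (k, j) else 0)"
    unfolding w(2) by (intro sum.cong refl) auto
  also have "\<dots> = (\<Sum>i<n. B $$ (i, i))"
    by simp
  finally show ?thesis .
qed

text \<open>The diagonal of a Schur form consists of the eigenvalues and sums to the trace; if all
  of them were \<open>c\<close>, the trace would be the dimension times \<open>c\<close>.\<close>

lemma exists_eigenvector_avoiding:
  fixes B :: "'i::finite op"
  assumes tr: "trace_on UNIV B \<noteq> of_nat (card (UNIV :: 'i set)) * c"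
  shows "\<exists>r v. r \<noteq> c \<and> v \<noteq> (\<lambda>_. 0) \<and> appl UNIV B v = (\<lambda>i. r * v i)"
proof -
  let ?n = "card (UNIV :: 'i set)"
  let ?M = "to_mat B"
  note M = to_mat_carrier[of B]
  obtain as where as: "char_poly ?M = (\<Prod>a\<leftarrow>as. [:- a, 1:])" "length as = ?n"
    using char_poly_factorized[OF M] by blast
  obtain T P Q where TPQ: "schur_decomposition ?M as = (T, P, Q)"
    by (cases "schur_decomposition ?M as") auto
  from schur_decomposition[OF M as(1) TPQ] have T: "similar_mat_wit ?M T P Q" "diag_mat T = as" by auto
  have dT: "dim_row T = ?n" using similar_mat_witD2[OF M T(1)] by auto
  have "trace_on UNIV B = (\<Sum>i<?n. ?M $$ (i, i))"
    unfolding trace_on_def by (subst sum_basis_enum[symmetric]) (simp add: to_mat_def)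
  also have "\<dots> = (\<Sum>i<?n. as ! i)"
    unfolding trace_similar_mat_wit[OF M T(1)] T(2)[symmetric]
    by (intro sum.cong refl) (simp add: diag_mat_def dT)
  finally have s: "trace_on UNIV B = (\<Sum>i<?n. as ! i)" .
  have "\<exists>i<?n. as ! i \<noteq> c"
  proof (rule ccontr)
    assume "\<not> ?thesis"
    then have "(\<Sum>i<?n. as ! i) = (\<Sum>i<?n. c)" by (intro sum.cong) auto
    then show False using s tr by simp
  qed
  then obtain r where r: "r \<in> set as" "r \<noteq> c" using as(2) by (metis nth_mem)
  have "poly (char_poly ?M) r = 0"
    using r(1) unfolding as(1) by (induction as) auto
  then obtain v where v: "eigenvector ?M v r"
    using eigenvalue_root_char_poly[OF M] by (auto simp: eigenvalue_def)
  then have vc: "v \<in> carrier_vec ?n" "v \<noteq> 0\<^sub>v ?n" "?M *\<^sub>v v = r \<cdot>\<^sub>v v"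
    using M by (auto simp: eigenvector_def)
  define idx where "idx = the_inv_into {..<?n} (basis_enum :: nat \<Rightarrow> 'i)"
  have inj: "inj_on (basis_enum :: nat \<Rightarrow> 'i) {..<?n}"
    using bij_betw_basis_enum[where 'i = 'i] by (simp add: bij_betw_def)
  have idx: "idx (basis_enum k) = k" if "k < ?n" for k
    unfolding idx_def using that inj by (simp add: the_inv_into_f_f)
  define u where "u i = v $ idx i" for i
  have ex: "\<exists>k<?n. i = basis_enum k" for i :: 'i
    using bij_betw_basis_enum[where 'i = 'i] by (auto simp: bij_betw_def image_iff set_eq_iff)
  have "\<exists>k<?n. v $ k \<noteq> 0"
    using vc(1,2) by (metis carrier_vecD eq_vecI index_zero_vec(1,2))
  then obtain k where "k < ?n" "v $ k \<noteq> 0" by blast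
  then have "u (basis_enum k) \<noteq> 0" by (simp add: u_def idx)
  then have "u \<noteq> (\<lambda>_. 0)" by auto
  moreover have "appl UNIV B u i = r * u i" for i
  proof -
    obtain k where k: "k < ?n" "i = basis_enum k" using ex by blast
    have "appl UNIV B u i = (\<Sum>j<?n. B i (basis_enum j) * u (basis_enum j))"
      by (simp add: appl_def sum_basis_enum[of "\<lambda>j. B i j * u j"])
    also have "\<dots> = (?M *\<^sub>v v) $ k"
      using k vc(1) by (simp add: to_mat_def u_def idx scalar_prod_def atLeast0LessThan)
    also have "\<dots> = r * u i"
      unfolding vc(3) using k vc(1) by (simp add: u_def idx)
    finally show ?thesis .
  qed
  ultimately show ?thesis using r(2) by blast
qed

text \<open>Deflation: after shifting the eigenvalues of the given eigenvectors to a common value \<open>c\<close>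
  different from the average of the remaining ones, the trace shows that there is an
  eigenvalue other than \<open>c\<close>, whose eigenvector is orthogonal to the given ones.\<close>

lemma hermitian_extend_eigenvectors:
  fixes A :: "'i::finite op"
  assumes A: "hermitian_on UNIV A" and e: "orthonormal UNIV S e"
    and ev: "\<And>k. k \<in> S \<Longrightarrow> appl UNIV A (e k) = (\<lambda>i. complex_of_real (l k) * e k i)"
    and fin: "finite S" and card: "card S < card (UNIV :: 'i set)"
  shows "\<exists>v r. nsq UNIV v = 1 \<and> (\<forall>k\<in>S. cinner UNIV (e k) v = 0)
    \<and> appl UNIV A v = (\<lambda>i. complex_of_real r * v i)"
proof -
  let ?d = "real (card (UNIV :: 'i set)) - real (card S)"
  define t where "t = trace_on UNIV A - (\<Sum>k\<in>S. complex_of_real (l k))"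
  \<comment> \<open>\<open>t\<close> is the sum of the eigenvalues still to be found and
    \<open>?d\<close> their number, so \<open>Re t / ?d\<close> is their mean; adding 1 moves
    \<open>c\<close> away from it.\<close>
  define c where "c = Re t / ?d + 1"
  have d: "?d > 0" using card by simp
  define B where "B = (\<lambda>i j. A i j + (\<Sum>k\<in>S. complex_of_real (c - l k) * e k i * cnj (e k j)))"
  have nrm: "(\<Sum>i\<in>UNIV. e k i * cnj (e k i)) = 1" if "k \<in> S" for k
  proof -
    have "cinner UNIV (e k) (e k) = 1" using e that by (simp add: orthonormal_def)
    then show ?thesis by (simp add: cinner_def mult.commute)
  qed
  have "trace_on UNIV B = trace_on UNIV A
      + (\<Sum>k\<in>S. complex_of_real (c - l k) * (\<Sum>i\<in>UNIV. e k i * cnj (e k i)))"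
    unfolding trace_on_def B_def sum.distrib sum_distrib_left mult.assoc by (subst sum.swap) simp
  also have "\<dots> = trace_on UNIV A + (\<Sum>k\<in>S. complex_of_real (c - l k))"
    using nrm by simp
  also have "\<dots> = t + complex_of_real (real (card S) * c)"
    by (simp add: t_def sum_subtractf)
  finally have trB: "trace_on UNIV B = t + complex_of_real (real (card S) * c)" .
  have "trace_on UNIV B \<noteq> of_nat (card (UNIV :: 'i set)) * complex_of_real c"
  proof
    assume "trace_on UNIV B = of_nat (card (UNIV :: 'i set)) * complex_of_real c"
    then have "Re t = ?d * c" by (simp add: trB complex_eq_iff algebra_simps)
    moreover have "?d * c = Re t + ?d" using d by (simp add: c_def field_simps)
    ultimately show False using d by simp
  qed
  from exists_eigenvector_avoiding[OF this] obtain r v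
    where r: "r \<noteq> complex_of_real c" and v: "v \<noteq> (\<lambda>_. 0)" and Bv: "appl UNIV B v = (\<lambda>i. r * v i)"
    by blast
  have hB: "hermitian_on UNIV B"
    unfolding hermitian_on_def B_def using hermitian_onD[OF A] by (simp add: mult_ac)
  have applB: "appl UNIV B x = (\<lambda>i. appl UNIV A x i
      + (\<Sum>k\<in>S. complex_of_real (c - l k) * cinner UNIV (e k) x * e k i))" for x
  proof
    fix i
    have "appl UNIV B x i = appl UNIV A x i
        + (\<Sum>j\<in>UNIV. \<Sum>k\<in>S. complex_of_real (c - l k) * e k i * cnj (e k j) * x j)"
      by (simp add: appl_def B_def algebra_simps sum.distrib sum_distrib_right sum_distrib_left)
    also have "(\<Sum>j\<in>UNIV. \<Sum>k\<in>S. complex_of_real (c - l k) * e k i * cnj (e k j) * x j)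
        = (\<Sum>k\<in>S. complex_of_real (c - l k) * cinner UNIV (e k) x * e k i)"
      by (subst sum.swap) (simp add: cinner_def sum_distrib_left sum_distrib_right mult_ac)
    finally show "appl UNIV B x i = appl UNIV A x i
      + (\<Sum>k\<in>S. complex_of_real (c - l k) * cinner UNIV (e k) x * e k i)" .
  qed
  have Be: "appl UNIV B (e m) = (\<lambda>i. complex_of_real c * e m i)" if m: "m \<in> S" for m
  proof
    fix i
    have "appl UNIV B (e m) i = complex_of_real (l m) * e m i
        + (\<Sum>k\<in>S. if k = m then complex_of_real (c - l k) * e k i else 0)"
      unfolding applB ev[OF m] using e m by (auto simp: orthonormal_def intro!: sum.cong)
    then show "appl UNIV B (e m) i = complex_of_real c * e m i"
      using fin m by (simp add: algebra_simps)
  qed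
  \<comment> \<open>Since \<open>c\<close> is real, moving \<open>B\<close> across the inner product
    compares \<open>c\<close> with \<open>r\<close>. That \<open>r\<close> is real follows only
    later, from \<open>A\<close> being Hermitian.\<close>
  have orth: "cinner UNIV (e k) v = 0" if k: "k \<in> S" for k
  proof -
    have "complex_of_real c * cinner UNIV (e k) v = cinner UNIV (appl UNIV B (e k)) v"
      unfolding Be[OF k] by (simp add: cinner_def sum_distrib_left mult_ac)
    also have "\<dots> = cinner UNIV (e k) (appl UNIV B v)" by (rule cinner_appl[OF hB])
    also have "\<dots> = r * cinner UNIV (e k) v"
      unfolding Bv by (simp add: cinner_def sum_distrib_left mult_ac)
    finally show ?thesis using r by simp
  qed
  \<comment> \<open>On vectors orthogonal to the old eigenvectors the deflation term vanishes, so
    that \<open>A\<close> and \<open>B\<close> agree on \<open>v\<close>.\<close>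
  have Av: "appl UNIV A v = (\<lambda>i. r * v i)"
  proof
    fix i
    have "(\<Sum>k\<in>S. complex_of_real (c - l k) * cinner UNIV (e k) v * e k i) = 0"
      by (rule sum.neutral) (simp add: orth)
    then show "appl UNIV A v i = r * v i"
      using fun_cong[OF applB, of v i] fun_cong[OF Bv, of i] by simp
  qed
  obtain i where i: "v i \<noteq> 0" using v by auto
  have "0 < (cmod (v i))\<^sup>2" using i by simp
  also have "\<dots> \<le> nsq UNIV v" unfolding nsq_def by (rule member_le_sum) auto
  finally have npos: "0 < nsq UNIV v" .
  have "cnj r * of_real (nsq UNIV v) = cinner UNIV (appl UNIV A v) v"
    unfolding Av by (simp add: cinner_self[symmetric] cinner_def sum_distrib_left mult_ac)
  also have "\<dots> = cinner UNIV v (appl UNIV A v)" by (rule cinner_appl[OF A])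
  also have "\<dots> = r * of_real (nsq UNIV v)"
    unfolding Av by (simp add: cinner_self[symmetric] cinner_def sum_distrib_left mult_ac)
  finally have "cnj r = r" using npos by simp
  then have rr: "complex_of_real (Re r) = r" by (simp add: complex_eq_iff)
  define a where "a = complex_of_real (1 / sqrt (nsq UNIV v))"
  have "nsq UNIV (\<lambda>i. a * v i) = 1"
    using npos by (simp add: nsq_def a_def norm_mult norm_divide power_mult_distrib power_divide flip: sum_divide_distrib)
  moreover have "cinner UNIV (e k) (\<lambda>i. a * v i) = a * cinner UNIV (e k) v" for k
    by (simp add: cinner_def sum_distrib_left mult_ac)
  moreover have "appl UNIV A (\<lambda>i. a * v i) = (\<lambda>i. complex_of_real (Re r) * (a * v i))"
  proof -
    have "appl UNIV A (\<lambda>i. a * v i) = (\<lambda>i. a * appl UNIV A v i)"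
      by (simp add: appl_def sum_distrib_left mult_ac)
    then show ?thesis by (simp add: Av rr mult_ac)
  qed
  ultimately show ?thesis using orth by (intro exI[of _ "\<lambda>i. a * v i"] exI[of _ "Re r"]) simp
qed

text \<open>The basis type doubles as the index type of the eigenvectors: induction over its finite
  subsets adds one vector at a time, and at \<open>UNIV\<close> the family has as many members as
  the dimension.\<close>

lemma hermitian_eigenbasis:
  fixes A :: "'i::finite op" and S :: "'i set"
  assumes A: "hermitian_on UNIV A"
  shows "\<exists>(e :: 'i \<Rightarrow> 'i \<Rightarrow> complex) l. orthonormal UNIV S e \<and>
    (\<forall>k\<in>S. appl UNIV A (e k) = (\<lambda>i. complex_of_real (l k) * e k i))"
  using finite[of S]
proof (induction S rule: finite_induct)
  case empty
  show ?case by (simp add: orthonormal_def)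
next
  case (insert x S)
  then obtain e :: "'i \<Rightarrow> 'i \<Rightarrow> complex" and l where e: "orthonormal UNIV S e"
    and ev: "\<And>k. k \<in> S \<Longrightarrow> appl UNIV A (e k) = (\<lambda>i. complex_of_real (l k) * e k i)"
    by blast
  have "card S < card (UNIV :: 'i set)"
    using insert by (intro psubset_card_mono) auto
  from hermitian_extend_eigenvectors[OF A e ev insert(1) this] obtain v r
    where v: "nsq UNIV v = 1" "\<And>k. k \<in> S \<Longrightarrow> cinner UNIV (e k) v = 0"
      "appl UNIV A v = (\<lambda>i. complex_of_real r * v i)" by auto
  have v': "cinner UNIV v (e k) = 0" if "k \<in> S" for k
    using v(2)[OF that] cinner_commute[of UNIV v "e k"] by simp
  have "cinner UNIV v v = 1" using v(1) by (simp add: cinner_self)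
  then have "orthonormal UNIV (insert x S) (e(x := v))"
    using e v v' insert(2) by (auto simp: orthonormal_def)
  moreover have "\<forall>k\<in>insert x S. appl UNIV A ((e(x := v)) k) = (\<lambda>i. complex_of_real ((l(x := r)) k) * (e(x := v)) k i)"
    using ev v(3) insert(2) by auto
  ultimately show ?case by blast
qed

text \<open>For square matrices a left inverse is a right inverse. Orthonormality is the first
  equation, and the second yields the resolution of the identity.\<close>

lemma orthonormal_unitary:
  fixes e :: "'i::finite \<Rightarrow> 'i \<Rightarrow> complex"
  assumes e: "orthonormal UNIV UNIV e"
  defines "U \<equiv> to_mat (\<lambda>i k. e k i)" and "V \<equiv> to_mat (\<lambda>k i. cnj (e k i))"
  shows "V * U = 1\<^sub>m (card (UNIV :: 'i set))" "U * V = 1\<^sub>m (card (UNIV :: 'i set))"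
proof -
  let ?n = "card (UNIV :: 'i set)"
  have c: "V \<in> carrier_mat ?n ?n" "U \<in> carrier_mat ?n ?n"
    by (simp_all add: U_def V_def to_mat_carrier)
  show 1: "V * U = 1\<^sub>m ?n"
  proof (rule eq_matI)
    fix r s assume "r < dim_row (1\<^sub>m ?n)" "s < dim_col (1\<^sub>m ?n)"
    then have rs: "r < ?n" "s < ?n" by auto
    have "(V * U) $$ (r, s) = (\<Sum>k<?n. cnj (e (basis_enum r) (basis_enum k)) * e (basis_enum s) (basis_enum k))"
      using rs by (simp add: U_def V_def to_mat_def scalar_prod_def atLeast0LessThan)
    also have "\<dots> = cinner UNIV (e (basis_enum r)) (e (basis_enum s))"
      by (simp add: cinner_def sum_basis_enum[of "\<lambda>i. cnj (e (basis_enum r) i) * e (basis_enum s) i"])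
    also have "\<dots> = 1\<^sub>m ?n $$ (r, s)"
      using e rs by (simp add: orthonormal_def basis_enum_eq_iff)
    finally show "(V * U) $$ (r, s) = 1\<^sub>m ?n $$ (r, s)" .
  qed (use c in auto)
  show "U * V = 1\<^sub>m ?n" using mat_mult_left_right_inverse[OF c 1] .
qed

lemma orthonormal_completeness:
  fixes e :: "'i::finite \<Rightarrow> 'i \<Rightarrow> complex"
  assumes e: "orthonormal UNIV UNIV e"
  shows "(\<Sum>k\<in>UNIV. e k i * cnj (e k j)) = (if i = j then 1 else 0)"
proof -
  let ?n = "card (UNIV :: 'i set)"
  obtain r s where rs: "r < ?n" "s < ?n" "i = basis_enum r" "j = basis_enum s"
    using bij_betw_basis_enum[where 'i = 'i] unfolding bij_betw_def
    by (metis UNIV_I image_iff lessThan_iff)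
  have "(to_mat (\<lambda>i k. e k i) * to_mat (\<lambda>k i. cnj (e k i))) $$ (r, s) = 1\<^sub>m ?n $$ (r, s)"
    using orthonormal_unitary(2)[OF e] by simp
  then have "(\<Sum>k<?n. e (basis_enum k) i * cnj (e (basis_enum k) j)) = (if i = j then 1 else 0)"
    using rs by (simp add: to_mat_def scalar_prod_def atLeast0LessThan basis_enum_eq_iff)
  then show ?thesis by (simp add: sum_basis_enum[of "\<lambda>k. e k i * cnj (e k j)"])
qed

theorem spectral_decomposition:
  fixes A :: "'i::finite op"
  assumes A: "hermitian_on UNIV A"
  shows "\<exists>(e :: 'i \<Rightarrow> 'i \<Rightarrow> complex) l. orthonormal UNIV UNIV e \<and>
    (\<forall>i j. A i j = (\<Sum>k\<in>UNIV. complex_of_real (l k) * e k i * cnj (e k j)))"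
proof -
  obtain e :: "'i \<Rightarrow> 'i \<Rightarrow> complex" and l where e: "orthonormal UNIV UNIV e"
    and ev: "\<And>k. appl UNIV A (e k) = (\<lambda>i. complex_of_real (l k) * e k i)"
    using hermitian_eigenbasis[OF A, of UNIV] by auto
  have "A i j = (\<Sum>k\<in>UNIV. complex_of_real (l k) * e k i * cnj (e k j))" for i j
  proof -
    have "A i j = (\<Sum>m\<in>UNIV. A i m * (if m = j then 1 else 0))"
      by (simp add: if_distrib[of "(*) _"] cong: if_cong)
    also have "\<dots> = (\<Sum>m\<in>UNIV. \<Sum>k\<in>UNIV. A i m * (e k m * cnj (e k j)))"
      unfolding orthonormal_completeness[OF e, symmetric] sum_distrib_left ..
    also have "\<dots> = (\<Sum>k\<in>UNIV. appl UNIV A (e k) i * cnj (e k j))"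
      unfolding appl_def sum_distrib_right by (subst sum.swap) (simp add: mult.assoc)
    finally show ?thesis by (simp add: ev)
  qed
  with e show ?thesis by blast
qed

section \<open>Entropy as a function of the spectrum\<close>

lemma sum_order_prod_linear:
  fixes as :: "'a::field list" and h :: "'a \<Rightarrow> real"
  assumes "finite S" "set as \<subseteq> S"
  shows "(\<Sum>z\<in>S. real (Polynomial.order z (\<Prod>a\<leftarrow>as. [:- a, 1:])) * h z) = (\<Sum>a\<leftarrow>as. h a)"
  using assms(2)
proof (induction as)
  case (Cons a as)
  have nz: "(\<Prod>a\<leftarrow>as. [:- a, 1:]) \<noteq> 0" for as :: "'a list"
    by (induction as) (auto simp del: mult_pCons_left)
  have o: "Polynomial.order z [:- a, 1:] = (if z = a then 1 else 0)" for z
    using order_power_n_n[of a 1] by (auto intro!: order_0I)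
  have "real (Polynomial.order z (\<Prod>a\<leftarrow>a # as. [:- a, 1:])) * h z
      = (if z = a then h a else 0) + real (Polynomial.order z (\<Prod>a\<leftarrow>as. [:- a, 1:])) * h z" for z
    using nz[of as] nz[of "a # as"] by (simp add: order_mult o algebra_simps del: mult_pCons_left)
  then show ?case using Cons assms(1) by (simp add: sum.distrib)
qed simp

text \<open>The entropy is defined through roots of the characteristic polynomial with their
  multiplicities. A unitary similarity to the diagonal matrix of the \<open>l k\<close> turns this
  into a sum over whichever eigenbasis is at hand, repeated eigenvalues included.\<close>

lemma vn_entropy_spectral:
  fixes A :: "'i::finite op" and e :: "'i \<Rightarrow> 'i \<Rightarrow> complex"
  assumes e: "orthonormal UNIV UNIV e"
    and A: "\<And>i j. A i j = (\<Sum>k\<in>UNIV. complex_of_real (l k) * e k i * cnj (e k j))"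
  shows "vn_entropy A = (\<Sum>k\<in>UNIV. eta (l k))"
proof -
  let ?n = "card (UNIV :: 'i set)"
  let ?U = "to_mat (\<lambda>i k. e k i)" and ?V = "to_mat (\<lambda>k i. cnj (e k i))"
  let ?D = "to_mat (\<lambda>i k. if i = k then complex_of_real (l i) else 0 :: complex)"
  let ?as = "map (\<lambda>r. complex_of_real (l (basis_enum r))) [0..<?n]"
  have "to_mat A = ?U * ?D * ?V"
  proof (rule eq_matI)
    fix r s assume "r < dim_row (?U * ?D * ?V)" "s < dim_col (?U * ?D * ?V)"
    then have rs: "r < ?n" "s < ?n" by (auto simp: to_mat_def)
    have "(?U * ?D * ?V) $$ (r, s) = (\<Sum>k<?n. (\<Sum>m<?n. e (basis_enum m) (basis_enum r) *
        (if basis_enum m = (basis_enum k :: 'i) then complex_of_real (l (basis_enum m)) else 0)) *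
        cnj (e (basis_enum k) (basis_enum s)))"
      using rs by (simp add: to_mat_def scalar_prod_def atLeast0LessThan)
    also have "\<dots> = (\<Sum>k<?n. (\<Sum>m<?n. if m = k then e (basis_enum m) (basis_enum r) *
         complex_of_real (l (basis_enum m)) else 0) * cnj (e (basis_enum k) (basis_enum s)))"
      by (intro sum.cong arg_cong2[of _ _ _ _ "(*)"] refl) (simp add: basis_enum_eq_iff)
    also have "\<dots> = (\<Sum>k<?n. complex_of_real (l (basis_enum k)) * e (basis_enum k) (basis_enum r) *
        cnj (e (basis_enum k) (basis_enum s)))"
      by (intro sum.cong refl) (simp add: mult_ac)
    also have "\<dots> = A (basis_enum r) (basis_enum s)"
      unfolding A by (rule sum_basis_enum)
    finally show "to_mat A $$ (r, s) = (?U * ?D * ?V) $$ (r, s)"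
      using rs by (simp add: to_mat_def)
  qed (auto simp: to_mat_def)
  then have "similar_mat_wit (to_mat A) ?D ?U ?V"
    using orthonormal_unitary[OF e] by (intro similar_mat_witI[of _ _ ?n] to_mat_carrier) auto
  then have "similar_mat (to_mat A) ?D" by (auto simp: similar_mat_def)
  then have "char_poly (to_mat A) = char_poly ?D" by (rule char_poly_similar)
  also have "\<dots> = (\<Prod>a\<leftarrow>diag_mat ?D. [:- a, 1:])"
    by (rule char_poly_upper_triangular[OF to_mat_carrier])
      (auto simp: upper_triangular_def to_mat_def basis_enum_eq_iff)
  also have "diag_mat ?D = ?as"
    by (simp add: diag_mat_def to_mat_def)
  finally have P: "char_poly (to_mat A) = (\<Prod>a\<leftarrow>?as. [:- a, 1:])" .
  have root: "poly (\<Prod>a\<leftarrow>bs. [:- a, 1:]) z = 0 \<longleftrightarrow> z \<in> set bs" for bs and z :: complex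
    by (induction bs) auto
  have "vn_entropy A = (\<Sum>z\<in>set ?as. real (Polynomial.order z (\<Prod>a\<leftarrow>?as. [:- a, 1:])) * eta (Re z))"
    unfolding vn_entropy_def Let_def P root by simp
  also have "\<dots> = (\<Sum>a\<leftarrow>?as. eta (Re a))"
    by (rule sum_order_prod_linear) auto
  also have "\<dots> = (\<Sum>r<?n. eta (l (basis_enum r)))"
    by (simp add: sum_list_distinct_conv_sum_set atLeast0LessThan o_def)
  also have "\<dots> = (\<Sum>k\<in>UNIV. eta (l k))"
    by (rule sum_basis_enum)
  finally show ?thesis .
qed

lemma psd_spectral_nonneg:
  assumes psd: "psd_on C A" and e: "orthonormal C K e" and fin: "finite C" "finite K"
    and A: "\<And>i j. i \<in> C \<Longrightarrow> j \<in> C \<Longrightarrow> A i j = (\<Sum>k\<in>K. complex_of_real (l k) * e k i * cnj (e k j))"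
    and k: "k \<in> K"
  shows "0 \<le> l k"
proof -
  have "cinner C (e k) (appl C A (e k)) = (\<Sum>i\<in>C. \<Sum>j\<in>C. \<Sum>m\<in>K. cnj (e k i) * (complex_of_real (l m) * e m i * cnj (e m j)) * e k j)"
    by (simp add: cinner_def appl_def A sum_distrib_left sum_distrib_right mult.assoc)
  also have "\<dots> = (\<Sum>i\<in>C. \<Sum>m\<in>K. \<Sum>j\<in>C. cnj (e k i) * (complex_of_real (l m) * e m i * cnj (e m j)) * e k j)"
    by (intro sum.cong refl sum.swap)
  also have "\<dots> = (\<Sum>m\<in>K. \<Sum>i\<in>C. \<Sum>j\<in>C. cnj (e k i) * (complex_of_real (l m) * e m i * cnj (e m j)) * e k j)"
    by (rule sum.swap)
  also have "\<dots> = (\<Sum>m\<in>K. complex_of_real (l m) * (cinner C (e k) (e m) * cinner C (e m) (e k)))"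
    unfolding cinner_def sum_product unfolding sum_distrib_left by (intro sum.cong refl) (simp add: mult_ac)
  also have "\<dots> = (\<Sum>m\<in>K. if m = k then complex_of_real (l m) else 0)"
    using e k by (intro sum.cong refl) (auto simp: orthonormal_def)
  also have "\<dots> = complex_of_real (l k)" using fin k by simp
  finally show ?thesis using psd unfolding psd_on_quadratic by (metis Re_complex_of_real)
qed

lemma density_op_spectral:
  fixes A :: "'i::finite op"
  assumes A: "density_op A"
  shows "\<exists>(e :: 'i \<Rightarrow> 'i \<Rightarrow> complex) l. orthonormal UNIV UNIV e \<and> (\<forall>k. 0 \<le> l k) \<and> (\<Sum>k\<in>UNIV. l k) = 1 \<and>
    (\<forall>i j. A i j = (\<Sum>k\<in>UNIV. complex_of_real (l k) * e k i * cnj (e k j)))"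
proof -
  have psd: "psd_on UNIV A" and tr: "trace_on UNIV A = 1" using A by (auto simp: density_op_def)
  obtain e :: "'i \<Rightarrow> 'i \<Rightarrow> complex" and l where e: "orthonormal UNIV UNIV e"
    and Ae: "\<And>i j. A i j = (\<Sum>k\<in>UNIV. complex_of_real (l k) * e k i * cnj (e k j))"
    using spectral_decomposition[OF psd_on_imp_hermitian_on[OF _ psd]] by auto
  have "trace_on UNIV A = (\<Sum>k\<in>UNIV. complex_of_real (l k) * cinner UNIV (e k) (e k))"
    unfolding trace_on_def Ae cinner_def sum_distrib_left by (subst sum.swap) (simp add: mult_ac)
  also have "\<dots> = complex_of_real (\<Sum>k\<in>UNIV. l k)"
    using e by (simp add: orthonormal_def)
  finally have "(\<Sum>k\<in>UNIV. l k) = 1" using tr by (metis of_real_eq_1_iff)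
  moreover have "\<forall>k. 0 \<le> l k"
    using psd_spectral_nonneg[OF psd e _ _ Ae] by auto
  ultimately show ?thesis using e Ae by blast
qed

section \<open>Sequential measurements\<close>

lemma cinner_cong: "(\<And>i. i \<in> C \<Longrightarrow> u i = u' i) \<Longrightarrow> (\<And>i. i \<in> C \<Longrightarrow> v i = v' i) \<Longrightarrow> cinner C u v = cinner C u' v'"
  by (simp add: cinner_def)

lemma nsq_cong: "(\<And>i. i \<in> C \<Longrightarrow> v i = v' i) \<Longrightarrow> nsq C v = nsq C v'"
  by (simp add: nsq_def)

lemma appl_cong: "(\<And>i. i \<in> C \<Longrightarrow> v i = v' i) \<Longrightarrow> appl C A v = appl C A v'"
  by (simp add: appl_def)

lemma cinner_diff_right: "cinner C u (\<lambda>i. v i - w i) = cinner C u v - cinner C u w"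
  by (simp add: cinner_def algebra_simps sum_subtractf)

lemma cinner_diff_left: "cinner C (\<lambda>i. v i - w i) u = cinner C v u - cinner C w u"
  by (simp add: cinner_def algebra_simps sum_subtractf)

lemma cinner_sum_right: "cinner C u (\<lambda>i. \<Sum>a\<in>S. z a * f a i) = (\<Sum>a\<in>S. z a * cinner C u (f a))"
  unfolding cinner_def sum_distrib_left by (subst sum.swap) (simp add: mult_ac)

lemma appl_diff: "appl C A (\<lambda>i. v i - w i) = (\<lambda>i. appl C A v i - appl C A w i)"
  by (simp add: appl_def algebra_simps sum_subtractf)

lemma appl_sum: "appl C A (\<lambda>i. \<Sum>a\<in>S. z a * f a i) = (\<lambda>i. \<Sum>a\<in>S. z a * appl C A (f a) i)"
  unfolding appl_def sum_distrib_left by (rule ext, subst sum.swap) (simp add: mult_ac)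

lemma cinner_cauchy_schwarz: "cmod (cinner C u v) \<le> sqrt (nsq C u) * sqrt (nsq C v)"
proof -
  have "cmod (cinner C u v) \<le> (\<Sum>i\<in>C. \<bar>cmod (u i)\<bar> * \<bar>cmod (v i)\<bar>)"
    unfolding cinner_def by (rule order_trans[OF norm_sum]) (simp add: norm_mult)
  also have "\<dots> \<le> L2_set (\<lambda>i. cmod (u i)) C * L2_set (\<lambda>i. cmod (v i)) C"
    by (rule L2_set_mult_ineq)
  finally show ?thesis by (simp add: L2_set_def nsq_def)
qed

section \<open>Projectors and the quantum union bound\<close>

definition projector_on :: "'i set \<Rightarrow> 'i op \<Rightarrow> bool" where
  "projector_on C P \<longleftrightarrow> hermitian_on C P \<and>
    (\<forall>i\<in>C. \<forall>j\<in>C. (\<Sum>k\<in>C. P i k * P k j) = P i j)"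

lemma projector_idem:
  assumes "projector_on C P" "i \<in> C"
  shows "appl C P (appl C P v) i = appl C P v i"
proof -
  have "appl C P (appl C P v) i = (\<Sum>k\<in>C. (\<Sum>j\<in>C. P i j * P j k) * v k)"
    unfolding appl_def sum_distrib_left sum_distrib_right
    by (subst sum.swap) (simp add: mult.assoc)
  also have "\<dots> = appl C P v i"
    unfolding appl_def using assms by (intro sum.cong) (auto simp: projector_on_def)
  finally show ?thesis .
qed

lemma projector_cinner:
  assumes P: "projector_on C P"
  shows "cinner C (appl C P u) (appl C P v) = cinner C u (appl C P v)"
proof -
  have h: "hermitian_on C P" using P by (simp add: projector_on_def)
  have "cinner C (appl C P u) (appl C P v) = cinner C u (appl C P (appl C P v))"
    by (rule cinner_appl[OF h])
  also have "\<dots> = cinner C u (appl C P v)"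
    unfolding cinner_def by (rule sum.cong) (simp_all add: projector_idem[OF P])
  finally show ?thesis .
qed

lemma projector_compl_cinner:
  assumes P: "projector_on C P"
  shows "cinner C (\<lambda>i. u i - appl C P u i) (\<lambda>i. v i - appl C P v i) = cinner C u (\<lambda>i. v i - appl C P v i)"
proof -
  have h: "hermitian_on C P" using P by (simp add: projector_on_def)
  show ?thesis
    using projector_cinner[OF P, of u v]
    by (simp add: cinner_diff_left cinner_diff_right cinner_appl[OF h])
qed

lemma projector_cinner_split:
  assumes P: "projector_on C P"
  shows "cinner C u v = cinner C (appl C P u) (appl C P v)
      + cinner C (\<lambda>i. u i - appl C P u i) (\<lambda>i. v i - appl C P v i)"
  unfolding projector_compl_cinner[OF P] projector_cinner[OF P] by (simp add: cinner_diff_right)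

lemma projector_nsq_split:
  assumes P: "projector_on C P"
  shows "nsq C v = nsq C (appl C P v) + nsq C (\<lambda>i. v i - appl C P v i)"
  using projector_cinner_split[OF P, of v v] unfolding cinner_self
  by (metis of_real_add of_real_eq_iff)

text \<open>Gao's quantum union bound, obtained from the telescoping identity
  \<open>\<langle>v\<^sub>0, v\<^sub>0 - v\<^sub>m\<rangle> = (\<Sum>i<m. \<langle>(1 - R\<^sub>i) v\<^sub>0, (1 - R\<^sub>i) v\<^sub>i\<rangle>)\<close> and two applications of Cauchy-Schwarz.\<close>

lemma quantum_union_bound:
  assumes R: "\<And>i. i < m \<Longrightarrow> projector_on C (R i)"
    and v: "\<And>i x. i < m \<Longrightarrow> x \<in> C \<Longrightarrow> v (Suc i) x = appl C (R i) (v i) x"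
  shows "nsq C (v 0) - nsq C (v m) \<le> 4 * (\<Sum>i<m. nsq C (\<lambda>x. v 0 x - appl C (R i) (v 0) x))"
proof -
  define b where "b i = (\<lambda>x. v 0 x - appl C (R i) (v 0) x)" for i
  define d where "d i = (\<lambda>x. v i x - appl C (R i) (v i) x)" for i
  define B where "B = (\<Sum>i<m. nsq C (b i))"
  define D where "D = (\<Sum>i<m. nsq C (d i))"
  define N where "N k = nsq C (v k)" for k
  have dv: "d i x = v i x - v (Suc i) x" if "i < m" "x \<in> C" for i x
    using v that by (simp add: d_def)
  have "nsq C (d i) = N i - N (Suc i)" if "i < m" for i
    using projector_nsq_split[OF R[OF that], of "v i"] nsq_cong[OF v[OF that], of C "\<lambda>x. x"] v that
    unfolding N_def d_def by (simp add: nsq_cong[of C "v (Suc i)" "appl C (R i) (v i)"])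
  \<comment> \<open>The squared norm of the part removed in a step is the loss of squared norm in
    that step, so the losses telescope.\<close>
  then have D: "D = N 0 - N m"
    unfolding D_def by (simp add: sum_lessThan_telescope')
  have "(\<Sum>i<m. cinner C (v 0) (d i)) = (\<Sum>i<m. cinner C (v 0) (v i) - cinner C (v 0) (v (Suc i)))"
    by (intro sum.cong refl, subst cinner_diff_right[symmetric]) (auto intro!: cinner_cong simp: dv)
  also have "\<dots> = of_real (N 0) - cinner C (v 0) (v m)"
    using sum_lessThan_telescope'[of "\<lambda>i. cinner C (v 0) (v i)" m] by (simp add: N_def cinner_self)
  finally have tel: "of_real (N 0) - cinner C (v 0) (v m) = (\<Sum>i<m. cinner C (v 0) (d i))" ..
  have "cinner C (v 0) (d i) = cinner C (b i) (d i)" if "i < m" for i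
    unfolding d_def b_def using projector_compl_cinner[OF R[OF that]] by simp
  then have eq: "(\<Sum>i<m. cinner C (v 0) (d i)) = (\<Sum>i<m. cinner C (b i) (d i))"
    by (intro sum.cong) auto
  have LB: "L2_set (\<lambda>i. sqrt (nsq C (b i))) {..<m} = sqrt B"
    and LD: "L2_set (\<lambda>i. sqrt (nsq C (d i))) {..<m} = sqrt D"
    by (simp_all add: L2_set_def B_def D_def nsq_nonneg)
  have le: "cmod (cinner C (b i) (d i)) \<le> \<bar>sqrt (nsq C (b i))\<bar> * \<bar>sqrt (nsq C (d i))\<bar>" for i
    using cinner_cauchy_schwarz[of C "b i" "d i"] nsq_nonneg[of C "b i"] nsq_nonneg[of C "d i"] by simp
  have up: "cmod (\<Sum>i<m. cinner C (v 0) (d i)) \<le> sqrt B * sqrt D"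
    unfolding eq LB[symmetric] LD[symmetric]
    by (rule order_trans[OF norm_sum order_trans[OF sum_mono[OF le] L2_set_mult_ineq]])
  define a where "a = sqrt (N 0)"
  define t where "t = sqrt (N m)"
  have N0: "N k \<ge> 0" for k by (simp add: N_def nsq_nonneg)
  have B0: "B \<ge> 0" and D0: "D \<ge> 0" by (simp_all add: B_def D_def nsq_nonneg sum_nonneg)
  have at: "0 \<le> t" "t \<le> a" "N 0 = a * a" "N m = t * t"
    using N0 D D0 by (auto simp: a_def t_def)
  have cs: "cmod (cinner C (v 0) (v m)) \<le> a * t"
    using cinner_cauchy_schwarz[of C "v 0" "v m"] by (simp add: a_def t_def N_def)
  have "N 0 - cmod (cinner C (v 0) (v m)) \<le> Re (of_real (N 0) - cinner C (v 0) (v m))"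
    using complex_Re_le_cmod[of "cinner C (v 0) (v m)"] by simp
  also have "\<dots> \<le> cmod (\<Sum>i<m. cinner C (v 0) (d i))"
    unfolding tel by (rule complex_Re_le_cmod)
  finally have "a * a - a * t \<le> sqrt B * sqrt D"
    using up cs at(3) by linarith
  then have "a * (a - t) \<le> sqrt B * sqrt D" by (simp only: right_diff_distrib)
  moreover have "0 \<le> a * (a - t)" using at by (intro mult_nonneg_nonneg) auto
  \<comment> \<open>As \<open>D = (a + t) * (a - t)\<close> and \<open>t \<le> a\<close>, the
    right-hand side is at most \<open>2 * B * (a * (a - t))\<close>. Cancelling one factor gives
    \<open>a * (a - t) \<le> 2 * B\<close>, and \<open>D \<le> 2 * a * (a - t)\<close> then produces
    the constant 4.\<close>
  ultimately have "(a * (a - t))\<^sup>2 \<le> (sqrt B * sqrt D)\<^sup>2"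
    by (intro power_mono)
  also have "\<dots> = B * D" using B0 D0 by (simp add: power_mult_distrib)
  also have "\<dots> = B * (a + t) * (a - t)" by (simp add: D at algebra_simps)
  also have "\<dots> \<le> B * (2 * a) * (a - t)"
    using at B0 by (intro mult_right_mono mult_left_mono) auto
  finally have *: "(a * (a - t)) * (a * (a - t)) \<le> (2 * B) * (a * (a - t))"
    by (simp add: power2_eq_square algebra_simps)
  have "a * (a - t) \<le> 2 * B"
  proof (cases "a * (a - t) > 0")
    case True
    then show ?thesis using * by (metis mult_le_cancel_right_pos)
  next
    case False
    then show ?thesis using B0 by linarith
  qed
  moreover have "(a + t) * (a - t) \<le> (2 * a) * (a - t)"
    using at by (intro mult_right_mono) auto
  ultimately have "N 0 - N m \<le> 4 * B"
    by (simp add: at algebra_simps)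
  then show ?thesis by (simp add: N_def B_def b_def)
qed

text \<open>The state vector after the test \<open>T\<close> and after the outcomes of the tests \<open>P 0, \<dots>, P (k - 1)\<close>
  have all been negative.\<close>

primrec seq_vec :: "'i set \<Rightarrow> 'i op \<Rightarrow> (nat \<Rightarrow> 'i op) \<Rightarrow> nat \<Rightarrow> ('i \<Rightarrow> complex) \<Rightarrow> 'i \<Rightarrow> complex" where
  "seq_vec C T P 0 v = appl C T v"
| "seq_vec C T P (Suc k) v = (\<lambda>i. seq_vec C T P k v i - appl C (P k) (seq_vec C T P k v) i)"

section \<open>Outcome operators and error of the sequential decoder\<close>

definition ket :: "'i \<Rightarrow> 'i \<Rightarrow> complex" where
  "ket a = (\<lambda>i. if i = a then 1 else 0)"

text \<open>This is \<open>K* K\<close> for \<open>K = P l (1 - P (l - 1)) ... (1 - P 0) T\<close>,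
  written as the Gram matrix of the images of the basis vectors, so that positivity is
  visible.\<close>

definition seq_povm :: "'i set \<Rightarrow> 'i op \<Rightarrow> (nat \<Rightarrow> 'i op) \<Rightarrow> nat \<Rightarrow> 'i op" where
  "seq_povm C T P l = (\<lambda>a b. cinner C (appl C (P l) (seq_vec C T P l (ket a))) (appl C (P l) (seq_vec C T P l (ket b))))"

text \<open>The two summands are the two ways to obtain no message: all \<open>L\<close> tests are
  negative, or the test \<open>T\<close> has failed before them.\<close>

definition seq_rest :: "'i set \<Rightarrow> 'i op \<Rightarrow> (nat \<Rightarrow> 'i op) \<Rightarrow> nat \<Rightarrow> 'i op" where
  "seq_rest C T P L = (\<lambda>a b. cinner C (seq_vec C T P L (ket a)) (seq_vec C T P L (ket b))
     + cinner C (\<lambda>i. ket a i - appl C T (ket a) i) (\<lambda>i. ket b i - appl C T (ket b) i))"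

lemma vec_ket_expand: "finite C \<Longrightarrow> i \<in> C \<Longrightarrow> v i = (\<Sum>a\<in>C. v a * ket a i)"
  by (simp add: ket_def if_distrib[of "(*) _"] cong: if_cong)

lemma cinner_ket: "finite C \<Longrightarrow> a \<in> C \<Longrightarrow> b \<in> C \<Longrightarrow> cinner C (ket a) (ket b) = (if a = b then 1 else 0)"
  by (simp add: cinner_def ket_def if_distrib[of cnj] if_distrib[of "\<lambda>z. z * _"] cong: if_cong)

lemma seq_vec_sum: "seq_vec C T P k (\<lambda>i. \<Sum>a\<in>S. z a * f a i) = (\<lambda>i. \<Sum>a\<in>S. z a * seq_vec C T P k (f a) i)"
  by (induction k) (simp_all add: appl_sum algebra_simps sum_subtractf)

lemma seq_vec_cong: "(\<And>i. i \<in> C \<Longrightarrow> v i = v' i) \<Longrightarrow> seq_vec C T P k v = seq_vec C T P k v'"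
  by (induction k) (simp_all add: appl_cong[of C v v'])

text \<open>A projector splits every inner product into the parts for its two outcomes. One more
  test thus only splits the first summand of the rest.\<close>

lemma seq_povm_complete:
  assumes fin: "finite C" and T: "projector_on C T" and P: "\<And>l. l < L \<Longrightarrow> projector_on C (P l)"
    and ab: "a \<in> C" "b \<in> C"
  shows "(\<Sum>l<L. seq_povm C T P l a b) + seq_rest C T P L a b = (if a = b then 1 else 0)"
  using P
proof (induction L)
  case 0
  then show ?case
    using projector_cinner_split[OF T, of "ket a" "ket b"] by (simp add: seq_rest_def cinner_ket fin ab)
next
  case (Suc L)
  have "cinner C (seq_vec C T P L (ket a)) (seq_vec C T P L (ket b))
     = seq_povm C T P L a b + cinner C (seq_vec C T P (Suc L) (ket a)) (seq_vec C T P (Suc L) (ket b))"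
    unfolding seq_povm_def
    using projector_cinner_split[OF Suc.prems[of L], of "seq_vec C T P L (ket a)" "seq_vec C T P L (ket b)"]
    by simp
  then show ?case using Suc by (simp add: seq_rest_def algebra_simps)
qed

lemma seq_povm_quadratic:
  assumes fin: "finite C"
  shows "(\<Sum>a\<in>C. \<Sum>b\<in>C. cnj (v a) * seq_povm C T P l a b * v b)
    = of_real (nsq C (appl C (P l) (seq_vec C T P l v)))"
proof -
  let ?f = "\<lambda>v. appl C (P l) (seq_vec C T P l v)"
  have f: "?f v = (\<lambda>i. \<Sum>a\<in>C. v a * ?f (ket a) i)"
    using seq_vec_cong[of C v "\<lambda>i. \<Sum>a\<in>C. v a * ket a i", OF vec_ket_expand[OF fin]]
    by (simp add: seq_vec_sum appl_sum)
  have fx: "cinner C x (?f v) = (\<Sum>b\<in>C. v b * cinner C x (?f (ket b)))" for x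
    by (subst f) (rule cinner_sum_right)
  have "(\<Sum>a\<in>C. \<Sum>b\<in>C. cnj (v a) * seq_povm C T P l a b * v b)
      = (\<Sum>a\<in>C. cnj (v a) * cinner C (?f (ket a)) (?f v))"
    unfolding seq_povm_def fx by (simp add: sum_distrib_left mult_ac)
  also have "\<dots> = cnj (\<Sum>a\<in>C. v a * cinner C (?f v) (?f (ket a)))"
    by (simp flip: cinner_commute)
  also have "(\<Sum>a\<in>C. v a * cinner C (?f v) (?f (ket a))) = cinner C (?f v) (?f v)"
    by (rule fx[symmetric])
  finally show ?thesis by (simp add: cinner_self)
qed

lemma nsq_diff_le: "nsq C (\<lambda>i. u i - v i) \<le> 2 * nsq C u + 2 * nsq C v"
proof -
  have "(cmod (x - y))\<^sup>2 \<le> 2 * (cmod x)\<^sup>2 + 2 * (cmod y)\<^sup>2" for x y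
  proof -
    have "(cmod (x - y))\<^sup>2 \<le> (cmod x + cmod y)\<^sup>2"
      by (intro power_mono norm_triangle_ineq4) simp
    also have "\<dots> \<le> 2 * (cmod x)\<^sup>2 + 2 * (cmod y)\<^sup>2"
      using sum_squares_ge_zero[of "cmod x - cmod y" 0] by (simp add: power2_eq_square algebra_simps)
    finally show ?thesis .
  qed
  then have "nsq C (\<lambda>i. u i - v i) \<le> (\<Sum>i\<in>C. 2 * (cmod (u i))\<^sup>2 + 2 * (cmod (v i))\<^sup>2)"
    unfolding nsq_def by (intro sum_mono)
  also have "\<dots> = 2 * nsq C u + 2 * nsq C v"
    by (simp add: nsq_def sum.distrib sum_distrib_left)
  finally show ?thesis .
qed

definition compl_op :: "'i op \<Rightarrow> 'i op" where
  "compl_op P = (\<lambda>i j. (if i = j then 1 else 0) - P i j)"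

lemma appl_compl_op:
  "finite C \<Longrightarrow> x \<in> C \<Longrightarrow> appl C (compl_op P) v x = v x - appl C P v x"
  by (simp add: appl_def compl_op_def left_diff_distrib sum_subtractf if_distrib[of "\<lambda>z. z * _"] cong: if_cong)

lemma projector_compl_op:
  assumes fin: "finite C" and P: "projector_on C P"
  shows "projector_on C (compl_op P)"
  unfolding projector_on_def
proof (intro conjI ballI)
  show "hermitian_on C (compl_op P)"
    using P hermitian_onD[of C P] unfolding projector_on_def hermitian_on_def[of C "compl_op P"]
    by (simp add: compl_op_def)
  fix i j assume ij: "i \<in> C" "j \<in> C"
  have "(\<Sum>k\<in>C. compl_op P i k * compl_op P k j)
      = (\<Sum>k\<in>C. (if i = k then compl_op P k j else 0) - (if k = j then P i k else 0) + P i k * P k j)"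
    by (intro sum.cong refl) (auto simp: compl_op_def algebra_simps)
  also have "\<dots> = compl_op P i j - P i j + P i j"
    using fin ij P by (simp add: sum.distrib sum_subtractf projector_on_def)
  finally show "(\<Sum>k\<in>C. compl_op P i k * compl_op P k j) = compl_op P i j" by simp
qed

text \<open>The union bound is started at \<open>w = T v\<close> and not at \<open>v\<close>: the
  wrong tests then act on the typical part only, which the packing estimate relies on. Returning to
  \<open>v\<close> costs \<open>nsq C (v - w)\<close> once for the initial norm. In the test
  \<open>P l\<close>, the failing part of \<open>w\<close> is the difference of those of
  \<open>v\<close> and \<open>v - w\<close>, which costs twice both squared norms. With the factor 4
  of the union bound this gives 8 and 1 + 8 = 9.\<close>

lemma seq_povm_error:
  assumes fin: "finite C" and T: "projector_on C T" and P: "\<And>i. i \<le> l \<Longrightarrow> projector_on C (P i)"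
  shows "nsq C v - nsq C (appl C (P l) (seq_vec C T P l v))
    \<le> 9 * nsq C (\<lambda>i. v i - appl C T v i) + 8 * nsq C (\<lambda>i. v i - appl C (P l) v i)
      + 4 * (\<Sum>i<l. nsq C (appl C (P i) (appl C T v)))"
proof -
  define w where "w = appl C T v"
  define R where "R i = (if i < l then compl_op (P i) else P l)" for i
  define s where "s i = (if i \<le> l then seq_vec C T P i v else appl C (P l) (seq_vec C T P l v))" for i
  have s0: "s 0 = w" by (simp add: s_def w_def)
  have bound: "nsq C (s 0) - nsq C (s (Suc l)) \<le> 4 * (\<Sum>i<Suc l. nsq C (\<lambda>x. s 0 x - appl C (R i) (s 0) x))"
  proof (rule quantum_union_bound)
    show "projector_on C (R i)" if "i < Suc l" for i
      using that P by (auto simp: R_def intro: projector_compl_op[OF fin])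
    show "s (Suc i) x = appl C (R i) (s i) x" if "i < Suc l" "x \<in> C" for i x
      using that by (auto simp: s_def R_def appl_compl_op[OF fin] less_Suc_eq)
  qed
  have pos: "nsq C (\<lambda>x. w x - appl C (compl_op (P i)) w x) = nsq C (appl C (P i) w)" for i
    by (rule nsq_cong) (simp add: appl_compl_op[OF fin])
  have eq: "(\<lambda>x. w x - appl C (P l) w x) = (\<lambda>x. (v x - appl C (P l) v x)
      - ((v x - w x) - appl C (P l) (\<lambda>i. v i - w i) x))"
    by (simp add: appl_diff)
  have "nsq C (\<lambda>x. w x - appl C (P l) w x) \<le> 2 * nsq C (\<lambda>x. v x - appl C (P l) v x)
      + 2 * nsq C (\<lambda>x. (v x - w x) - appl C (P l) (\<lambda>i. v i - w i) x)"
    by (subst eq) (rule nsq_diff_le)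
  moreover have "nsq C (\<lambda>x. (v x - w x) - appl C (P l) (\<lambda>i. v i - w i) x) \<le> nsq C (\<lambda>i. v i - w i)"
    using projector_nsq_split[OF P[OF order.refl], of "\<lambda>i. v i - w i"] nsq_nonneg[of C "appl C (P l) (\<lambda>i. v i - w i)"]
    by linarith
  moreover have "nsq C v - nsq C w = nsq C (\<lambda>i. v i - w i)"
    unfolding w_def using projector_nsq_split[OF T, of v] by simp
  moreover have "(\<Sum>i<Suc l. nsq C (\<lambda>x. s 0 x - appl C (R i) (s 0) x))
      = (\<Sum>i<l. nsq C (appl C (P i) w)) + nsq C (\<lambda>x. w x - appl C (P l) w x)"
    by (simp add: R_def s0 pos)
  moreover have "nsq C (s (Suc l)) = nsq C (appl C (P l) (seq_vec C T P l v))"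
    by (simp add: s_def)
  ultimately show ?thesis
    using bound unfolding s0 by (simp add: w_def algebra_simps)
qed

section \<open>Random coding for classical-quantum channels\<close>

definition proj_op :: "'k set \<Rightarrow> ('k \<Rightarrow> 'i \<Rightarrow> complex) \<Rightarrow> 'i op" where
  "proj_op K e = (\<lambda>a b. \<Sum>k\<in>K. e k a * cnj (e k b))"

lemma appl_proj_op: "appl C (proj_op K e) v = (\<lambda>i. \<Sum>k\<in>K. cinner C (e k) v * e k i)"
  unfolding appl_def proj_op_def sum_distrib_right cinner_def
  by (rule ext, subst sum.swap) (simp add: mult_ac)

lemma orthonormal_subset: "orthonormal C K e \<Longrightarrow> K' \<subseteq> K \<Longrightarrow> orthonormal C K' e"
  unfolding orthonormal_def by blast

lemma orthonormal_nsq: "orthonormal C K e \<Longrightarrow> k \<in> K \<Longrightarrow> nsq C (e k) = 1"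
  using cinner_self[of C "e k"] by (simp add: orthonormal_def)

lemma projector_proj_op:
  assumes fin: "finite K" and e: "orthonormal C K e"
  shows "projector_on C (proj_op K e)"
  unfolding projector_on_def
proof (intro conjI ballI)
  show "hermitian_on C (proj_op K e)"
    by (auto simp: hermitian_on_def proj_op_def mult.commute)
  fix i j
  have "(\<Sum>k\<in>C. proj_op K e i k * proj_op K e k j) = appl C (proj_op K e) (\<lambda>k. proj_op K e k j) i"
    by (simp add: appl_def)
  also have "\<dots> = (\<Sum>k\<in>K. cinner C (e k) (\<lambda>x. \<Sum>m\<in>K. cnj (e m j) * e m x) * e k i)"
    unfolding appl_proj_op by (simp add: proj_op_def mult.commute)
  also have "\<dots> = (\<Sum>k\<in>K. (\<Sum>m\<in>K. if k = m then cnj (e m j) else 0) * e k i)"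
    unfolding cinner_sum_right using e
    by (intro sum.cong arg_cong2[of _ _ _ _ "(*)"] refl) (auto simp: orthonormal_def)
  also have "\<dots> = proj_op K e i j"
    using fin by (simp add: proj_op_def mult.commute)
  finally show "(\<Sum>k\<in>C. proj_op K e i k * proj_op K e k j) = proj_op K e i j" .
qed

lemma cmod_cinner_commute: "cmod (cinner C u v) = cmod (cinner C v u)"
  by (subst cinner_commute) simp

lemma nsq_proj_op:
  assumes fin: "finite K" and e: "orthonormal C K e"
  shows "nsq C (appl C (proj_op K e) v) = (\<Sum>k\<in>K. (cmod (cinner C (e k) v))\<^sup>2)"
proof -
  have "complex_of_real (nsq C (appl C (proj_op K e) v)) = cinner C v (appl C (proj_op K e) v)"
    unfolding cinner_self[symmetric] by (rule projector_cinner[OF projector_proj_op[OF assms]])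
  also have "\<dots> = (\<Sum>k\<in>K. cinner C (e k) v * cinner C v (e k))"
    unfolding appl_proj_op by (rule cinner_sum_right)
  also have "\<dots> = (\<Sum>k\<in>K. complex_of_real ((cmod (cinner C (e k) v))\<^sup>2))"
    unfolding complex_norm_square by (simp flip: cinner_commute)
  finally show ?thesis by (simp only: of_real_eq_iff flip: of_real_sum)
qed

text \<open>Both sides are the quadratic form at \<open>h\<close> of one operator, decomposed in two
  ways. This is how a mixture over the eigenvectors of all codeword states is exchanged for the
  eigenbasis of the average state.\<close>

lemma weighted_overlaps_eq:
  assumes eq: "\<And>a b. a \<in> C \<Longrightarrow> b \<in> C \<Longrightarrow>
      (\<Sum>k\<in>K. complex_of_real (l k) * e k a * cnj (e k b)) = (\<Sum>j\<in>J. complex_of_real (m j) * g j a * cnj (g j b))"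
  shows "(\<Sum>k\<in>K. l k * (cmod (cinner C (e k) h))\<^sup>2) = (\<Sum>j\<in>J. m j * (cmod (cinner C (g j) h))\<^sup>2)"
proof -
  have quad: "complex_of_real (\<Sum>k\<in>K. l k * (cmod (cinner C (e k) h))\<^sup>2)
      = (\<Sum>a\<in>C. \<Sum>b\<in>C. cnj (h a) * (\<Sum>k\<in>K. complex_of_real (l k) * e k a * cnj (e k b)) * h b)"
    for K :: "'z set" and l e
  proof -
    have "complex_of_real (\<Sum>k\<in>K. l k * (cmod (cinner C (e k) h))\<^sup>2)
        = (\<Sum>k\<in>K. complex_of_real (l k) * (cinner C h (e k) * cinner C (e k) h))"
      unfolding of_real_sum of_real_mult complex_norm_square by (simp add: mult.commute flip: cinner_commute)
    also have "\<dots> = (\<Sum>k\<in>K. \<Sum>a\<in>C. \<Sum>b\<in>C. cnj (h a) * (complex_of_real (l k) * e k a * cnj (e k b)) * h b)"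
      unfolding cinner_def sum_product unfolding sum_distrib_left by (intro sum.cong refl) (simp add: mult_ac)
    also have "\<dots> = (\<Sum>a\<in>C. \<Sum>k\<in>K. \<Sum>b\<in>C. cnj (h a) * (complex_of_real (l k) * e k a * cnj (e k b)) * h b)"
      by (rule sum.swap)
    also have "\<dots> = (\<Sum>a\<in>C. \<Sum>b\<in>C. \<Sum>k\<in>K. cnj (h a) * (complex_of_real (l k) * e k a * cnj (e k b)) * h b)"
      by (intro sum.cong refl sum.swap)
    finally show ?thesis by (simp only: sum_distrib_left sum_distrib_right)
  qed
  have "complex_of_real (\<Sum>k\<in>K. l k * (cmod (cinner C (e k) h))\<^sup>2)
      = complex_of_real (\<Sum>j\<in>J. m j * (cmod (cinner C (g j) h))\<^sup>2)"
    unfolding quad by (intro sum.cong refl) (simp add: eq)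
  then show ?thesis by (simp only: of_real_eq_iff)
qed

text \<open>The three terms of \<open>seq_povm_error\<close> are averaged over the codebook. The
  first is the weight of the average state outside \<open>T\<close>, the second the weight of the
  output state outside its own test. In the third, a wrong word \<open>c i\<close> is independent of
  the sent \<open>c x\<close>, so averaging over \<open>c x\<close> replaces the sent state by the
  average state. \<open>T\<close> cuts that down to eigenvalues at most \<open>m\<close>, and the
  test of \<open>c i\<close> has rank at most \<open>M\<close>, so each wrong test costs at most
  \<open>m * M\<close>.\<close>

lemma one_shot_packing:
  fixes e :: "'w \<Rightarrow> 'k \<Rightarrow> 'i \<Rightarrow> complex" and l :: "'w \<Rightarrow> 'k \<Rightarrow> real"
  assumes finC: "finite C" and q: "distr_on W q" and finK: "finite KK" and finJ: "finite JJ"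
    and e: "\<And>u. u \<in> W \<Longrightarrow> orthonormal C KK (e u)"
    and l0: "\<And>u k. u \<in> W \<Longrightarrow> k \<in> KK \<Longrightarrow> 0 \<le> l u k" and l1: "\<And>u. u \<in> W \<Longrightarrow> (\<Sum>k\<in>KK. l u k) = 1"
    and g: "orthonormal C JJ g" and \<mu>0: "\<And>j. j \<in> JJ \<Longrightarrow> 0 \<le> \<mu> j"
    and avg: "\<And>a b. a \<in> C \<Longrightarrow> b \<in> C \<Longrightarrow>
      (\<Sum>(u, k)\<in>W \<times> KK. complex_of_real (q u * l u k) * e u k a * cnj (e u k b))
        = (\<Sum>j\<in>JJ. complex_of_real (\<mu> j) * g j a * cnj (g j b))"
    and K: "K \<subseteq> JJ" and m: "\<And>j. j \<in> K \<Longrightarrow> \<mu> j \<le> m" "0 \<le> m"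
    and Ku: "\<And>u. u \<in> W \<Longrightarrow> Ku u \<subseteq> KK" and M: "\<And>u. u \<in> W \<Longrightarrow> real (card (Ku u)) \<le> M"
    and x: "x < L"
  defines "T \<equiv> proj_op K g" and "P \<equiv> \<lambda>c i. proj_op (Ku (c i)) (e (c i))"
  shows "cbE {..<L} W q (\<lambda>c. \<Sum>k\<in>KK. l (c x) k *
        (nsq C (e (c x) k) - nsq C (appl C (P c x) (seq_vec C T (P c) x (e (c x) k)))))
    \<le> 9 * (1 - (\<Sum>j\<in>K. \<mu> j)) + 8 * (\<Sum>u\<in>W. q u * (\<Sum>k\<in>KK - Ku u. l u k)) + 4 * real (L - 1) * (m * M)"
proof -
  have finW: "finite W" and q0: "\<And>u. u \<in> W \<Longrightarrow> 0 \<le> q u" and q1: "(\<Sum>u\<in>W. q u) = 1"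
    using q by (auto simp: distr_on_def)
  have fK: "finite K" and fKu: "\<And>u. u \<in> W \<Longrightarrow> finite (Ku u)"
    using finite_subset[OF K finJ] finite_subset[OF Ku finK] by auto
  have gK: "orthonormal C K g" using orthonormal_subset[OF g K] .
  have eKu: "orthonormal C (Ku u) (e u)" if "u \<in> W" for u
    using orthonormal_subset[OF e[OF that] Ku[OF that]] .
  have T: "projector_on C T" unfolding T_def by (rule projector_proj_op[OF fK gK])
  have Pp: "projector_on C (proj_op (Ku u) (e u))" if "u \<in> W" for u
    using projector_proj_op[OF fKu[OF that] eKu[OF that]] .
  define F1 where "F1 u = (\<Sum>k\<in>KK. l u k * nsq C (\<lambda>i. e u k i - appl C T (e u k) i))" for u
  define F2 where "F2 u = (\<Sum>k\<in>KK. l u k * nsq C (\<lambda>i. e u k i - appl C (proj_op (Ku u) (e u)) (e u k) i))" for u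
  define F3 where "F3 v u = (\<Sum>k\<in>KK. l u k * nsq C (appl C (proj_op (Ku v) (e v)) (appl C T (e u k))))" for v u
  have ov: "(\<Sum>u\<in>W. q u * (\<Sum>k\<in>KK. l u k * (cmod (cinner C (e u k) h))\<^sup>2)) = (\<Sum>j\<in>JJ. \<mu> j * (cmod (cinner C (g j) h))\<^sup>2)" for h
  proof -
    have "(\<Sum>u\<in>W. q u * (\<Sum>k\<in>KK. l u k * (cmod (cinner C (e u k) h))\<^sup>2))
        = (\<Sum>z\<in>W \<times> KK. (q (fst z) * l (fst z) (snd z)) * (cmod (cinner C (e (fst z) (snd z)) h))\<^sup>2)"
      unfolding sum_distrib_left sum.cartesian_product by (intro sum.cong refl) auto
    also have "\<dots> = (\<Sum>j\<in>JJ. \<mu> j * (cmod (cinner C (g j) h))\<^sup>2)"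
      by (rule weighted_overlaps_eq) (use avg in \<open>simp add: case_prod_unfold\<close>)
    finally show ?thesis .
  qed
  have E1: "(\<Sum>u\<in>W. q u * F1 u) = 1 - (\<Sum>j\<in>K. \<mu> j)"
  proof -
    have "F1 u = 1 - (\<Sum>k\<in>KK. l u k * (\<Sum>j\<in>K. (cmod (cinner C (e u k) (g j)))\<^sup>2))" if "u \<in> W" for u
    proof -
      have "F1 u = (\<Sum>k\<in>KK. l u k * (1 - (\<Sum>j\<in>K. (cmod (cinner C (e u k) (g j)))\<^sup>2)))"
        unfolding F1_def
      proof (intro sum.cong refl)
        fix k assume "k \<in> KK"
        then have "nsq C (\<lambda>i. e u k i - appl C T (e u k) i) = 1 - nsq C (appl C T (e u k))"
          using projector_nsq_split[OF T, of "e u k"] orthonormal_nsq[OF e[OF that]] by simp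
        then show "l u k * nsq C (\<lambda>i. e u k i - appl C T (e u k) i)
            = l u k * (1 - (\<Sum>j\<in>K. (cmod (cinner C (e u k) (g j)))\<^sup>2))"
          unfolding T_def nsq_proj_op[OF fK gK] cmod_cinner_commute[of C "e u k"] by simp
      qed
      then show ?thesis using l1[OF that] by (simp add: right_diff_distrib sum_subtractf)
    qed
    then have "(\<Sum>u\<in>W. q u * F1 u)
        = (\<Sum>u\<in>W. q u) - (\<Sum>u\<in>W. q u * (\<Sum>k\<in>KK. l u k * (\<Sum>j\<in>K. (cmod (cinner C (e u k) (g j)))\<^sup>2)))"
      by (simp add: right_diff_distrib sum_subtractf)
    also have "(\<Sum>u\<in>W. q u * (\<Sum>k\<in>KK. l u k * (\<Sum>j\<in>K. (cmod (cinner C (e u k) (g j)))\<^sup>2)))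
        = (\<Sum>u\<in>W. \<Sum>j\<in>K. q u * (\<Sum>k\<in>KK. l u k * (cmod (cinner C (e u k) (g j)))\<^sup>2))"
      unfolding sum_distrib_left by (intro sum.cong refl sum.swap)
    also have "\<dots> = (\<Sum>j\<in>K. \<Sum>j'\<in>JJ. \<mu> j' * (cmod (cinner C (g j') (g j)))\<^sup>2)"
      by (subst sum.swap) (simp only: ov)
    also have "\<dots> = (\<Sum>j\<in>K. \<Sum>j'\<in>JJ. if j' = j then \<mu> j' else 0)"
      using g K by (intro sum.cong refl) (auto simp: orthonormal_def)
    also have "\<dots> = (\<Sum>j\<in>K. \<mu> j)"
      using K finJ by (intro sum.cong refl) (auto simp: sum.delta)
    finally show ?thesis using q1 by simp
  qed
  have F2: "F2 u = (\<Sum>k\<in>KK - Ku u. l u k)" if u: "u \<in> W" for u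
  proof -
    have "F2 u = (\<Sum>k\<in>KK. if k \<in> Ku u then 0 else l u k)"
      unfolding F2_def
    proof (intro sum.cong refl)
      fix k assume k: "k \<in> KK"
      have "(\<Sum>k'\<in>Ku u. (cmod (cinner C (e u k') (e u k)))\<^sup>2) = (\<Sum>k'\<in>Ku u. if k' = k then 1 else 0)"
        using e[OF u] k Ku[OF u] by (intro sum.cong refl) (auto simp: orthonormal_def)
      then have "nsq C (appl C (proj_op (Ku u) (e u)) (e u k)) = (if k \<in> Ku u then 1 else 0)"
        unfolding nsq_proj_op[OF fKu[OF u] eKu[OF u]] using fKu[OF u] by simp
      then show "l u k * nsq C (\<lambda>i. e u k i - appl C (proj_op (Ku u) (e u)) (e u k) i)
          = (if k \<in> Ku u then 0 else l u k)"
        using projector_nsq_split[OF Pp[OF u], of "e u k"] orthonormal_nsq[OF e[OF u] k] by auto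
    qed
    also have "\<dots> = (\<Sum>k\<in>KK - Ku u. l u k)"
      using finK by (intro sum.mono_neutral_cong_right) auto
    finally show ?thesis .
  qed
  have E3: "(\<Sum>v\<in>W. \<Sum>u\<in>W. q v * q u * F3 v u) \<le> m * M"
  proof -
    have inner: "(\<Sum>u\<in>W. q u * F3 v u) \<le> m * M" if v: "v \<in> W" for v
    proof -
      \<comment> \<open>With \<open>T\<close> moved onto the fixed vector \<open>e v k'\<close>, the
        remaining average over sent words and eigenvectors is a quadratic form of the average state,
        to which \<open>ov\<close> applies.\<close>
      have adj: "cinner C (e v k') (appl C T w) = cinner C (appl C T (e v k')) w" for k' w
        using T by (simp add: projector_on_def cinner_appl)
      have "(\<Sum>u\<in>W. q u * F3 v u) = (\<Sum>u\<in>W. \<Sum>k'\<in>Ku v. q u * (\<Sum>k\<in>KK. l u k *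
            (cmod (cinner C (e u k) (appl C T (e v k'))))\<^sup>2))"
        unfolding F3_def nsq_proj_op[OF fKu[OF v] eKu[OF v]] adj cmod_cinner_commute[of C "e _ _" "appl C T _"]
        unfolding sum_distrib_left by (intro sum.cong refl sum.swap)
      also have "\<dots> = (\<Sum>k'\<in>Ku v. \<Sum>j\<in>JJ. \<mu> j * (cmod (cinner C (g j) (appl C T (e v k'))))\<^sup>2)"
        by (subst sum.swap) (simp only: ov)
      also have "\<dots> \<le> (\<Sum>k'\<in>Ku v. m)"
      proof (rule sum_mono)
        fix k' assume k': "k' \<in> Ku v"
        define h where "h = e v k'"
        have gT: "cinner C (g j) (appl C T h) = (if j \<in> K then cinner C (g j) h else 0)" if j: "j \<in> JJ" for j
        proof -
          have "cinner C (g j) (appl C T h) = (\<Sum>j'\<in>K. cinner C (g j') h * cinner C (g j) (g j'))"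
            unfolding T_def appl_proj_op by (rule cinner_sum_right)
          also have "\<dots> = (\<Sum>j'\<in>K. if j' = j then cinner C (g j') h else 0)"
            using g K j by (intro sum.cong refl) (auto simp: orthonormal_def)
          finally show ?thesis using fK by simp
        qed
        have "(\<Sum>j\<in>JJ. \<mu> j * (cmod (cinner C (g j) (appl C T h)))\<^sup>2) = (\<Sum>j\<in>K. \<mu> j * (cmod (cinner C (g j) h))\<^sup>2)"
          using K finJ by (intro sum.mono_neutral_cong_right) (auto simp: gT)
        also have "\<dots> \<le> (\<Sum>j\<in>K. m * (cmod (cinner C (g j) h))\<^sup>2)"
          using m by (intro sum_mono mult_right_mono) auto
        also have "\<dots> = m * nsq C (appl C T h)"
          unfolding T_def nsq_proj_op[OF fK gK] sum_distrib_left ..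
        also have "\<dots> \<le> m * nsq C h"
          using projector_nsq_split[OF T, of h] nsq_nonneg[of C "\<lambda>i. h i - appl C T h i"] m
          by (intro mult_left_mono) auto
        also have "nsq C h = 1" unfolding h_def using orthonormal_nsq[OF eKu[OF v] k'] .
        finally show "(\<Sum>j\<in>JJ. \<mu> j * (cmod (cinner C (g j) (appl C T (e v k'))))\<^sup>2) \<le> m"
          by (simp add: h_def)
      qed
      also have "\<dots> \<le> m * M" using mult_right_mono[OF M[OF v] m(2)] by (simp add: mult.commute)
      finally show ?thesis .
    qed
    have "(\<Sum>v\<in>W. \<Sum>u\<in>W. q v * q u * F3 v u) = (\<Sum>v\<in>W. q v * (\<Sum>u\<in>W. q u * F3 v u))"
      by (simp add: sum_distrib_left mult.assoc)
    also have "\<dots> \<le> (\<Sum>v\<in>W. q v * (m * M))"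
      using inner q0 by (intro sum_mono mult_left_mono) auto
    finally show ?thesis using q1 by (simp flip: sum_distrib_right)
  qed
  have mM: "0 \<le> m * M"
  proof -
    obtain u where "u \<in> W" using q1 by fastforce
    then have "0 \<le> M" using M[of u] by linarith
    then show ?thesis using m by simp
  qed
  have bound: "(\<Sum>k\<in>KK. l (c x) k * (nsq C (e (c x) k) - nsq C (appl C (P c x) (seq_vec C T (P c) x (e (c x) k)))))
      \<le> 9 * F1 (c x) + (8 * F2 (c x) + 4 * (\<Sum>i<x. F3 (c i) (c x)))" if c: "c \<in> PiE {..<L} (\<lambda>_. W)" for c
  proof -
    have cW: "c i \<in> W" if "i < L" for i using c that by auto
    have Pc: "projector_on C (P c i)" if "i \<le> x" for i
      unfolding P_def using Pp[OF cW] that x by simp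
    have "(\<Sum>k\<in>KK. l (c x) k * (nsq C (e (c x) k) - nsq C (appl C (P c x) (seq_vec C T (P c) x (e (c x) k)))))
      \<le> (\<Sum>k\<in>KK. l (c x) k * (9 * nsq C (\<lambda>i. e (c x) k i - appl C T (e (c x) k) i)
          + 8 * nsq C (\<lambda>i. e (c x) k i - appl C (P c x) (e (c x) k) i)
          + 4 * (\<Sum>i<x. nsq C (appl C (P c i) (appl C T (e (c x) k))))))"
      by (intro sum_mono mult_left_mono seq_povm_error finC T Pc l0 cW x)
    also have "\<dots> = 9 * F1 (c x) + 8 * F2 (c x) + 4 * (\<Sum>k\<in>KK. \<Sum>i<x. l (c x) k * nsq C (appl C (P c i) (appl C T (e (c x) k))))"
      unfolding F1_def F2_def P_def by (simp add: distrib_left sum.distrib sum_distrib_left mult_ac)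
    also have "(\<Sum>k\<in>KK. \<Sum>i<x. l (c x) k * nsq C (appl C (P c i) (appl C T (e (c x) k)))) = (\<Sum>i<x. F3 (c i) (c x))"
      unfolding F3_def P_def by (rule sum.swap)
    finally show ?thesis by simp
  qed
  have "cbE {..<L} W q (\<lambda>c. \<Sum>k\<in>KK. l (c x) k *
        (nsq C (e (c x) k) - nsq C (appl C (P c x) (seq_vec C T (P c) x (e (c x) k)))))
     \<le> cbE {..<L} W q (\<lambda>c. 9 * F1 (c x) + (8 * F2 (c x) + 4 * (\<Sum>i<x. F3 (c i) (c x))))"
    by (rule cbE_mono[OF q bound])
  also have "\<dots> = 9 * (\<Sum>u\<in>W. q u * F1 u) + (8 * (\<Sum>u\<in>W. q u * F2 u)
      + 4 * (\<Sum>i<x. \<Sum>v\<in>W. \<Sum>u\<in>W. q v * q u * F3 v u))"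
    unfolding cbE_add cbE_cmult cbE_sum
    using x cbE_single[OF _ q, of "{..<L}" x F1] cbE_single[OF _ q, of "{..<L}" x F2]
      cbE_pair[OF _ q, of "{..<L}" _ x F3] by simp
  also have "\<dots> \<le> 9 * (1 - (\<Sum>j\<in>K. \<mu> j)) + (8 * (\<Sum>u\<in>W. q u * (\<Sum>k\<in>KK - Ku u. l u k)) + 4 * (\<Sum>i<x. m * M))"
    unfolding E1 using E3 F2 q0 by (intro add_mono mult_left_mono sum_mono order.refl) (auto intro!: sum_mono)
  \<comment> \<open>Only tests before position \<open>x\<close> can interfere, hence
    \<open>L - 1\<close>: a codebook of a single word has no third term, which matters when the
    admissible number of words drops below 1.\<close>
  also have "\<dots> \<le> 9 * (1 - (\<Sum>j\<in>K. \<mu> j)) + (8 * (\<Sum>u\<in>W. q u * (\<Sum>k\<in>KK - Ku u. l u k)) + 4 * (real (L - 1) * (m * M)))"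
  proof -
    have "real x * (m * M) \<le> real (L - 1) * (m * M)"
      using x mM by (intro mult_right_mono) auto
    then show ?thesis by simp
  qed
  finally show ?thesis by simp
qed

text \<open>The cone generated by rank-one positive operators, with entries compared on
  \<open>C\<close> only. Its induction principle handles products of positive operators (tensor
  products, traces against a positive operator) without square roots of operators. Gram matrices and
  spectral sums with nonnegative eigenvalues lie in it directly.\<close>

inductive gram :: "'i set \<Rightarrow> 'i op \<Rightarrow> bool" for C where
  zero: "(\<And>i j. i \<in> C \<Longrightarrow> j \<in> C \<Longrightarrow> A i j = 0) \<Longrightarrow> gram C A"
| rank_one: "gram C A \<Longrightarrow> (\<And>i j. i \<in> C \<Longrightarrow> j \<in> C \<Longrightarrow> B i j = A i j + cnj (x i) * x j) \<Longrightarrow> gram C B"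

lemma gram_cong: "gram C A \<Longrightarrow> (\<And>i j. i \<in> C \<Longrightarrow> j \<in> C \<Longrightarrow> B i j = A i j) \<Longrightarrow> gram C B"
proof (induction A rule: gram.induct)
  case (zero A)
  then show ?case by (intro gram.zero) auto
next
  case (rank_one A B' x)
  then show ?case by (intro gram.rank_one[OF rank_one.hyps(1)]) auto
qed

lemma gram_add: "gram C B \<Longrightarrow> gram C A \<Longrightarrow> gram C (\<lambda>i j. A i j + B i j)"
proof (induction B rule: gram.induct)
  case (zero B)
  then show ?case by (intro gram_cong[OF zero.prems]) auto
next
  case (rank_one B B' x)
  then show ?case by (intro gram.rank_one[OF rank_one.IH[OF rank_one.prems], where x = x]) auto
qed

lemma gram_sum:
  "finite S \<Longrightarrow> (\<And>s. s \<in> S \<Longrightarrow> gram C (A s)) \<Longrightarrow> gram C (\<lambda>i j. \<Sum>s\<in>S. A s i j)"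
proof (induction S rule: finite_induct)
  case empty
  show ?case by (rule gram.zero) simp
next
  case (insert s S)
  then show ?case
    using gram_add[of C "\<lambda>i j. \<Sum>s\<in>S. A s i j" "A s"] by simp
qed

lemma gram_cinner:
  assumes "finite D"
  shows "gram C (\<lambda>a b. cinner D (f a) (f b))"
  unfolding cinner_def
proof (rule gram_sum[OF assms])
  show "gram C (\<lambda>a b. cnj (f a d) * f b d)" for d
    by (rule gram.rank_one[OF gram.zero[where A = "\<lambda>_ _. 0"], where x = "\<lambda>a. f a d"]) auto
qed

lemma gram_seq_povm: "finite C \<Longrightarrow> gram C (seq_povm C T P l)"
  unfolding seq_povm_def by (rule gram_cinner)

lemma gram_seq_rest: "finite C \<Longrightarrow> gram C (seq_rest C T P L)"
  unfolding seq_rest_def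
  using gram_add[OF gram_cinner[of C C "\<lambda>a i. ket a i - appl C T (ket a) i"] gram_cinner[of C C "\<lambda>a. seq_vec C T P L (ket a)"]]
  by simp

lemma gram_imp_psd_on:
  assumes "gram C A"
  shows "psd_on C A"
proof -
  have "\<exists>r\<ge>0. (\<Sum>i\<in>C. \<Sum>j\<in>C. cnj (v i) * A i j * v j) = complex_of_real r" for v
    using assms
  proof (induction A rule: gram.induct)
    case (zero A)
    then show ?case by (intro exI[of _ 0]) simp
  next
    case (rank_one A B x)
    then obtain r where r: "r \<ge> 0" "(\<Sum>i\<in>C. \<Sum>j\<in>C. cnj (v i) * A i j * v j) = complex_of_real r" by auto
    define s where "s = (\<Sum>j\<in>C. x j * v j)"
    have "(\<Sum>i\<in>C. \<Sum>j\<in>C. cnj (v i) * B i j * v j)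
        = (\<Sum>i\<in>C. \<Sum>j\<in>C. cnj (v i) * A i j * v j + cnj (x i * v i) * (x j * v j))"
      by (intro sum.cong refl) (simp add: rank_one.hyps(2) algebra_simps)
    also have "\<dots> = complex_of_real r + cnj s * s"
      by (simp add: sum.distrib r s_def sum_product)
    also have "\<dots> = complex_of_real (r + (cmod s)\<^sup>2)"
      unfolding of_real_add complex_norm_square by (simp add: mult.commute)
    finally show ?case using r by (intro exI[of _ "r + (cmod s)\<^sup>2"]) simp
  qed
  then show ?thesis unfolding psd_on_def Let_def by (metis Im_complex_of_real Re_complex_of_real)
qed

definition etr :: "'i set \<Rightarrow> 'i op \<Rightarrow> 'i op \<Rightarrow> real" where
  "etr C A R = Re (\<Sum>a\<in>C. \<Sum>b\<in>C. A a b * R b a)"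

lemma etr_cong:
  "(\<And>a b. a \<in> C \<Longrightarrow> b \<in> C \<Longrightarrow> A a b = A' a b) \<Longrightarrow> (\<And>a b. a \<in> C \<Longrightarrow> b \<in> C \<Longrightarrow> R a b = R' a b)
    \<Longrightarrow> etr C A R = etr C A' R'"
  unfolding etr_def by (intro arg_cong[of _ _ Re] sum.cong refl) simp

lemma etr_spectral:
  assumes R: "\<And>a b. a \<in> C \<Longrightarrow> b \<in> C \<Longrightarrow> R a b = (\<Sum>k\<in>K. complex_of_real (l k) * e k a * cnj (e k b))"
  shows "etr C A R = (\<Sum>k\<in>K. l k * Re (\<Sum>a\<in>C. \<Sum>b\<in>C. cnj (e k a) * A a b * e k b))"
proof -
  have "(\<Sum>a\<in>C. \<Sum>b\<in>C. A a b * R b a)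
      = (\<Sum>a\<in>C. \<Sum>b\<in>C. \<Sum>k\<in>K. complex_of_real (l k) * (cnj (e k a) * A a b * e k b))"
    by (intro sum.cong refl) (simp add: R sum_distrib_left mult_ac)
  also have "\<dots> = (\<Sum>a\<in>C. \<Sum>k\<in>K. \<Sum>b\<in>C. complex_of_real (l k) * (cnj (e k a) * A a b * e k b))"
    by (intro sum.cong refl sum.swap)
  also have "\<dots> = (\<Sum>k\<in>K. \<Sum>a\<in>C. \<Sum>b\<in>C. complex_of_real (l k) * (cnj (e k a) * A a b * e k b))"
    by (rule sum.swap)
  also have "\<dots> = (\<Sum>k\<in>K. complex_of_real (l k) * (\<Sum>a\<in>C. \<Sum>b\<in>C. cnj (e k a) * A a b * e k b))"
    by (simp only: sum_distrib_left)
  finally show ?thesis unfolding etr_def by (simp del: Re_sum add: Re_sum[of _ K])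
qed

lemma etr_compl_seq_povm:
  assumes fin: "finite C"
    and R: "\<And>a b. a \<in> C \<Longrightarrow> b \<in> C \<Longrightarrow> R a b = (\<Sum>k\<in>K. complex_of_real (l k) * e k a * cnj (e k b))"
  shows "etr C (compl_op (seq_povm C T P x)) R
    = (\<Sum>k\<in>K. l k * (nsq C (e k) - nsq C (appl C (P x) (seq_vec C T P x (e k)))))"
proof -
  have "Re (\<Sum>a\<in>C. \<Sum>b\<in>C. cnj (v a) * compl_op (seq_povm C T P x) a b * v b)
      = nsq C v - nsq C (appl C (P x) (seq_vec C T P x v))" for v
  proof -
    have "(\<Sum>a\<in>C. \<Sum>b\<in>C. cnj (v a) * compl_op (seq_povm C T P x) a b * v b)
        = (\<Sum>a\<in>C. \<Sum>b\<in>C. (if a = b then cnj (v a) * v b else 0) - cnj (v a) * seq_povm C T P x a b * v b)"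
      by (intro sum.cong refl) (auto simp: compl_op_def algebra_simps)
    also have "\<dots> = cinner C v v - complex_of_real (nsq C (appl C (P x) (seq_vec C T P x v)))"
      unfolding sum_subtractf seq_povm_quadratic[OF fin] using fin by (simp add: cinner_def)
    finally show ?thesis by (simp add: cinner_self)
  qed
  then show ?thesis by (simp add: etr_spectral[OF R])
qed

section \<open>Product bases and random coding over n channel uses\<close>

definition pvec :: "nat \<Rightarrow> (nat \<Rightarrow> 'k \<Rightarrow> 'b \<Rightarrow> complex) \<Rightarrow> 'k list \<Rightarrow> 'b list \<Rightarrow> complex" where
  "pvec n e k = (\<lambda>b. \<Prod>i<n. e i (k ! i) (b ! i))"

lemma orthonormal_pvec:
  fixes e :: "nat \<Rightarrow> 'k \<Rightarrow> 'b::finite \<Rightarrow> complex"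
  assumes e: "\<And>i. i < n \<Longrightarrow> orthonormal UNIV UNIV (e i)"
  shows "orthonormal (words n) (words n) (pvec n e)"
  unfolding orthonormal_def
proof (intro ballI)
  fix k l :: "'k list" assume kl: "k \<in> words n" "l \<in> words n"
  have "cinner (words n) (pvec n e k) (pvec n e l)
      = (\<Sum>b\<in>words n. \<Prod>i<n. cnj (e i (k ! i) (b ! i)) * e i (l ! i) (b ! i))"
    by (simp add: cinner_def pvec_def prod.distrib)
  also have "\<dots> = (\<Prod>i<n. cinner UNIV (e i (k ! i)) (e i (l ! i)))"
    unfolding cinner_def by (rule sum_words_prod)
  also have "\<dots> = (\<Prod>i<n. if k ! i = l ! i then 1 else 0)"
    using e by (intro prod.cong refl) (auto simp: orthonormal_def)
  also have "\<dots> = (if k = l then 1 else 0)"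
  proof (cases "k = l")
    case False
    then obtain i where "i < n" "k ! i \<noteq> l ! i"
      using kl nth_equalityI[of k l] by (auto simp: words_def)
    then show ?thesis using False by (auto intro!: prod_zero)
  qed simp
  finally show "cinner (words n) (pvec n e k) (pvec n e l) = (if k = l then 1 else 0)" .
qed

text \<open>The letters are given by functions \<open>s\<close> and \<open>t\<close> instead of
  lists, so that the joint output, whose basis consists of pairs of lists, is covered as
  well.\<close>

lemma prod_spectral:
  fixes e :: "nat \<Rightarrow> 'k::finite \<Rightarrow> 'b \<Rightarrow> complex"
  assumes "\<And>i a b. i < n \<Longrightarrow> A i a b = (\<Sum>k\<in>UNIV. complex_of_real (l i k) * e i k a * cnj (e i k b))"
  shows "(\<Prod>i<n. A i (s i) (t i)) = (\<Sum>k\<in>words n. complex_of_real (\<Prod>i<n. l i (k ! i)) *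
      (\<Prod>i<n. e i (k ! i) (s i)) * cnj (\<Prod>i<n. e i (k ! i) (t i)))"
proof -
  have "(\<Prod>i<n. A i (s i) (t i))
      = (\<Prod>i<n. \<Sum>k\<in>UNIV. complex_of_real (l i k) * e i k (s i) * cnj (e i k (t i)))"
    using assms by (intro prod.cong refl) simp
  also have "\<dots> = (\<Sum>k\<in>words n. \<Prod>i<n. complex_of_real (l i (k ! i)) * e i (k ! i) (s i) * cnj (e i (k ! i) (t i)))"
    by (rule sum_words_prod[symmetric])
  finally show ?thesis by (simp add: prod.distrib)
qed

lemma distr_on_words:
  fixes p :: "'u::finite \<Rightarrow> real"
  assumes "\<And>u. 0 \<le> p u" "(\<Sum>u\<in>UNIV. p u) = 1"
  shows "distr_on (words n) (\<lambda>w. \<Prod>i<n. p (w ! i))"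
  using assms sum_words_iid[of p n] by (auto simp: distr_on_def intro: prod_nonneg)

text \<open>The interface between packing and binning. The error is bounded for each index
  \<open>x\<close> separately, so that it can be summed over the members of any bin; the operators
  need only be completed by a positive rest, which binning distributes later.\<close>

definition random_decoder ::
  "nat \<Rightarrow> nat \<Rightarrow> ('u::finite \<Rightarrow> real) \<Rightarrow> ('u \<Rightarrow> ('b::finite) op) \<Rightarrow> real \<Rightarrow> ((nat \<Rightarrow> 'u list) \<Rightarrow> nat \<Rightarrow> 'b list op) \<Rightarrow> bool" where
  "random_decoder n L p \<omega> \<epsilon> D \<longleftrightarrow>
    (\<forall>c\<in>PiE {..<L} (\<lambda>_. words n). (\<forall>x<L. gram (words n) (D c x)) \<and>
        gram (words n) (compl_op (\<lambda>a b. \<Sum>x<L. D c x a b))) \<and>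
    (\<forall>x<L. cbE {..<L} (words n) (\<lambda>w. \<Prod>i<n. p (w ! i)) (\<lambda>c.
        etr (words n) (compl_op (D c x)) (\<lambda>a b. \<Prod>i<n. \<omega> (c x ! i) (a ! i) (b ! i))) \<le> \<epsilon>)"

lemma random_decoderD:
  assumes "random_decoder n L p \<omega> \<epsilon> D"
  shows "\<And>c x. c \<in> PiE {..<L} (\<lambda>_. words n) \<Longrightarrow> x < L \<Longrightarrow> gram (words n) (D c x)"
    and "\<And>c. c \<in> PiE {..<L} (\<lambda>_. words n) \<Longrightarrow> gram (words n) (compl_op (\<lambda>a b. \<Sum>x<L. D c x a b))"
    and "\<And>x. x < L \<Longrightarrow> cbE {..<L} (words n) (\<lambda>w. \<Prod>i<n. p (w ! i)) (\<lambda>c.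
        etr (words n) (compl_op (D c x)) (\<lambda>a b. \<Prod>i<n. \<omega> (c x ! i) (a ! i) (b ! i))) \<le> \<epsilon>"
  using assms unfolding random_decoder_def by blast+

text \<open>One-sided typicality suffices. \<open>K\<close> keeps the product eigenvectors of the
  average state with eigenvalue at most \<open>m\<close>, while \<open>Ku u\<close> keeps those of
  the output for \<open>u\<close> with eigenvalue at least \<open>1 / M\<close>, of which there are
  at most \<open>M\<close>. The weights lost are i.i.d. tails. The hypothesis bounds
  \<open>L - 1\<close>, so that a codebook of one word stays admissible even if the exponent is
  negative.\<close>

lemma hsw_packing_spectral:
  fixes p :: "'u::finite \<Rightarrow> real" and \<omega> :: "'u \<Rightarrow> ('b::finite) op"
    and E :: "'u \<Rightarrow> 'b \<Rightarrow> 'b \<Rightarrow> complex" and g :: "'b \<Rightarrow> 'b \<Rightarrow> complex"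
  assumes p: "\<And>u. 0 \<le> p u" "(\<Sum>u\<in>UNIV. p u) = 1"
    and E: "\<And>u. orthonormal UNIV UNIV (E u)"
    and l0: "\<And>u k. 0 \<le> l u k" and l1: "\<And>u. (\<Sum>k\<in>UNIV. l u k) = 1"
    and \<omega>: "\<And>u a b. \<omega> u a b = (\<Sum>k\<in>UNIV. complex_of_real (l u k) * E u k a * cnj (E u k b))"
    and g: "orthonormal UNIV UNIV g" and \<mu>0: "\<And>j. 0 \<le> \<mu> j" and \<mu>1: "(\<Sum>j\<in>UNIV. \<mu> j) = 1"
    and avg: "\<And>a b. (\<Sum>u\<in>UNIV. complex_of_real (p u) * \<omega> u a b)
        = (\<Sum>j\<in>UNIV. complex_of_real (\<mu> j) * g j a * cnj (g j b))"
    and I: "I = (\<Sum>j\<in>UNIV. eta (\<mu> j)) - (\<Sum>u\<in>UNIV. p u * (\<Sum>k\<in>UNIV. eta (l u k)))"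
    and \<epsilon>: "0 < \<epsilon>" and \<delta>: "0 < \<delta>"
  shows "\<exists>N. \<forall>n\<ge>N. \<forall>L. real (L - 1) \<le> 2 * 2 powr (real n * (I - \<delta>)) \<longrightarrow>
    (\<exists>D. random_decoder n L p \<omega> \<epsilon> D)"
proof -
  define S where "S = (\<Sum>j\<in>UNIV. eta (\<mu> j))"
  define H where "H = (\<Sum>u\<in>UNIV. p u * (\<Sum>k\<in>UNIV. eta (l u k)))"
  \<comment> \<open>The two typicality conditions spend \<open>d\<close> each, so of the gap
    \<open>\<delta> = 4 * d\<close> an exponent \<open>2 * d\<close> is left for the wrong
    tests.\<close>
  define d where "d = \<delta> / 4"
  have d: "0 < d" using \<delta> by (simp add: d_def)
  define t1 where "t1 n = (\<Sum>w\<in>words n. if 2 powr (real n * (- S + d)) < (\<Prod>i<n. \<mu> (w ! i)) then \<Prod>i<n. \<mu> (w ! i) else 0)" for n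
  \<comment> \<open>\<open>q2\<close> is the joint law of an input letter and an eigenvalue index of
    its output. The mean of \<open>log 2 (g2 z)\<close> under it is the average output entropy
    \<open>H\<close>.\<close>
  define q2 where "q2 z = p (fst z) * l (fst z) (snd z)" for z
  define g2 where "g2 z = 1 / l (fst z) (snd z)" for z
  define t2 where "t2 n = (\<Sum>w\<in>words n. if 2 powr (real n * (H + d)) < (\<Prod>i<n. g2 (w ! i)) then \<Prod>i<n. q2 (w ! i) else 0)" for n
  have eta: "eta y = - y * log 2 y" if "0 \<le> y" for y
    using that by (auto simp: eta_def)
  have "t1 \<longlonglongrightarrow> 0"
    unfolding t1_def
  proof (rule iid_tail_tendsto_0)
    show "- S = (\<Sum>a\<in>UNIV. \<mu> a * log 2 (\<mu> a))"
      by (simp add: S_def eta \<mu>0 sum_negf)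
  qed (use \<mu>0 \<mu>1 d in auto)
  moreover have "t2 \<longlonglongrightarrow> 0"
    unfolding t2_def
  proof (rule iid_tail_tendsto_0)
    show "(\<Sum>z\<in>UNIV. q2 z) = 1"
      using l1 p by (simp add: q2_def sum_UNIV_Times flip: sum_distrib_left)
    have "(\<Sum>z\<in>UNIV. q2 z * log 2 (g2 z)) = (\<Sum>u\<in>UNIV. \<Sum>k\<in>UNIV. p u * l u k * log 2 (1 / l u k))"
      by (simp add: q2_def g2_def sum_UNIV_Times)
    also have "\<dots> = (\<Sum>u\<in>UNIV. \<Sum>k\<in>UNIV. p u * eta (l u k))"
    proof (intro sum.cong refl)
      fix u k
      show "p u * l u k * log 2 (1 / l u k) = p u * eta (l u k)"
        using l0[of u k] by (cases "l u k = 0") (auto simp: eta log_divide)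
    qed
    also have "\<dots> = H" by (simp add: H_def sum_distrib_left)
    finally show "H = (\<Sum>z\<in>UNIV. q2 z * log 2 (g2 z))" ..
    show "0 < g2 z" if "0 < q2 z" for z
      using that l0[of "fst z" "snd z"] p(1)[of "fst z"] by (auto simp: q2_def g2_def zero_less_mult_iff)
  qed (use l0 p d in \<open>auto simp: q2_def g2_def\<close>)
  moreover have "(\<lambda>n. 2 powr (- real n * (2 * d))) \<longlonglongrightarrow> 0"
  proof -
    have "(\<lambda>n. (2 powr (- (2 * d))) ^ n) \<longlonglongrightarrow> 0"
      using d by (intro LIMSEQ_realpow_zero) (auto simp: powr_less_one)
    then show ?thesis by (simp add: powr_power mult.commute)
  qed
  ultimately have "(\<lambda>n. 9 * t1 n + 8 * t2 n + 8 * 2 powr (- real n * (2 * d))) \<longlonglongrightarrow> 9 * 0 + 8 * 0 + 8 * 0"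
    by (intro tendsto_intros)
  then have "eventually (\<lambda>n. 9 * t1 n + 8 * t2 n + 8 * 2 powr (- real n * (2 * d)) < \<epsilon>) sequentially"
    using \<epsilon> by (intro order_tendstoD(2)) auto
  then obtain N where N: "\<And>n. n \<ge> N \<Longrightarrow> 9 * t1 n + 8 * t2 n + 8 * 2 powr (- real n * (2 * d)) < \<epsilon>"
    by (auto simp: eventually_sequentially)
  show ?thesis
  proof (intro exI[of _ N] allI impI)
    fix n L assume n: "N \<le> n" and L: "real (L - 1) \<le> 2 * 2 powr (real n * (I - \<delta>))"
    let ?C = "words n :: 'b list set" and ?W = "words n :: 'u list set"
    define q where "q w = (\<Prod>i<n. p (w ! i))" for w
    define e where "e u = pvec n (\<lambda>i. E (u ! i))" for u
    define ll where "ll u k = (\<Prod>i<n. l (u ! i) (k ! i))" for u k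
    define gn where "gn = pvec n (\<lambda>_. g)"
    define \<mu>n where "\<mu>n j = (\<Prod>i<n. \<mu> (j ! i))" for j
    define m where "m = 2 powr (real n * (- S + d))"
    define M where "M = 2 powr (real n * (H + d))"
    define K where "K = {j \<in> ?C. \<mu>n j \<le> m}"
    define Ku where "Ku u = {k \<in> ?C. 1 / M \<le> ll u k}" for u
    define T where "T = proj_op K gn"
    define P where "P c i = proj_op (Ku (c i)) (e (c i))" for c :: "nat \<Rightarrow> 'u list" and i
    define D where "D c x = seq_povm ?C T (P c) x" for c x
    have M0: "0 < M" by (simp add: M_def)
    have qW: "distr_on ?W q" unfolding q_def by (rule distr_on_words[OF p])
    have e: "orthonormal ?C ?C (e u)" for u
      unfolding e_def by (rule orthonormal_pvec[OF E])
    have gn: "orthonormal ?C ?C gn"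
      unfolding gn_def by (rule orthonormal_pvec[OF g])
    have ll0: "0 \<le> ll u k" for u k by (simp add: ll_def l0 prod_nonneg)
    have ll1: "(\<Sum>k\<in>?C. ll u k) = 1" for u
      using sum_words_prod[of "\<lambda>i. l (u ! i)" n] l1 by (simp add: ll_def)
    have \<mu>n0: "0 \<le> \<mu>n j" for j by (simp add: \<mu>n_def \<mu>0 prod_nonneg)
    have spec: "(\<Prod>i<n. \<omega> (u ! i) (a ! i) (b ! i)) = (\<Sum>k\<in>?C. complex_of_real (ll u k) * e u k a * cnj (e u k b))"
      for u a b
      unfolding ll_def e_def pvec_def by (rule prod_spectral[OF \<omega>])
    have Kfin: "K \<subseteq> ?C" "Ku u \<subseteq> ?C" for u by (auto simp: K_def Ku_def)
    have avgn: "(\<Sum>(u, k)\<in>?W \<times> ?C. complex_of_real (q u * ll u k) * e u k a * cnj (e u k b))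
        = (\<Sum>j\<in>?C. complex_of_real (\<mu>n j) * gn j a * cnj (gn j b))" for a b
    proof -
      have "(\<Sum>(u, k)\<in>?W \<times> ?C. complex_of_real (q u * ll u k) * e u k a * cnj (e u k b))
          = (\<Sum>u\<in>?W. complex_of_real (q u) * (\<Prod>i<n. \<omega> (u ! i) (a ! i) (b ! i)))"
        unfolding spec by (simp add: sum.cartesian_product' sum_distrib_left mult.assoc)
      also have "\<dots> = (\<Sum>u\<in>?W. \<Prod>i<n. complex_of_real (p (u ! i)) * \<omega> (u ! i) (a ! i) (b ! i))"
        by (simp add: q_def prod.distrib)
      also have "\<dots> = (\<Prod>i<n. \<Sum>u\<in>UNIV. complex_of_real (p u) * \<omega> u (a ! i) (b ! i))"
        by (rule sum_words_prod)
      also have "\<dots> = (\<Sum>j\<in>?C. complex_of_real (\<mu>n j) * gn j a * cnj (gn j b))"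
        unfolding \<mu>n_def gn_def pvec_def by (rule prod_spectral[OF avg])
      finally show ?thesis .
    qed
    have cardKu: "real (card (Ku u)) \<le> M" for u
    proof -
      have "(\<Sum>k\<in>Ku u. 1 / M) \<le> (\<Sum>k\<in>Ku u. ll u k)"
        by (rule sum_mono) (simp add: Ku_def)
      also have "\<dots> \<le> (\<Sum>k\<in>?C. ll u k)"
        using ll0 Kfin by (intro sum_mono2) auto
      finally show ?thesis using M0 ll1 by (simp add: field_simps)
    qed
    have one: "1 - (\<Sum>j\<in>K. \<mu>n j) = t1 n"
    proof -
      have "(\<Sum>j\<in>?C. \<mu>n j) = 1" unfolding \<mu>n_def by (rule sum_words_iid[OF \<mu>1])
      moreover have "(\<Sum>j\<in>?C. \<mu>n j) = (\<Sum>j\<in>K. \<mu>n j) + (\<Sum>j\<in>?C - K. \<mu>n j)"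
        using sum.subset_diff[OF Kfin(1), of \<mu>n] by simp
      moreover have "(\<Sum>j\<in>?C - K. \<mu>n j) = t1 n"
        unfolding t1_def \<mu>n_def[symmetric] m_def[symmetric]
        by (intro sum.mono_neutral_cong_left) (auto simp: K_def)
      ultimately show ?thesis by simp
    qed
    have two: "(\<Sum>u\<in>?W. q u * (\<Sum>k\<in>?C - Ku u. ll u k)) \<le> t2 n"
    proof -
      define F where "F u k = (if M < (\<Prod>i<n. 1 / l (u ! i) (k ! i)) then \<Prod>i<n. p (u ! i) * l (u ! i) (k ! i) else 0)"
        for u :: "'u list" and k :: "'b list"
      have F0: "0 \<le> F u k" for u k by (simp add: F_def p l0 prod_nonneg)
      have "t2 n = (\<Sum>w\<in>words n. F (map fst w) (map snd w))"
        unfolding t2_def F_def M_def[symmetric]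
        by (intro sum.cong refl) (auto simp: q2_def g2_def words_def intro!: prod.cong)
      also have "\<dots> = (\<Sum>u\<in>?W. \<Sum>k\<in>?C. F u k)" by (rule sum_words_pair)
      finally have t2: "t2 n = (\<Sum>u\<in>?W. \<Sum>k\<in>?C. F u k)" .
      have "(\<Sum>k\<in>?C - Ku u. q u * ll u k) \<le> (\<Sum>k\<in>?C. F u k)" for u
      proof (rule order_trans[OF sum_mono sum_mono2])
        fix k assume k: "k \<in> ?C - Ku u"
        show "q u * ll u k \<le> F u k"
        \<comment> \<open>As \<open>1 / 0 = 0\<close>, a vanishing eigenvalue can escape the tail
          event in \<open>F\<close>; but then its weight is zero.\<close>
        proof (cases "ll u k = 0")
          case True
          then show ?thesis using F0 by simp
        next
          case False
          then have pos: "0 < ll u k" using ll0[of u k] by simp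
          have "ll u k < 1 / M" using k by (auto simp: Ku_def)
          then have "M < 1 / ll u k" using pos M0 by (simp add: field_simps)
          then show ?thesis
            by (simp add: F_def q_def ll_def prod.distrib prod_dividef)
        qed
      qed (use F0 in auto)
      then show ?thesis unfolding t2 sum_distrib_left by (intro sum_mono)
    qed
    have mM: "4 * real (L - 1) * (m * M) \<le> 8 * 2 powr (- real n * (2 * d))"
    proof -
      have "4 * real (L - 1) * (m * M) \<le> 4 * (2 * 2 powr (real n * (I - \<delta>))) * (m * M)"
        using L by (intro mult_right_mono mult_left_mono) (auto simp: m_def M_def)
      also have "\<dots> = 8 * 2 powr (real n * (I - \<delta>) + (real n * (- S + d) + real n * (H + d)))"
        by (simp add: m_def M_def powr_add)
      also have "real n * (I - \<delta>) + (real n * (- S + d) + real n * (H + d)) = - real n * (2 * d)"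
        by (simp add: I S_def[symmetric] H_def[symmetric] d_def algebra_simps)
      finally show ?thesis .
    qed
    have "random_decoder n L p \<omega> \<epsilon> D"
      unfolding random_decoder_def
    proof (intro conjI ballI allI impI)
      fix c :: "nat \<Rightarrow> 'u list" and x assume "x < L"
      show "gram ?C (D c x)" unfolding D_def by (rule gram_seq_povm) simp
    next
      fix c :: "nat \<Rightarrow> 'u list"
      have T: "projector_on ?C T"
        unfolding T_def by (rule projector_proj_op[OF finite_subset[OF Kfin(1)] orthonormal_subset[OF gn Kfin(1)]]) simp
      have P: "projector_on ?C (P c i)" for i
        unfolding P_def by (rule projector_proj_op[OF finite_subset[OF Kfin(2)] orthonormal_subset[OF e Kfin(2)]]) simp
      show "gram ?C (compl_op (\<lambda>a b. \<Sum>x<L. D c x a b))"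
      proof (rule gram_cong[OF gram_seq_rest[of ?C T "P c" L]])
        fix a b assume "a \<in> ?C" "b \<in> ?C"
        then show "compl_op (\<lambda>a b. \<Sum>x<L. D c x a b) a b = seq_rest ?C T (P c) L a b"
          using seq_povm_complete[of ?C T L "P c" a b, OF _ T P] by (simp add: D_def compl_op_def algebra_simps)
      qed simp
    next
      fix x assume x: "x < L"
      have "cbE {..<L} ?W (\<lambda>w. \<Prod>i<n. p (w ! i)) (\<lambda>c.
          etr ?C (compl_op (D c x)) (\<lambda>a b. \<Prod>i<n. \<omega> (c x ! i) (a ! i) (b ! i)))
        = cbE {..<L} ?W q (\<lambda>c. \<Sum>k\<in>?C. ll (c x) k *
        (nsq ?C (e (c x) k) - nsq ?C (appl ?C (P c x) (seq_vec ?C T (P c) x (e (c x) k)))))"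
        unfolding D_def q_def[symmetric] by (subst etr_compl_seq_povm[OF _ spec]) simp_all
      also have "\<dots> \<le> 9 * (1 - (\<Sum>j\<in>K. \<mu>n j)) + 8 * (\<Sum>u\<in>?W. q u * (\<Sum>k\<in>?C - Ku u. ll u k)) + 4 * real (L - 1) * (m * M)"
        unfolding T_def P_def
        by (rule one_shot_packing[where JJ = ?C])
          (use qW e ll0 ll1 gn \<mu>n0 avgn Kfin cardKu x in \<open>auto simp: K_def m_def\<close>)
      also have "\<dots> \<le> 9 * t1 n + 8 * t2 n + 8 * 2 powr (- real n * (2 * d))"
        unfolding one using two by (intro add_mono mult_left_mono mM) auto
      also have "\<dots> \<le> \<epsilon>" using N[OF n] by simp
      finally show "cbE {..<L} ?W (\<lambda>w. \<Prod>i<n. p (w ! i)) (\<lambda>c.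
          etr ?C (compl_op (D c x)) (\<lambda>a b. \<Prod>i<n. \<omega> (c x ! i) (a ! i) (b ! i))) \<le> \<epsilon>" .
    qed
    then show "\<exists>D. random_decoder n L p \<omega> \<epsilon> D" by (rule exI[of _ D])
  qed
qed

section \<open>Mutual information of classical-quantum states\<close>

lemma eta_mult: "0 \<le> a \<Longrightarrow> 0 \<le> b \<Longrightarrow> eta (a * b) = a * eta b + b * eta a"
  by (cases "a = 0"; cases "b = 0") (auto simp: eta_def log_mult zero_less_mult_iff algebra_simps mult_le_0_iff)

lemma orthonormal_ket: "orthonormal UNIV UNIV (ket :: 'i::finite \<Rightarrow> _)"
  by (simp add: orthonormal_def cinner_ket)

definition diag_op :: "('i \<Rightarrow> real) \<Rightarrow> 'i op" where
  "diag_op p = (\<lambda>i j. if i = j then complex_of_real (p i) else 0)"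

lemma vn_entropy_diag_op:
  fixes p :: "'i::finite \<Rightarrow> real"
  shows "vn_entropy (diag_op p) = (\<Sum>i\<in>UNIV. eta (p i))"
proof (rule vn_entropy_spectral[OF orthonormal_ket])
  fix i j :: 'i
  have "(\<Sum>k\<in>UNIV. complex_of_real (p k) * ket k i * cnj (ket k j))
      = (\<Sum>k\<in>UNIV. if k = i then (if i = j then complex_of_real (p i) else 0) else 0)"
    by (intro sum.cong refl) (auto simp: ket_def)
  then show "diag_op p i j = (\<Sum>k\<in>UNIV. complex_of_real (p k) * ket k i * cnj (ket k j))"
    by (simp add: diag_op_def)
qed

lemma ptrace_fst:
  fixes A :: "('a::finite \<times> 'b::finite) op"
  shows "ptrace fst snd A a a' = (\<Sum>b\<in>UNIV. A (a, b) (a', b))"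
proof -
  have "ptrace fst snd A a a' = (\<Sum>x\<in>UNIV. \<Sum>b\<in>UNIV. \<Sum>x'\<in>UNIV. \<Sum>b'\<in>UNIV.
      if b' = b then if x' = a' then if x = a then A (x, b) (x', b') else 0 else 0 else 0)"
    unfolding ptrace_def sum_UNIV_Times by (intro sum.cong refl) auto
  also have "\<dots> = (\<Sum>b\<in>UNIV. \<Sum>x\<in>UNIV. if x = a then A (x, b) (a', b) else 0)"
    by (subst sum.swap) simp
  finally show ?thesis by simp
qed

lemma ptrace_snd:
  fixes A :: "('a::finite \<times> 'b::finite) op"
  shows "ptrace snd fst A b b' = (\<Sum>a\<in>UNIV. A (a, b) (a, b'))"
proof -
  have "ptrace snd fst A b b' = (\<Sum>a\<in>UNIV. \<Sum>y\<in>UNIV. \<Sum>a'\<in>UNIV. \<Sum>y'\<in>UNIV.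
      if y' = b' then if a' = a then if y = b then A (a, y) (a', y') else 0 else 0 else 0)"
    unfolding ptrace_def sum_UNIV_Times by (intro sum.cong refl) auto
  then show ?thesis by simp
qed

lemma qmutual_info_diag_op:
  fixes p :: "'a::finite \<times> 'b::finite \<Rightarrow> real"
  shows "qmutual_info (diag_op p) = (\<Sum>a\<in>UNIV. eta (\<Sum>b\<in>UNIV. p (a, b)))
    + (\<Sum>b\<in>UNIV. eta (\<Sum>a\<in>UNIV. p (a, b))) - (\<Sum>z\<in>UNIV. eta (p z))"
proof -
  have "ptrace fst snd (diag_op p) = diag_op (\<lambda>a. \<Sum>b\<in>UNIV. p (a, b))"
    by (intro ext) (auto simp: ptrace_fst diag_op_def)
  moreover have "ptrace snd fst (diag_op p) = diag_op (\<lambda>b. \<Sum>a\<in>UNIV. p (a, b))"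
    by (intro ext) (auto simp: ptrace_snd diag_op_def)
  ultimately show ?thesis by (simp add: qmutual_info_def vn_entropy_diag_op)
qed

definition cq_state :: "('u \<Rightarrow> real) \<Rightarrow> ('u \<Rightarrow> 'b op) \<Rightarrow> ('u \<times> 'b) op" where
  "cq_state p \<omega> = (\<lambda>(u, b) (u', b'). if u = u' then complex_of_real (p u) * \<omega> u b b' else 0)"

text \<open>The state is block diagonal, with eigenvectors \<open>F (u, k)\<close> equal to the
  tensor product of \<open>ket u\<close> and \<open>E u k\<close>. By \<open>eta_mult\<close> its
  entropy is the entropy of \<open>p\<close> plus the average output entropy. The former cancels
  against the classical marginal, and the Holevo quantity of the ensemble remains.\<close>

lemma qmutual_info_cq_state:
  fixes p :: "'u::finite \<Rightarrow> real" and \<omega> :: "'u \<Rightarrow> ('b::finite) op"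
    and E :: "'u \<Rightarrow> 'b \<Rightarrow> 'b \<Rightarrow> complex" and g :: "'b \<Rightarrow> 'b \<Rightarrow> complex"
  assumes p: "\<And>u. 0 \<le> p u"
    and E: "\<And>u. orthonormal UNIV UNIV (E u)"
    and l0: "\<And>u k. 0 \<le> l u k" and l1: "\<And>u. (\<Sum>k\<in>UNIV. l u k) = 1"
    and \<omega>: "\<And>u a b. \<omega> u a b = (\<Sum>k\<in>UNIV. complex_of_real (l u k) * E u k a * cnj (E u k b))"
    and tr: "\<And>u. trace_on UNIV (\<omega> u) = 1"
    and g: "orthonormal UNIV UNIV g"
    and avg: "\<And>a b. (\<Sum>u\<in>UNIV. complex_of_real (p u) * \<omega> u a b)
        = (\<Sum>j\<in>UNIV. complex_of_real (\<mu> j) * g j a * cnj (g j b))"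
  shows "qmutual_info (cq_state p \<omega>)
    = (\<Sum>j\<in>UNIV. eta (\<mu> j)) - (\<Sum>u\<in>UNIV. p u * (\<Sum>k\<in>UNIV. eta (l u k)))"
proof -
  have 1: "vn_entropy (ptrace fst snd (cq_state p \<omega>)) = (\<Sum>u\<in>UNIV. eta (p u))"
  proof -
    have "ptrace fst snd (cq_state p \<omega>) = diag_op p"
      using tr by (intro ext) (auto simp: ptrace_fst cq_state_def diag_op_def trace_on_def simp flip: sum_distrib_left)
    then show ?thesis by (simp add: vn_entropy_diag_op)
  qed
  have 2: "vn_entropy (ptrace snd fst (cq_state p \<omega>)) = (\<Sum>j\<in>UNIV. eta (\<mu> j))"
    by (rule vn_entropy_spectral[OF g]) (simp add: ptrace_snd cq_state_def avg)
  define F where "F z = (\<lambda>y. if fst z = fst y then E (fst z) (snd z) (snd y) else 0)" for z :: "'u \<times> 'b"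
  have "orthonormal UNIV UNIV F"
    unfolding orthonormal_def
  proof (intro ballI)
    fix z z' :: "'u \<times> 'b"
    have "cinner UNIV (F z) (F z') = (\<Sum>u\<in>UNIV. if u = fst z then
        (\<Sum>b\<in>UNIV. if u = fst z' then cnj (E (fst z) (snd z) b) * E (fst z') (snd z') b else 0) else 0)"
      unfolding cinner_def sum_UNIV_Times
      by (rule sum.cong[OF refl]) (auto simp: F_def intro!: sum.cong sum.neutral)
    also have "\<dots> = (if fst z = fst z' then cinner UNIV (E (fst z) (snd z)) (E (fst z) (snd z')) else 0)"
      by (simp add: cinner_def)
    also have "\<dots> = (if z = z' then 1 else 0)"
      using E[of "fst z"] by (auto simp: orthonormal_def prod_eq_iff)
    finally show "cinner UNIV (F z) (F z') = (if z = z' then 1 else 0)" .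
  qed
  then have "vn_entropy (cq_state p \<omega>) = (\<Sum>z\<in>UNIV. eta (p (fst z) * l (fst z) (snd z)))"
  proof (rule vn_entropy_spectral)
    fix y y' :: "'u \<times> 'b"
    have "(\<Sum>z\<in>UNIV. complex_of_real (p (fst z) * l (fst z) (snd z)) * F z y * cnj (F z y'))
      = (\<Sum>u\<in>UNIV. if u = fst y then if u = fst y' then complex_of_real (p u) *
          (\<Sum>k\<in>UNIV. complex_of_real (l u k) * E u k (snd y) * cnj (E u k (snd y'))) else 0 else 0)"
      unfolding sum_UNIV_Times by (intro sum.cong refl) (auto simp: F_def sum_distrib_left mult.assoc)
    also have "\<dots> = cq_state p \<omega> y y'"
      by (auto simp: cq_state_def case_prod_unfold \<omega>)
    finally show "cq_state p \<omega> y y'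
      = (\<Sum>z\<in>UNIV. complex_of_real (p (fst z) * l (fst z) (snd z)) * F z y * cnj (F z y'))" ..
  qed
  also have "\<dots> = (\<Sum>u\<in>UNIV. \<Sum>k\<in>UNIV. p u * eta (l u k) + l u k * eta (p u))"
    by (simp add: sum_UNIV_Times eta_mult p l0)
  also have "\<dots> = (\<Sum>u\<in>UNIV. p u * (\<Sum>k\<in>UNIV. eta (l u k))) + (\<Sum>u\<in>UNIV. eta (p u))"
    using l1 by (simp add: sum.distrib flip: sum_distrib_left sum_distrib_right)
  finally show ?thesis using 1 2 by (simp add: qmutual_info_def)
qed

section \<open>Mixtures of density operators and the packing bound at the mutual information\<close>

lemma psd_on_sum:
  assumes "finite S" "\<And>s. s \<in> S \<Longrightarrow> 0 \<le> q s" "\<And>s. s \<in> S \<Longrightarrow> psd_on C (A s)"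
  shows "psd_on C (\<lambda>a b. \<Sum>s\<in>S. complex_of_real (q s) * A s a b)"
  unfolding psd_on_def Let_def
proof (intro allI conjI)
  fix v
  have "(\<Sum>i\<in>C. \<Sum>j\<in>C. cnj (v i) * (\<Sum>s\<in>S. complex_of_real (q s) * A s i j) * v j)
      = (\<Sum>i\<in>C. \<Sum>s\<in>S. \<Sum>j\<in>C. complex_of_real (q s) * (cnj (v i) * A s i j * v j))"
    unfolding sum_distrib_left sum_distrib_right
    by (rule sum.cong[OF refl], subst sum.swap) (simp add: mult_ac)
  also have "\<dots> = (\<Sum>s\<in>S. complex_of_real (q s) * (\<Sum>i\<in>C. \<Sum>j\<in>C. cnj (v i) * A s i j * v j))"
    unfolding sum_distrib_left by (rule sum.swap)
  finally have eq: "(\<Sum>i\<in>C. \<Sum>j\<in>C. cnj (v i) * (\<Sum>s\<in>S. complex_of_real (q s) * A s i j) * v j)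
      = (\<Sum>s\<in>S. complex_of_real (q s) * (\<Sum>i\<in>C. \<Sum>j\<in>C. cnj (v i) * A s i j * v j))" .
  define r where "r s = Re (\<Sum>i\<in>C. \<Sum>j\<in>C. cnj (v i) * A s i j * v j)" for s
  have r: "0 \<le> r s" "(\<Sum>i\<in>C. \<Sum>j\<in>C. cnj (v i) * A s i j * v j) = complex_of_real (r s)" if "s \<in> S" for s
    using assms(3)[OF that] by (auto simp: psd_on_def Let_def r_def complex_eq_iff)
  have "(\<Sum>i\<in>C. \<Sum>j\<in>C. cnj (v i) * (\<Sum>s\<in>S. complex_of_real (q s) * A s i j) * v j)
      = complex_of_real (\<Sum>s\<in>S. q s * r s)"
    unfolding eq of_real_sum by (intro sum.cong refl) (simp add: r)
  moreover have "0 \<le> (\<Sum>s\<in>S. q s * r s)"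
    using r assms(2) by (intro sum_nonneg mult_nonneg_nonneg) auto
  ultimately show "Im (\<Sum>i\<in>C. \<Sum>j\<in>C. cnj (v i) * (\<Sum>s\<in>S. complex_of_real (q s) * A s i j) * v j) = 0"
    and "0 \<le> Re (\<Sum>i\<in>C. \<Sum>j\<in>C. cnj (v i) * (\<Sum>s\<in>S. complex_of_real (q s) * A s i j) * v j)"
    by (simp_all only: Im_complex_of_real Re_complex_of_real)
qed

lemma density_op_mixture:
  fixes q :: "'s::finite \<Rightarrow> real" and A :: "'s \<Rightarrow> ('b::finite) op"
  assumes q: "\<And>s. 0 \<le> q s" "(\<Sum>s\<in>UNIV. q s) = 1" and A: "\<And>s. density_op (A s)"
  shows "density_op (\<lambda>a b. \<Sum>s\<in>UNIV. complex_of_real (q s) * A s a b)"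
proof -
  have "trace_on UNIV (\<lambda>a b. \<Sum>s\<in>UNIV. complex_of_real (q s) * A s a b)
      = (\<Sum>s\<in>UNIV. complex_of_real (q s) * trace_on UNIV (A s))"
    unfolding trace_on_def sum_distrib_left by (rule sum.swap)
  also have "\<dots> = 1" using A q(2) by (simp add: density_op_def flip: of_real_sum)
  finally show ?thesis
    using psd_on_sum[of UNIV q UNIV A] A q by (simp add: density_op_def)
qed

lemma hsw_packing:
  fixes p :: "'u::finite \<Rightarrow> real" and \<omega> :: "'u \<Rightarrow> ('b::finite) op"
  assumes p: "\<And>u. 0 \<le> p u" "(\<Sum>u\<in>UNIV. p u) = 1" and \<omega>: "\<And>u. density_op (\<omega> u)"
    and \<epsilon>: "0 < \<epsilon>" and \<delta>: "0 < \<delta>"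
  shows "\<exists>N. \<forall>n\<ge>N. \<forall>L. real (L - 1) \<le> 2 * 2 powr (real n * (qmutual_info (cq_state p \<omega>) - \<delta>)) \<longrightarrow>
    (\<exists>D. random_decoder n L p \<omega> \<epsilon> D)"
proof -
  have "\<forall>u. \<exists>(e :: 'b \<Rightarrow> 'b \<Rightarrow> complex) l. orthonormal UNIV UNIV e \<and> (\<forall>k. 0 \<le> l k) \<and> (\<Sum>k\<in>UNIV. l k) = 1 \<and>
    (\<forall>i j. \<omega> u i j = (\<Sum>k\<in>UNIV. complex_of_real (l k) * e k i * cnj (e k j)))"
    using density_op_spectral[OF \<omega>] by (rule allI)
  then obtain E :: "'u \<Rightarrow> 'b \<Rightarrow> 'b \<Rightarrow> complex" and l where E: "\<And>u. orthonormal UNIV UNIV (E u)"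
    and l: "\<And>u k. 0 \<le> l u k" "\<And>u. (\<Sum>k\<in>UNIV. l u k) = 1"
    and \<omega>E: "\<And>u i j. \<omega> u i j = (\<Sum>k\<in>UNIV. complex_of_real (l u k) * E u k i * cnj (E u k j))"
    unfolding choice_iff by blast
  obtain g :: "'b \<Rightarrow> 'b \<Rightarrow> complex" and \<mu> where g: "orthonormal UNIV UNIV g"
    and \<mu>: "\<And>k. 0 \<le> \<mu> k" "(\<Sum>k\<in>UNIV. \<mu> k) = 1"
    and avg: "\<And>i j. (\<Sum>u\<in>UNIV. complex_of_real (p u) * \<omega> u i j) = (\<Sum>k\<in>UNIV. complex_of_real (\<mu> k) * g k i * cnj (g k j))"
    using density_op_spectral[OF density_op_mixture[of p \<omega>, OF p \<omega>]] by blast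
  have tr: "trace_on UNIV (\<omega> u) = 1" for u using \<omega> by (simp add: density_op_def)
  show ?thesis
    by (rule hsw_packing_spectral[OF p E l \<omega>E g \<mu> avg qmutual_info_cq_state[OF p(1) E l \<omega>E tr g avg] \<epsilon> \<delta>])
qed

section \<open>Binning and the broadcast channel\<close>

lemma gram_spectral:
  assumes "finite K" "\<And>k. k \<in> K \<Longrightarrow> 0 \<le> l k"
  shows "gram C (\<lambda>a b. \<Sum>k\<in>K. complex_of_real (l k) * e k a * cnj (e k b))"
proof (rule gram_sum[OF assms(1)])
  fix k assume k: "k \<in> K"
  have s: "complex_of_real (sqrt (l k)) * complex_of_real (sqrt (l k)) = complex_of_real (l k)"
    using assms(2)[OF k] by (simp flip: of_real_mult)
  show "gram C (\<lambda>a b. complex_of_real (l k) * e k a * cnj (e k b))"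
    by (rule gram.rank_one[OF gram.zero[where A = "\<lambda>_ _. 0"],
        where x = "\<lambda>a. complex_of_real (sqrt (l k)) * cnj (e k a)"]) (auto simp: mult_ac simp flip: s)
qed

lemma gram_product:
  fixes A :: "nat \<Rightarrow> ('b::finite) op"
  assumes A: "\<And>i. i < n \<Longrightarrow> density_op (A i)"
  shows "gram C (\<lambda>z z'. \<Prod>i<n. A i (s z i) (s z' i))"
proof -
  have "\<forall>i. \<exists>(e :: 'b \<Rightarrow> 'b \<Rightarrow> complex) l. i < n \<longrightarrow> ((\<forall>k. 0 \<le> l k) \<and>
    (\<forall>a b. A i a b = (\<Sum>k\<in>UNIV. complex_of_real (l k) * e k a * cnj (e k b))))"
    using density_op_spectral[OF A] by blast
  then obtain e :: "nat \<Rightarrow> 'b \<Rightarrow> 'b \<Rightarrow> complex" and l where l: "\<And>i k. i < n \<Longrightarrow> 0 \<le> l i k"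
    and e: "\<And>i a b. i < n \<Longrightarrow> A i a b = (\<Sum>k\<in>UNIV. complex_of_real (l i k) * e i k a * cnj (e i k b))"
    unfolding choice_iff by blast
  show ?thesis
  proof (rule gram_cong)
    show "gram C (\<lambda>z z'. \<Sum>k\<in>words n. complex_of_real (\<Prod>i<n. l i (k ! i)) *
        (\<Prod>i<n. e i (k ! i) (s z i)) * cnj (\<Prod>i<n. e i (k ! i) (s z' i)))"
      by (rule gram_spectral) (auto intro: prod_nonneg l)
  qed (rule prod_spectral[OF e])
qed

lemma psd_on_product:
  fixes A :: "nat \<Rightarrow> ('b::finite) op"
  assumes "\<And>i. i < n \<Longrightarrow> density_op (A i)"
  shows "psd_on C (\<lambda>a b. \<Prod>i<n. A i (a ! i) (b ! i))"
  by (rule gram_imp_psd_on[OF gram_product[OF assms]])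

lemma density_op_ptrace_fst:
  fixes A :: "('a::finite \<times> 'b::finite) op"
  assumes A: "density_op A"
  shows "density_op (ptrace fst snd A)"
proof -
  obtain e :: "'a \<times> 'b \<Rightarrow> 'a \<times> 'b \<Rightarrow> complex" and l where l: "\<And>k. 0 \<le> l k"
    and e: "\<And>i j. A i j = (\<Sum>k\<in>UNIV. complex_of_real (l k) * e k i * cnj (e k j))"
    using density_op_spectral[OF A] by blast
  have "gram UNIV (\<lambda>a a'. \<Sum>b\<in>UNIV. \<Sum>k\<in>UNIV. complex_of_real (l k) * (\<lambda>a. e k (a, b)) a * cnj ((\<lambda>a. e k (a, b)) a'))"
    by (intro gram_sum gram_spectral finite l)
  then have "psd_on UNIV (ptrace fst snd A)"
    using gram_imp_psd_on by (simp add: ptrace_fst[abs_def] e)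
  moreover have "trace_on UNIV (ptrace fst snd A) = trace_on UNIV A"
    by (simp add: trace_on_def ptrace_fst sum_UNIV_Times)
  ultimately show ?thesis using A by (simp add: density_op_def)
qed

lemma density_op_ptrace_snd:
  fixes A :: "('a::finite \<times> 'b::finite) op"
  assumes A: "density_op A"
  shows "density_op (ptrace snd fst A)"
proof -
  obtain e :: "'a \<times> 'b \<Rightarrow> 'a \<times> 'b \<Rightarrow> complex" and l where l: "\<And>k. 0 \<le> l k"
    and e: "\<And>i j. A i j = (\<Sum>k\<in>UNIV. complex_of_real (l k) * e k i * cnj (e k j))"
    using density_op_spectral[OF A] by blast
  have "gram UNIV (\<lambda>b b'. \<Sum>a\<in>UNIV. \<Sum>k\<in>UNIV. complex_of_real (l k) * (\<lambda>b. e k (a, b)) b * cnj ((\<lambda>b. e k (a, b)) b'))"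
    by (intro gram_sum gram_spectral finite l)
  then have "psd_on UNIV (ptrace snd fst A)"
    using gram_imp_psd_on by (simp add: ptrace_snd[abs_def] e)
  moreover have "trace_on UNIV (ptrace snd fst A) = trace_on UNIV A"
    unfolding trace_on_def ptrace_snd sum_UNIV_Times by (rule sum.swap)
  ultimately show ?thesis using A by (simp add: density_op_def)
qed

lemma gram_tensor_rank_one:
  assumes "gram C A"
  shows "gram (C \<times> C') (\<lambda>z z'. A (fst z) (fst z') * (cnj (y (snd z)) * y (snd z')))"
  using assms
proof (induction A rule: gram.induct)
  case (zero A)
  then show ?case by (intro gram.zero) auto
next
  case (rank_one A B x)
  show ?case
    by (rule gram.rank_one[OF rank_one.IH, where x = "\<lambda>z. x (fst z) * y (snd z)"])
      (auto simp: rank_one.hyps(2) algebra_simps)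
qed

text \<open>Needed to drop \<open>(1 - L) \<otimes> (1 - G)\<close> from the error of a pair of
  receivers.\<close>

lemma gram_tensor:
  assumes "gram C' B" "gram C A"
  shows "gram (C \<times> C') (\<lambda>z z'. A (fst z) (fst z') * B (snd z) (snd z'))"
  using assms(1)
proof (induction B rule: gram.induct)
  case (zero B)
  then show ?case by (intro gram.zero) auto
next
  case (rank_one B B' y)
  show ?case
    by (rule gram_cong[OF gram_add[OF gram_tensor_rank_one[OF assms(2), where y = y] rank_one.IH]])
      (auto simp: rank_one.hyps(2) algebra_simps)
qed

text \<open>A rank-one summand of \<open>A\<close> contributes the quadratic form of
  \<open>R\<close> at the conjugate of its vector.\<close>

lemma etr_nonneg:
  assumes "gram C A" "psd_on C R"
  shows "0 \<le> etr C A R"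
  using assms(1)
proof (induction A rule: gram.induct)
  case (zero A)
  then show ?case by (simp add: etr_def)
next
  case (rank_one A B x)
  have "(\<Sum>a\<in>C. \<Sum>b\<in>C. B a b * R b a)
      = (\<Sum>a\<in>C. \<Sum>b\<in>C. A a b * R b a) + (\<Sum>b\<in>C. \<Sum>a\<in>C. cnj (cnj (x b)) * R b a * cnj (x a))"
    by (subst (3) sum.swap) (simp add: rank_one.hyps(2) algebra_simps sum.distrib)
  moreover have "0 \<le> Re (\<Sum>b\<in>C. \<Sum>a\<in>C. cnj (cnj (x b)) * R b a * cnj (x a))"
    using assms(2)[unfolded psd_on_def Let_def, rule_format, of "\<lambda>a. cnj (x a)"] by (rule conjunct2)
  ultimately show ?case using rank_one.IH unfolding etr_def by (simp only: plus_complex.sel)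
qed

lemma etr_diff: "etr C (\<lambda>a b. A a b - B a b) R = etr C A R - etr C B R"
  by (simp add: etr_def left_diff_distrib sum_subtractf)

lemma etr_sum_right:
  "etr C A (\<lambda>a b. \<Sum>s\<in>S. complex_of_real (q s) * R s a b) = (\<Sum>s\<in>S. q s * etr C A (R s))"
proof -
  have "(\<Sum>a\<in>C. \<Sum>b\<in>C. A a b * (\<Sum>s\<in>S. complex_of_real (q s) * R s b a))
      = (\<Sum>a\<in>C. \<Sum>s\<in>S. \<Sum>b\<in>C. complex_of_real (q s) * (A a b * R s b a))"
    unfolding sum_distrib_left by (rule sum.cong[OF refl], subst sum.swap) (simp add: mult_ac)
  also have "\<dots> = (\<Sum>s\<in>S. complex_of_real (q s) * (\<Sum>a\<in>C. \<Sum>b\<in>C. A a b * R s b a))"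
    unfolding sum_distrib_left by (rule sum.swap)
  finally show ?thesis unfolding etr_def by (simp del: Re_sum add: Re_sum[of _ S])
qed

lemma etr_compl_le_1:
  fixes A :: "nat \<Rightarrow> ('b::finite) op"
  assumes L: "gram (words n) L" and A: "\<And>i. i < n \<Longrightarrow> density_op (A i)"
  shows "etr (words n) (compl_op L) (\<lambda>a b. \<Prod>i<n. A i (a ! i) (b ! i)) \<le> 1"
proof -
  let ?R = "\<lambda>a b. \<Prod>i<n. A i (a ! i) (b ! i)"
  have "etr (words n) (\<lambda>a b. if a = b then 1 else 0) ?R = Re (\<Sum>a\<in>words n. ?R a a)"
    unfolding etr_def by (intro arg_cong[of _ _ Re] sum.cong refl) (simp add: if_distrib[of "\<lambda>z. z * _"] cong: if_cong)
  also have "(\<Sum>a\<in>words n. ?R a a) = (\<Prod>i<n. trace_on UNIV (A i))"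
    unfolding trace_on_def by (rule sum_words_prod)
  also have "\<dots> = 1" using A by (simp add: density_op_def)
  finally have "etr (words n) (\<lambda>a b. if a = b then 1 else 0) ?R = 1" by simp
  then show ?thesis
    unfolding compl_op_def etr_diff using etr_nonneg[OF L psd_on_product[OF A]] by simp
qed

text \<open>The bound drops the last term of
  \<open>1 - L \<otimes> G = (1 - L) \<otimes> 1 + 1 \<otimes> (1 - G) - (1 - L) \<otimes> (1 - G)\<close>.\<close>

lemma err_prob_le:
  fixes \<rho> :: "'x \<Rightarrow> ('b1::finite \<times> 'b2::finite) op"
  assumes \<rho>: "\<And>x. density_op (\<rho> x)"
    and L: "gram (words n) (compl_op L)" and G: "gram (words n) (compl_op G)"
  shows "err_prob n L G (chan_n \<rho> n xs)
    \<le> etr (words n) (compl_op L) (\<lambda>a a'. \<Prod>i<n. ptrace fst snd (\<rho> (xs i)) (a ! i) (a' ! i))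
      + etr (words n) (compl_op G) (\<lambda>b b'. \<Prod>i<n. ptrace snd fst (\<rho> (xs i)) (b ! i) (b' ! i))"
proof -
  let ?C = "words n :: 'b1 list set" and ?C' = "words n :: 'b2 list set"
  let ?R = "chan_n \<rho> n xs"
  define X1 where "X1 z z' = compl_op L (fst z) (fst z') * (if snd z = snd z' then 1 else 0)"
    for z z' :: "'b1 list \<times> 'b2 list"
  define X2 where "X2 z z' = (if fst z = fst z' then 1 else 0) * compl_op G (snd z) (snd z')"
    for z z' :: "'b1 list \<times> 'b2 list"
  define X3 where "X3 z z' = compl_op L (fst z) (fst z') * compl_op G (snd z) (snd z')"
    for z z' :: "'b1 list \<times> 'b2 list"
  have R: "?R z z' = (\<Prod>i<n. \<rho> (xs i) (fst z ! i, snd z ! i) (fst z' ! i, snd z' ! i))" for z z'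
    by (simp add: chan_n_def case_prod_unfold)
  have psd: "psd_on (?C \<times> ?C') ?R"
  proof -
    have "gram (?C \<times> ?C') (\<lambda>z z'. \<Prod>i<n. \<rho> (xs i) (fst z ! i, snd z ! i) (fst z' ! i, snd z' ! i))"
      using gram_product[of n "\<lambda>i. \<rho> (xs i)" "?C \<times> ?C'" "\<lambda>z i. (fst z ! i, snd z ! i)"] \<rho> by simp
    then show ?thesis by (intro gram_imp_psd_on gram_cong[OF _ R])
  qed
  have X3: "0 \<le> etr (?C \<times> ?C') X3 ?R"
    unfolding X3_def[abs_def] by (rule etr_nonneg[OF gram_tensor[OF G L] psd])
  \<comment> \<open>The identity on the second factor traces out the second receiver, and the
    marginal of the product output is the product of the marginals.\<close>
  have X1: "etr (?C \<times> ?C') X1 ?R = etr ?C (compl_op L) (\<lambda>a a'. \<Prod>i<n. ptrace fst snd (\<rho> (xs i)) (a ! i) (a' ! i))"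
  proof -
    have m: "(\<Sum>b\<in>?C'. ?R (a', b) (a, b)) = (\<Prod>i<n. ptrace fst snd (\<rho> (xs i)) (a' ! i) (a ! i))" for a a'
      unfolding R ptrace_fst fst_conv snd_conv by (rule sum_words_prod)
    have "(\<Sum>z\<in>?C \<times> ?C'. \<Sum>z'\<in>?C \<times> ?C'. X1 z z' * ?R z' z)
        = (\<Sum>a\<in>?C. \<Sum>b\<in>?C'. \<Sum>a'\<in>?C. \<Sum>b'\<in>?C'. if b' = b then compl_op L a a' * ?R (a', b') (a, b) else 0)"
      unfolding sum.cartesian_product' by (intro sum.cong refl) (auto simp: X1_def)
    also have "\<dots> = (\<Sum>a\<in>?C. \<Sum>b\<in>?C'. \<Sum>a'\<in>?C. compl_op L a a' * ?R (a', b) (a, b))"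
      by (intro sum.cong refl) simp
    also have "\<dots> = (\<Sum>a\<in>?C. \<Sum>a'\<in>?C. compl_op L a a' * (\<Sum>b\<in>?C'. ?R (a', b) (a, b)))"
      unfolding sum_distrib_left by (intro sum.cong refl sum.swap)
    finally show ?thesis unfolding etr_def m by simp
  qed
  have X2: "etr (?C \<times> ?C') X2 ?R = etr ?C' (compl_op G) (\<lambda>b b'. \<Prod>i<n. ptrace snd fst (\<rho> (xs i)) (b ! i) (b' ! i))"
  proof -
    have m: "(\<Sum>a\<in>?C. ?R (a, b') (a, b)) = (\<Prod>i<n. ptrace snd fst (\<rho> (xs i)) (b' ! i) (b ! i))" for b b'
      unfolding R ptrace_snd fst_conv snd_conv by (rule sum_words_prod)
    have "(\<Sum>z\<in>?C \<times> ?C'. \<Sum>z'\<in>?C \<times> ?C'. X2 z z' * ?R z' z)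
        = (\<Sum>a\<in>?C. \<Sum>b\<in>?C'. \<Sum>b'\<in>?C'. \<Sum>a'\<in>?C. if a' = a then compl_op G b b' * ?R (a', b') (a, b) else 0)"
      unfolding sum.cartesian_product'
      by (intro sum.cong refl, subst sum.swap) (intro sum.cong refl, auto simp: X2_def)
    also have "\<dots> = (\<Sum>a\<in>?C. \<Sum>b\<in>?C'. \<Sum>b'\<in>?C'. compl_op G b b' * ?R (a, b') (a, b))"
      by (intro sum.cong refl) simp
    also have "\<dots> = (\<Sum>b\<in>?C'. \<Sum>a\<in>?C. \<Sum>b'\<in>?C'. compl_op G b b' * ?R (a, b') (a, b))"
      by (rule sum.swap)
    also have "\<dots> = (\<Sum>b\<in>?C'. \<Sum>b'\<in>?C'. compl_op G b b' * (\<Sum>a\<in>?C. ?R (a, b') (a, b)))"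
      unfolding sum_distrib_left by (intro sum.cong refl sum.swap)
    finally show ?thesis unfolding etr_def m by simp
  qed
  have "err_prob n L G ?R = etr (?C \<times> ?C') (\<lambda>z z'. X1 z z' + X2 z z' - X3 z z') ?R"
    unfolding err_prob_def etr_def
    by (intro arg_cong[of _ _ Re] sum.cong refl)
      (auto simp: X1_def X2_def X3_def compl_op_def case_prod_unfold algebra_simps intro!: sum.cong)
  also have "\<dots> = etr (?C \<times> ?C') X1 ?R + etr (?C \<times> ?C') X2 ?R - etr (?C \<times> ?C') X3 ?R"
    by (simp add: etr_def algebra_simps sum.distrib sum_subtractf)
  finally show ?thesis using X1 X2 X3 by simp
qed

text \<open>Receivers only decode the bin index; the unused outcome is assigned to bin 0.\<close>

lemma binned_povm:
  assumes D: "\<And>x. x < M * A \<Longrightarrow> gram C (D x)" and rest: "gram C (compl_op (\<lambda>a b. \<Sum>x<M * A. D x a b))"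
    and pos: "0 < M" "0 < (A::nat)"
  shows "\<exists>\<Lambda> :: nat \<Rightarrow> 'i op. (\<forall>m<M. gram C (\<Lambda> m) \<and> gram C (compl_op (\<Lambda> m)))
    \<and> (\<forall>a\<in>C. \<forall>b\<in>C. (\<Sum>m<M. \<Lambda> m a b) = (if a = b then 1 else 0))
    \<and> (\<forall>x<M * A. gram C (\<lambda>a b. \<Lambda> (x div A) a b - D x a b))"
proof -
  let ?Z = "compl_op (\<lambda>a b. \<Sum>x<M * A. D x a b)"
  define \<Lambda> where "\<Lambda> m = (\<lambda>a b. (\<Sum>x<M * A. if x div A = m then D x a b else 0) + (if m = 0 then ?Z a b else 0))" for m
  have g0: "gram C (\<lambda>_ _. 0)" by (rule gram.zero) simp
  have gz: "gram C (\<lambda>a b. if m = 0 then ?Z a b else 0)" for m :: nat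
    using rest g0 by (cases "m = 0") auto
  have gS: "gram C (\<lambda>a b. \<Sum>x\<in>S. if x div A = m then D x a b else 0)" if "S \<subseteq> {..<M * A}" for m S
  proof (rule gram_sum)
    show "finite S" using that finite_subset by auto
    show "gram C (\<lambda>a b. if x div A = m then D x a b else 0)" if "x \<in> S" for x
    proof (cases "x div A = m")
      case True
      then show ?thesis using D[of x] that \<open>S \<subseteq> {..<M * A}\<close> by (simp add: subset_eq)
    next
      case False
      then show ?thesis using g0 by (simp only: if_False)
    qed
  qed
  have gL: "gram C (\<Lambda> m)" for m
    unfolding \<Lambda>_def using gram_add[OF gz gS[OF order.refl]] by simp
  have total: "(\<Sum>m<M. \<Lambda> m a b) = (if a = b then 1 else 0)" for a b
  proof -
    have "(\<Sum>m<M. \<Lambda> m a b) = (\<Sum>m<M. \<Sum>x<M * A. if x div A = m then D x a b else 0) + ?Z a b"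
      unfolding \<Lambda>_def sum.distrib using pos by simp
    also have "(\<Sum>m<M. \<Sum>x<M * A. if x div A = m then D x a b else 0)
        = (\<Sum>x<M * A. \<Sum>m<M. if x div A = m then D x a b else 0)"
      by (rule sum.swap)
    also have "\<dots> = (\<Sum>x<M * A. D x a b)"
      by (intro sum.cong refl) (simp add: less_mult_imp_div_less)
    finally show ?thesis by (simp add: compl_op_def)
  qed
  have gc: "gram C (compl_op (\<Lambda> m))" if "m < M" for m
  proof (rule gram_cong[OF gram_sum[of "{..<M} - {m}" C \<Lambda>]])
    fix a b
    show "compl_op (\<Lambda> m) a b = (\<Sum>k\<in>{..<M} - {m}. \<Lambda> k a b)"
      unfolding compl_op_def total[symmetric]
      using sum.remove[of "{..<M}" m "\<lambda>k. \<Lambda> k a b"] that by simp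
  qed (auto simp: gL)
  \<comment> \<open>The outcome of a bin dominates that of each of its members, since it is a sum
    containing it whose other terms are positive. This makes decoding the bin no worse than decoding
    the word.\<close>
  have gd: "gram C (\<lambda>a b. \<Lambda> (x div A) a b - D x a b)" if "x < M * A" for x
  proof (rule gram_cong[OF gram_add[OF gz gS[of "{..<M * A} - {x}"]]])
    fix a b
    show "\<Lambda> (x div A) a b - D x a b = (\<Sum>y\<in>{..<M * A} - {x}. if y div A = x div A then D y a b else 0)
        + (if x div A = 0 then ?Z a b else 0)"
      unfolding \<Lambda>_def
      using sum.remove[of "{..<M * A}" x "\<lambda>y. if y div A = x div A then D y a b else 0", OF finite_lessThan] that
      by (simp only: lessThan_iff if_True simp_thms add.assoc add_diff_cancel_left')
  qed auto
  show ?thesis using gL gc total gd by (intro exI[of _ \<Lambda>]) auto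
qed

text \<open>The minimum of \<open>e\<close> is at most the weighted average \<open>V / W\<close>. If
  \<open>W / N \<ge> 1 / 2\<close>, this is at most \<open>2 / N * V\<close>. Otherwise
  \<open>W / N\<close> deviates from 1 by more than 1/2, and 8 times the squared deviation is at
  least 2, the trivial bound on \<open>e\<close>. Adding both bounds removes the case distinction,
  and the result can be averaged over codebooks.\<close>

lemma weighted_selection:
  fixes w e :: "'a \<Rightarrow> 'b \<Rightarrow> real"
  assumes fin: "finite J1" "finite J2" "J1 \<noteq> {}" "J2 \<noteq> {}" and N: "0 < N"
    and w: "\<And>x y. x \<in> J1 \<Longrightarrow> y \<in> J2 \<Longrightarrow> 0 \<le> w x y"
    and e: "\<And>x y. x \<in> J1 \<Longrightarrow> y \<in> J2 \<Longrightarrow> 0 \<le> e x y \<and> e x y \<le> 2"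
  shows "\<exists>x\<in>J1. \<exists>y\<in>J2. e x y \<le> 2 / N * (\<Sum>x\<in>J1. \<Sum>y\<in>J2. w x y * e x y)
      + 8 * ((\<Sum>x\<in>J1. \<Sum>y\<in>J2. w x y) / N - 1)\<^sup>2"
proof -
  let ?E = "(\<lambda>z. e (fst z) (snd z)) ` (J1 \<times> J2)"
  have E: "finite ?E" "?E \<noteq> {}" using fin by auto
  obtain x y where xy: "x \<in> J1" "y \<in> J2" "Min ?E = e x y"
    using Min_in[OF E] by auto
  have min: "e x y \<le> e x' y'" if "x' \<in> J1" "y' \<in> J2" for x' y'
    using Min_le[OF E(1), of "e x' y'"] that xy by force
  define W where "W = (\<Sum>x\<in>J1. \<Sum>y\<in>J2. w x y)"
  define V where "V = (\<Sum>x\<in>J1. \<Sum>y\<in>J2. w x y * e x y)"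
  have V0: "0 \<le> V" unfolding V_def using w e by (intro sum_nonneg mult_nonneg_nonneg) auto
  have WV: "e x y * W \<le> V"
    unfolding W_def V_def sum_distrib_left
  proof (intro sum_mono)
    fix x' y' assume "x' \<in> J1" "y' \<in> J2"
    then show "e x y * w x' y' \<le> w x' y' * e x' y'"
      using mult_left_mono[OF min w] by (simp only: mult.commute)
  qed
  have "e x y \<le> 2 / N * V + 8 * (W / N - 1)\<^sup>2"
  proof (cases "1 / 2 \<le> W / N")
    case True
    have "1 \<le> 2 * (W / N)" using True by linarith
    then have "1 * e x y \<le> 2 * (W / N) * e x y"
      using e[OF xy(1,2)] by (intro mult_right_mono) auto
    also have "\<dots> \<le> 2 / N * V" using WV N by (simp add: field_simps)
    finally show ?thesis by (simp add: add_increasing2)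
  next
    case False
    then have "(1 / 2)\<^sup>2 \<le> (1 - W / N)\<^sup>2" by (intro power_mono) auto
    moreover have "(1 / 2 :: real)\<^sup>2 = 1 / 4" by (simp add: power_divide)
    ultimately have "2 \<le> 8 * (W / N - 1)\<^sup>2"
      unfolding power2_commute[of "W / N"] by linarith
    moreover have "0 \<le> 2 / N * V" using V0 N by simp
    ultimately show ?thesis using e[OF xy(1,2)] by linarith
  qed
  then show ?thesis using xy unfolding W_def V_def by blast
qed

text \<open>Pointwise, \<open>q\<close> times the weight is at most \<open>q * h\<close> and hence
  at most \<open>r\<close>. As the error terms are nonnegative, the weighted average of errors over
  the other word is bounded by the \<open>r\<close>-average, which is the error for the product of
  the averaged states \<open>\<omega>\<close>. With \<open>r\<close> a conditional distribution this
  is the point-to-point channel seen by one receiver.\<close>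

lemma receiver_average:
  fixes \<tau> :: "'u \<Rightarrow> 'v::finite \<Rightarrow> ('b::finite) op" and q :: "'v \<Rightarrow> real"
  assumes A: "gram (words n) A" and \<tau>: "\<And>u v. density_op (\<tau> u v)"
    and W: "\<And>v. 0 \<le> W v" "\<And>v. v \<in> words n \<Longrightarrow> W v \<le> (\<Prod>i<n. h (u ! i) (v ! i))"
    and q: "\<And>v. 0 \<le> q v" and h: "\<And>u v. 0 \<le> h u v" and r: "\<And>u v. q v * h u v \<le> r u v"
    and \<omega>: "\<And>u a b. \<omega> u a b = (\<Sum>v\<in>UNIV. complex_of_real (r u v) * \<tau> u v a b)"
  shows "(\<Sum>v\<in>words n. (\<Prod>i<n. q (v ! i)) * (W v * etr (words n) A (\<lambda>a b. \<Prod>i<n. \<tau> (u ! i) (v ! i) (a ! i) (b ! i))))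
    \<le> etr (words n) A (\<lambda>a b. \<Prod>i<n. \<omega> (u ! i) (a ! i) (b ! i))"
proof -
  let ?t = "\<lambda>v. etr (words n) A (\<lambda>a b. \<Prod>i<n. \<tau> (u ! i) (v ! i) (a ! i) (b ! i))"
  have t0: "0 \<le> ?t v" for v
    by (rule etr_nonneg[OF A psd_on_product]) (rule \<tau>)
  have "(\<Sum>v\<in>words n. (\<Prod>i<n. q (v ! i)) * (W v * ?t v)) \<le> (\<Sum>v\<in>words n. (\<Prod>i<n. r (u ! i) (v ! i)) * ?t v)"
  proof (rule sum_mono)
    fix v :: "'v list" assume v: "v \<in> words n"
    have "(\<Prod>i<n. q (v ! i)) * W v \<le> (\<Prod>i<n. q (v ! i)) * (\<Prod>i<n. h (u ! i) (v ! i))"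
      using W(2)[OF v] q by (intro mult_left_mono prod_nonneg) auto
    also have "\<dots> = (\<Prod>i<n. q (v ! i) * h (u ! i) (v ! i))" by (simp add: prod.distrib)
    also have "\<dots> \<le> (\<Prod>i<n. r (u ! i) (v ! i))"
      using q h r by (intro prod_mono) auto
    finally have "(\<Prod>i<n. q (v ! i)) * W v \<le> (\<Prod>i<n. r (u ! i) (v ! i))" .
    then show "(\<Prod>i<n. q (v ! i)) * (W v * ?t v) \<le> (\<Prod>i<n. r (u ! i) (v ! i)) * ?t v"
      using t0 mult_right_mono by (fastforce simp: mult.assoc)
  qed
  also have "\<dots> = etr (words n) A (\<lambda>a b. \<Sum>v\<in>words n. complex_of_real (\<Prod>i<n. r (u ! i) (v ! i)) *
      (\<Prod>i<n. \<tau> (u ! i) (v ! i) (a ! i) (b ! i)))"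
    by (rule etr_sum_right[symmetric])
  also have "\<dots> = etr (words n) A (\<lambda>a b. \<Prod>i<n. \<omega> (u ! i) (a ! i) (b ! i))"
  proof (rule etr_cong[OF refl])
    fix a b :: "'b list"
    have "(\<Sum>v\<in>words n. complex_of_real (\<Prod>i<n. r (u ! i) (v ! i)) * (\<Prod>i<n. \<tau> (u ! i) (v ! i) (a ! i) (b ! i)))
        = (\<Sum>v\<in>words n. \<Prod>i<n. complex_of_real (r (u ! i) (v ! i)) * \<tau> (u ! i) (v ! i) (a ! i) (b ! i))"
      by (simp add: prod.distrib)
    also have "\<dots> = (\<Prod>i<n. \<omega> (u ! i) (a ! i) (b ! i))"
      unfolding \<omega> by (rule sum_words_prod)
    finally show "(\<Sum>v\<in>words n. complex_of_real (\<Prod>i<n. r (u ! i) (v ! i)) * (\<Prod>i<n. \<tau> (u ! i) (v ! i) (a ! i) (b ! i)))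
        = (\<Prod>i<n. \<omega> (u ! i) (a ! i) (b ! i))" .
  qed
  finally show ?thesis .
qed

lemma cbE_swap:
  "cbE I W q (\<lambda>c. cbE I' W' q' (F c)) = cbE I' W' q' (\<lambda>c'. cbE I W q (\<lambda>c. F c c'))"
  unfolding cbE_def sum_distrib_left by (subst sum.swap) (simp add: mult_ac)

lemma bin_less: "m < M \<Longrightarrow> x \<in> {m * A..<m * A + A} \<Longrightarrow> x < M * (A::nat)"
  using mult_le_mono1[of "Suc m" M A] by auto

lemma bin_div: "x \<in> {m * A..<m * A + A} \<Longrightarrow> x div A = (m::nat)"
  by (rule div_nat_eqI) (auto simp: mult.commute)

text \<open>Origin of \<open>\<epsilon>'\<close>: the weighted errors of both receivers have mean at
  most \<open>2 * \<epsilon>\<close> per pair, and selection doubles this. The factor 8 is the price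
  of the deviation in \<open>weighted_selection\<close>, multiplied by the second moment bound with
  \<open>1 - g = t\<close> and \<open>N = A1 * A2\<close>.\<close>

lemma marton_block:
  fixes \<rho> :: "'x \<Rightarrow> ('b1::finite \<times> 'b2::finite) op"
    and p :: "'u1::finite \<times> 'u2::finite \<Rightarrow> real" and f :: "'u1 \<Rightarrow> 'u2 \<Rightarrow> 'x"
    and D1 :: "(nat \<Rightarrow> 'u1 list) \<Rightarrow> nat \<Rightarrow> 'b1 list op" and D2 :: "(nat \<Rightarrow> 'u2 list) \<Rightarrow> nat \<Rightarrow> 'b2 list op"
  assumes \<rho>: "\<And>x. density_op (\<rho> x)" and p: "\<And>z. 0 \<le> p z" "(\<Sum>z\<in>UNIV. p z) = 1"
    and p1: "\<And>u. p1 u = (\<Sum>v\<in>UNIV. p (u, v))" and p2: "\<And>v. p2 v = (\<Sum>u\<in>UNIV. p (u, v))"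
    and r1: "\<And>u v. p2 v * (p (u, v) / (p1 u * p2 v)) \<le> r1 u v" "\<And>u. (\<Sum>v\<in>UNIV. r1 u v) = 1"
    and r2: "\<And>u v. p1 u * (p (u, v) / (p1 u * p2 v)) \<le> r2 v u" "\<And>v. (\<Sum>u\<in>UNIV. r2 v u) = 1"
    and \<omega>1: "\<And>u a b. \<omega>1 u a b = (\<Sum>v\<in>UNIV. complex_of_real (r1 u v) * ptrace fst snd (\<rho> (f u v)) a b)"
    and \<omega>2: "\<And>v a b. \<omega>2 v a b = (\<Sum>u\<in>UNIV. complex_of_real (r2 v u) * ptrace snd fst (\<rho> (f u v)) a b)"
    and pos: "0 < M1" "0 < A1" "0 < M2" "0 < (A2::nat)"
    and dec1: "random_decoder n (M1 * A1) p1 \<omega>1 \<epsilon> D1" and dec2: "random_decoder n (M2 * A2) p2 \<omega>2 \<epsilon> D2"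
    and K: "0 \<le> K"
    and t: "t = (\<Sum>z\<in>words n. if K < (\<Prod>i<n. p (z ! i) / (p1 (fst (z ! i)) * p2 (snd (z ! i)))) then \<Prod>i<n. p (z ! i) else 0)"
    and \<epsilon>': "\<epsilon>' = 4 * \<epsilon> + 8 * (2 * t + K / (real A1 * real A2))"
  shows "\<exists>(c :: nat \<Rightarrow> nat \<Rightarrow> nat \<Rightarrow> 'x) \<Lambda> \<Gamma>. povm_on (words n) {..<M1} \<Lambda> \<and> povm_on (words n) {..<M2} \<Gamma> \<and>
    (\<Sum>m1<M1. \<Sum>m2<M2. err_prob n (\<Lambda> m1) (\<Gamma> m2) (chan_n \<rho> n (c m1 m2))) \<le> real (M1 * M2) * \<epsilon>'"
proof -
  note D1 = random_decoderD[OF dec1] and D2 = random_decoderD[OF dec2]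
  define L1 where "L1 = M1 * A1"
  define L2 where "L2 = M2 * A2"
  define q1 where "q1 u = (\<Prod>i<n. p1 (u ! i))" for u
  define q2 where "q2 v = (\<Prod>i<n. p2 (v ! i))" for v
  define h where "h u v = p (u, v) / (p1 u * p2 v)" for u v
  \<comment> \<open>The weight is set to 0 above \<open>K\<close>, not capped at \<open>K\<close>:
    it remains dominated by the product of the \<open>h\<close>, and the mass removed under the
    joint distribution is exactly \<open>t\<close>.\<close>
  define w where "w u v = (if (\<Prod>i<n. h (u ! i) (v ! i)) \<le> K then \<Prod>i<n. h (u ! i) (v ! i) else 0)" for u v
  have p10: "0 \<le> p1 u" and p20: "0 \<le> p2 v" for u v by (simp_all add: p1 p2 p sum_nonneg)
  have p1s: "(\<Sum>u\<in>UNIV. p1 u) = 1" using p(2) by (simp add: p1 sum_UNIV_Times)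
  have p2s: "(\<Sum>v\<in>UNIV. p2 v) = 1" unfolding p2 using p(2) by (subst sum.swap) (simp add: sum_UNIV_Times)
  have d1: "distr_on (words n) q1" unfolding q1_def by (rule distr_on_words[OF p10 p1s])
  have d2: "distr_on (words n) q2" unfolding q2_def by (rule distr_on_words[OF p20 p2s])
  have q10: "0 \<le> q1 u" and q20: "0 \<le> q2 v" for u v by (simp_all add: q1_def q2_def prod_nonneg p10 p20)
  have h0: "0 \<le> h u v" for u v by (simp add: h_def p p10 p20)
  have r1h: "p2 v * h u v \<le> r1 u v" and r2h: "p1 u * h u v \<le> r2 v u" for u v
    using r1(1) r2(1) by (simp_all only: h_def)
  have w0: "0 \<le> w u v" for u v by (simp add: w_def h0 prod_nonneg)
  have wK: "w u v \<le> K" for u v by (simp add: w_def K)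
  have wh: "w u v \<le> (\<Prod>i<n. h (u ! i) (v ! i))" for u v by (simp add: w_def h0 prod_nonneg)
  have qw2: "q2 v * w u v \<le> (\<Prod>i<n. r1 (u ! i) (v ! i))" for u v
  proof -
    have "q2 v * w u v \<le> q2 v * (\<Prod>i<n. h (u ! i) (v ! i))" by (rule mult_left_mono[OF wh q20])
    also have "\<dots> = (\<Prod>i<n. p2 (v ! i) * h (u ! i) (v ! i))" by (simp add: q2_def prod.distrib)
    also have "\<dots> \<le> (\<Prod>i<n. r1 (u ! i) (v ! i))" by (intro prod_mono conjI mult_nonneg_nonneg p20 h0 r1h)
    finally show ?thesis .
  qed
  have qw1: "q1 u * w u v \<le> (\<Prod>i<n. r2 (v ! i) (u ! i))" for u v
  proof -
    have "q1 u * w u v \<le> q1 u * (\<Prod>i<n. h (u ! i) (v ! i))" by (rule mult_left_mono[OF wh q10])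
    also have "\<dots> = (\<Prod>i<n. p1 (u ! i) * h (u ! i) (v ! i))" by (simp add: q1_def prod.distrib)
    also have "\<dots> \<le> (\<Prod>i<n. r2 (v ! i) (u ! i))" by (intro prod_mono conjI mult_nonneg_nonneg p10 h0 r2h)
    finally show ?thesis .
  qed
  have m2: "(\<Sum>v\<in>words n. q2 v * w u v) \<le> 1" for u
  proof -
    have "(\<Sum>v\<in>words n. q2 v * w u v) \<le> (\<Sum>v\<in>words n. \<Prod>i<n. r1 (u ! i) (v ! i))"
      by (rule sum_mono) (rule qw2)
    also have "\<dots> = 1" using sum_words_prod[of "\<lambda>i. r1 (u ! i)" n] r1(2) by simp
    finally show ?thesis .
  qed
  have m1: "(\<Sum>u\<in>words n. q1 u * w u v) \<le> 1" for v
  proof -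
    have "(\<Sum>u\<in>words n. q1 u * w u v) \<le> (\<Sum>u\<in>words n. \<Prod>i<n. r2 (v ! i) (u ! i))"
      by (rule sum_mono) (rule qw1)
    also have "\<dots> = 1" using sum_words_prod[of "\<lambda>i. r2 (v ! i)" n] r2(2) by simp
    finally show ?thesis .
  qed
  define g where "g = (\<Sum>u\<in>words n. \<Sum>v\<in>words n. q1 u * q2 v * w u v)"
  have tg: "1 - g = t"
  proof -
    define F where "F b u v = (if (K < (\<Prod>i<n. h (u ! i) (v ! i))) = b then \<Prod>i<n. p (u ! i, v ! i) else 0)" for b u v
    \<comment> \<open>Where a marginal vanishes so does \<open>p\<close>, hence the value that
      division by zero gives to \<open>h\<close> there does not matter.\<close>
    have z: "p1 u * p2 v * h u v = p (u, v)" for u v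
    proof -
      have "p (u, v) \<le> p1 u" unfolding p1 by (rule member_le_sum) (auto simp: p)
      moreover have "p (u, v) \<le> p2 v" unfolding p2 by (rule member_le_sum) (auto simp: p)
      ultimately have "p (u, v) = 0" if "p1 u = 0 \<or> p2 v = 0"
        using that p(1)[of "(u, v)"] by linarith
      then show ?thesis by (simp add: h_def)
    qed
    have "q1 u * q2 v * w u v = F False u v" for u v
    proof -
      have "q1 u * q2 v * (\<Prod>i<n. h (u ! i) (v ! i)) = (\<Prod>i<n. p (u ! i, v ! i))"
        unfolding q1_def q2_def z[symmetric] by (simp add: prod.distrib)
      then show ?thesis by (auto simp: w_def F_def)
    qed
    then have g: "g = (\<Sum>z\<in>words n. F False (map fst z) (map snd z))"
      unfolding g_def sum_words_pair by simp
    have prods: "(\<Prod>i<n. p (map fst z ! i, map snd z ! i)) = (\<Prod>i<n. p (z ! i))"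
      "(\<Prod>i<n. h (map fst z ! i) (map snd z ! i)) = (\<Prod>i<n. p (z ! i) / (p1 (fst (z ! i)) * p2 (snd (z ! i))))"
      if "z \<in> words n" for z
      using that by (auto intro!: prod.cong simp: h_def words_def)
    have tF: "t = (\<Sum>z\<in>words n. F True (map fst z) (map snd z))"
      unfolding t F_def by (intro sum.cong refl) (simp only: prods eq_True)
    have "F False (map fst z) (map snd z) + F True (map fst z) (map snd z) = (\<Prod>i<n. p (z ! i))"
      if "z \<in> words n" for z
      unfolding F_def prods[OF that] by simp
    then have "g + t = (\<Sum>z\<in>words n. \<Prod>i<n. p (z ! i))"
      unfolding g tF sum.distrib[symmetric] by (intro sum.cong refl)
    then show ?thesis using sum_words_iid[OF p(2), of n] by simp
  qed
  define e1 where "e1 c1 c2 x y = etr (words n) (compl_op (D1 c1 x)) (\<lambda>a b. \<Prod>i<n. ptrace fst snd (\<rho> (f (c1 x ! i) (c2 y ! i))) (a ! i) (b ! i))"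
    for c1 c2 and x y :: nat
  define e2 where "e2 c1 c2 x y = etr (words n) (compl_op (D2 c2 y)) (\<lambda>a b. \<Prod>i<n. ptrace snd fst (\<rho> (f (c1 x ! i) (c2 y ! i))) (a ! i) (b ! i))"
    for c1 c2 and x y :: nat
  \<comment> \<open>The complement of one outcome consists of the other outcomes and the
    rest.\<close>
  have gD1: "gram (words n) (compl_op (D1 c x))" if c: "c \<in> PiE {..<L1} (\<lambda>_. words n)" and x: "x < L1" for c x
  proof (rule gram_cong[OF gram_add[OF gram_sum[of "{..<L1} - {x}" "words n" "D1 c"] D1(2)[OF c[unfolded L1_def]]]])
    fix a b
    show "compl_op (D1 c x) a b = compl_op (\<lambda>a b. \<Sum>x<M1 * A1. D1 c x a b) a b + (\<Sum>s\<in>{..<L1} - {x}. D1 c s a b)"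
      unfolding L1_def[symmetric] compl_op_def using sum.remove[of "{..<L1}" x "\<lambda>s. D1 c s a b"] x by simp
  qed (use D1(1) c x in \<open>auto simp: L1_def\<close>)
  have gD2: "gram (words n) (compl_op (D2 c x))" if c: "c \<in> PiE {..<L2} (\<lambda>_. words n)" and x: "x < L2" for c x
  proof (rule gram_cong[OF gram_add[OF gram_sum[of "{..<L2} - {x}" "words n" "D2 c"] D2(2)[OF c[unfolded L2_def]]]])
    fix a b
    show "compl_op (D2 c x) a b = compl_op (\<lambda>a b. \<Sum>x<M2 * A2. D2 c x a b) a b + (\<Sum>s\<in>{..<L2} - {x}. D2 c s a b)"
      unfolding L2_def[symmetric] compl_op_def using sum.remove[of "{..<L2}" x "\<lambda>s. D2 c s a b"] x by simp
  qed (use D2(1) c x in \<open>auto simp: L2_def\<close>)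
  have \<sigma>1: "density_op (ptrace fst snd (\<rho> x))" and \<sigma>2: "density_op (ptrace snd fst (\<rho> x))" for x
    using density_op_ptrace_fst[OF \<rho>] density_op_ptrace_snd[OF \<rho>] by blast+
  define E where "E F = cbE {..<L1} (words n) q1 (\<lambda>c1. cbE {..<L2} (words n) q2 (F c1))" for F
  \<comment> \<open>The decoder of receiver 1 depends on \<open>c1\<close> only, so
    \<open>c2\<close> is averaged first and \<open>receiver_average\<close> applies with
    \<open>c1\<close> fixed. For receiver 2 the order of the two averages is exchanged.\<close>
  have Ee1: "E (\<lambda>c1 c2. w (c1 x) (c2 y) * e1 c1 c2 x y) \<le> \<epsilon>" if x: "x < L1" and y: "y < L2" for x y
  proof -
    have "E (\<lambda>c1 c2. w (c1 x) (c2 y) * e1 c1 c2 x y)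
      \<le> cbE {..<L1} (words n) q1 (\<lambda>c. etr (words n) (compl_op (D1 c x)) (\<lambda>a b. \<Prod>i<n. \<omega>1 (c x ! i) (a ! i) (b ! i)))"
      unfolding E_def
    proof (rule cbE_mono[OF d1])
      fix c assume c: "c \<in> PiE {..<L1} (\<lambda>_. words n :: 'u1 list set)"
      have "cbE {..<L2} (words n) q2 (\<lambda>c2. w (c x) (c2 y) * e1 c c2 x y)
          = (\<Sum>v\<in>words n. q2 v * (w (c x) v * etr (words n) (compl_op (D1 c x))
            (\<lambda>a b. \<Prod>i<n. ptrace fst snd (\<rho> (f (c x ! i) (v ! i))) (a ! i) (b ! i))))"
        unfolding e1_def by (rule cbE_single[OF finite_lessThan d2]) (use y in simp)
      also have "\<dots> \<le> etr (words n) (compl_op (D1 c x)) (\<lambda>a b. \<Prod>i<n. \<omega>1 (c x ! i) (a ! i) (b ! i))"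
        unfolding q2_def
        by (rule receiver_average[OF gD1[OF c x] \<sigma>1 w0 wh p20 h0 r1h \<omega>1])
      finally show "cbE {..<L2} (words n) q2 (\<lambda>c2. w (c x) (c2 y) * e1 c c2 x y)
        \<le> etr (words n) (compl_op (D1 c x)) (\<lambda>a b. \<Prod>i<n. \<omega>1 (c x ! i) (a ! i) (b ! i))" .
    qed
    also have "\<dots> \<le> \<epsilon>" unfolding L1_def q1_def[abs_def] by (rule D1(3)) (use x in \<open>simp add: L1_def\<close>)
    finally show ?thesis .
  qed
  have Ee2: "E (\<lambda>c1 c2. w (c1 x) (c2 y) * e2 c1 c2 x y) \<le> \<epsilon>" if x: "x < L1" and y: "y < L2" for x y
  proof -
    have "E (\<lambda>c1 c2. w (c1 x) (c2 y) * e2 c1 c2 x y)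
      \<le> cbE {..<L2} (words n) q2 (\<lambda>c. etr (words n) (compl_op (D2 c y)) (\<lambda>a b. \<Prod>i<n. \<omega>2 (c y ! i) (a ! i) (b ! i)))"
      unfolding E_def cbE_swap[of "{..<L1}"]
    proof (rule cbE_mono[OF d2])
      fix c assume c: "c \<in> PiE {..<L2} (\<lambda>_. words n :: 'u2 list set)"
      have "cbE {..<L1} (words n) q1 (\<lambda>c1. w (c1 x) (c y) * e2 c1 c x y)
          = (\<Sum>u\<in>words n. q1 u * (w u (c y) * etr (words n) (compl_op (D2 c y))
            (\<lambda>a b. \<Prod>i<n. ptrace snd fst (\<rho> (f (u ! i) (c y ! i))) (a ! i) (b ! i))))"
        unfolding e2_def by (rule cbE_single[OF finite_lessThan d1]) (use x in simp)
      also have "\<dots> \<le> etr (words n) (compl_op (D2 c y)) (\<lambda>a b. \<Prod>i<n. \<omega>2 (c y ! i) (a ! i) (b ! i))"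
        unfolding q1_def
        by (rule receiver_average[where \<tau> = "\<lambda>v u. ptrace snd fst (\<rho> (f u v))" and h = "\<lambda>v u. h u v",
              OF gD2[OF c y] \<sigma>2 w0 wh p10 h0 r2h \<omega>2])
      finally show "cbE {..<L1} (words n) q1 (\<lambda>c1. w (c1 x) (c y) * e2 c1 c x y)
        \<le> etr (words n) (compl_op (D2 c y)) (\<lambda>a b. \<Prod>i<n. \<omega>2 (c y ! i) (a ! i) (b ! i))" .
    qed
    also have "\<dots> \<le> \<epsilon>" unfolding L2_def q2_def[abs_def] by (rule D2(3)) (use y in \<open>simp add: L2_def\<close>)
    finally show ?thesis .
  qed
  define J1 where "J1 m = {m * A1..<m * A1 + A1}" for m
  define J2 where "J2 m = {m * A2..<m * A2 + A2}" for m
  define N where "N = real A1 * real A2"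
  have N: "0 < N" using pos by (simp add: N_def)
  have J1: "x < L1" "x div A1 = m" if "x \<in> J1 m" "m < M1" for x m
    using that bin_less[of m M1 x A1] bin_div[of x m A1] by (simp_all add: J1_def L1_def)
  have J2: "x < L2" "x div A2 = m" if "x \<in> J2 m" "m < M2" for x m
    using that bin_less[of m M2 x A2] bin_div[of x m A2] by (simp_all add: J2_def L2_def)
  \<comment> \<open>A bound on the error of the best pair in a product bin that does not refer to
    which pair is best, so that its expectation can be computed term by term.\<close>
  define B where "B m1 m2 c1 c2 = 2 / N * (\<Sum>x\<in>J1 m1. \<Sum>y\<in>J2 m2. w (c1 x) (c2 y) * (e1 c1 c2 x y + e2 c1 c2 x y))
      + 8 * ((\<Sum>x\<in>J1 m1. \<Sum>y\<in>J2 m2. w (c1 x) (c2 y)) / N - 1)\<^sup>2" for m1 m2 c1 c2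
  have E_sum: "E (\<lambda>c1 c2. \<Sum>a\<in>S. F a c1 c2) = (\<Sum>a\<in>S. E (F a))" for S :: "nat set" and F
    by (simp add: E_def cbE_sum)
  have E_cm: "E (\<lambda>c1 c2. k * F c1 c2) = k * E F" for k F
    by (simp add: E_def cbE_cmult)
  have E_add: "E (\<lambda>c1 c2. F c1 c2 + G c1 c2) = E F + E G" for F G
    by (simp add: E_def cbE_add)
  have EB: "E (B m1 m2) \<le> \<epsilon>'" if m: "m1 < M1" "m2 < M2" for m1 m2
  proof -
    have "E (B m1 m2) = 2 / N * (\<Sum>x\<in>J1 m1. \<Sum>y\<in>J2 m2. E (\<lambda>c1 c2. w (c1 x) (c2 y) * e1 c1 c2 x y)
          + E (\<lambda>c1 c2. w (c1 x) (c2 y) * e2 c1 c2 x y))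
        + 8 * E (\<lambda>c1 c2. ((\<Sum>x\<in>J1 m1. \<Sum>y\<in>J2 m2. w (c1 x) (c2 y)) / N - 1)\<^sup>2)"
      unfolding B_def[abs_def] E_add E_cm E_sum distrib_left ..
    also have "\<dots> \<le> 2 / N * (\<Sum>x\<in>J1 m1. \<Sum>y\<in>J2 m2. \<epsilon> + \<epsilon>) + 8 * (2 * (1 - g) + K / N)"
    proof (intro add_mono mult_left_mono sum_mono Ee1 Ee2)
      show "E (\<lambda>c1 c2. ((\<Sum>x\<in>J1 m1. \<Sum>y\<in>J2 m2. w (c1 x) (c2 y)) / N - 1)\<^sup>2) \<le> 2 * (1 - g) + K / N"
        unfolding E_def
        by (rule covering_second_moment[OF d1 d2 finite_lessThan finite_lessThan _ _ _ _ w0 wK m1 m2 g_def])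
          (use J1 J2 m pos in \<open>auto simp: J1_def J2_def N_def\<close>)
    qed (use N J1 J2 m in auto)
    also have "(\<Sum>x\<in>J1 m1. \<Sum>y\<in>J2 m2. \<epsilon> + \<epsilon>) = N * (2 * \<epsilon>)"
      by (simp add: J1_def J2_def N_def)
    also have "2 / N * (N * (2 * \<epsilon>)) + 8 * (2 * (1 - g) + K / N) = \<epsilon>'"
      using pos by (simp add: tg \<epsilon>' N_def)
    finally show ?thesis .
  qed
  define S where "S c1 c2 = (\<Sum>m1<M1. \<Sum>m2<M2. B m1 m2 c1 c2)" for c1 c2
  have "E S = (\<Sum>m1<M1. \<Sum>m2<M2. E (B m1 m2))"
    unfolding S_def[abs_def] E_sum ..
  also have "\<dots> \<le> (\<Sum>m1<M1. \<Sum>m2<M2. \<epsilon>')"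
    by (intro sum_mono EB) auto
  finally have ES: "E S \<le> real (M1 * M2) * \<epsilon>'" by simp
  \<comment> \<open>The bound is summed over all message pairs before the codebooks are fixed,
    because one choice of \<open>c1\<close> and \<open>c2\<close> has to serve all of them.\<close>
  have "\<exists>c1\<in>PiE {..<L1} (\<lambda>_. words n). cbE {..<L2} (words n) q2 (S c1) \<le> E S"
    unfolding E_def by (rule cbE_exists_le[OF finite_lessThan d1])
  then obtain c1 where c1: "c1 \<in> PiE {..<L1} (\<lambda>_. words n)" "cbE {..<L2} (words n) q2 (S c1) \<le> E S"
    by (rule bexE)
  have "\<exists>c2\<in>PiE {..<L2} (\<lambda>_. words n). S c1 c2 \<le> cbE {..<L2} (words n) q2 (S c1)"
    by (rule cbE_exists_le[OF finite_lessThan d2])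
  then obtain c2 where c2: "c2 \<in> PiE {..<L2} (\<lambda>_. words n)" "S c1 c2 \<le> cbE {..<L2} (words n) q2 (S c1)"
    by (rule bexE)
  have SB: "S c1 c2 \<le> real (M1 * M2) * \<epsilon>'" using c1 c2 ES by linarith
  obtain \<Lambda> where L: "\<And>m. m < M1 \<Longrightarrow> gram (words n) (\<Lambda> m)" "\<And>m. m < M1 \<Longrightarrow> gram (words n) (compl_op (\<Lambda> m))"
      "\<And>a b. a \<in> words n \<Longrightarrow> b \<in> words n \<Longrightarrow> (\<Sum>m<M1. \<Lambda> m a b) = (if a = b then 1 else 0)"
      "\<And>x. x < L1 \<Longrightarrow> gram (words n) (\<lambda>a b. \<Lambda> (x div A1) a b - D1 c1 x a b)"
    using binned_povm[OF D1(1,2)[OF c1(1)[unfolded L1_def]] pos(1,2)] unfolding L1_def by blast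
  obtain \<Gamma> where G: "\<And>m. m < M2 \<Longrightarrow> gram (words n) (\<Gamma> m)" "\<And>m. m < M2 \<Longrightarrow> gram (words n) (compl_op (\<Gamma> m))"
      "\<And>a b. a \<in> words n \<Longrightarrow> b \<in> words n \<Longrightarrow> (\<Sum>m<M2. \<Gamma> m a b) = (if a = b then 1 else 0)"
      "\<And>x. x < L2 \<Longrightarrow> gram (words n) (\<lambda>a b. \<Gamma> (x div A2) a b - D2 c2 x a b)"
    using binned_povm[OF D2(1,2)[OF c2(1)[unfolded L2_def]] pos(3,4)] unfolding L2_def by blast
  have "\<exists>xs. m1 < M1 \<longrightarrow> m2 < M2 \<longrightarrow> err_prob n (\<Lambda> m1) (\<Gamma> m2) (chan_n \<rho> n xs) \<le> B m1 m2 c1 c2" for m1 m2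
  proof (cases "m1 < M1 \<and> m2 < M2")
    case True
    have "\<exists>x\<in>J1 m1. \<exists>y\<in>J2 m2. e1 c1 c2 x y + e2 c1 c2 x y \<le> B m1 m2 c1 c2"
      unfolding B_def
    proof (rule weighted_selection[OF _ _ _ _ N w0])
      fix x y assume "x \<in> J1 m1" "y \<in> J2 m2"
      then have xy: "x < L1" "y < L2" using J1 J2 True by auto
      have "0 \<le> e1 c1 c2 x y" unfolding e1_def
        by (rule etr_nonneg[OF gD1[OF c1(1) xy(1)] psd_on_product[OF \<sigma>1]])
      moreover have "0 \<le> e2 c1 c2 x y" unfolding e2_def
        by (rule etr_nonneg[OF gD2[OF c2(1) xy(2)] psd_on_product[OF \<sigma>2]])
      moreover have "e1 c1 c2 x y \<le> 1" unfolding e1_def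
        by (rule etr_compl_le_1[OF D1(1)[OF c1(1)[unfolded L1_def] xy(1)[unfolded L1_def]] \<sigma>1])
      moreover have "e2 c1 c2 x y \<le> 1" unfolding e2_def
        by (rule etr_compl_le_1[OF D2(1)[OF c2(1)[unfolded L2_def] xy(2)[unfolded L2_def]] \<sigma>2])
      ultimately show "0 \<le> e1 c1 c2 x y + e2 c1 c2 x y \<and> e1 c1 c2 x y + e2 c1 c2 x y \<le> 2" by simp
    qed (use pos in \<open>auto simp: J1_def J2_def\<close>)
    then obtain x y where xy: "x \<in> J1 m1" "y \<in> J2 m2" and le: "e1 c1 c2 x y + e2 c1 c2 x y \<le> B m1 m2 c1 c2" by blast
    have lt: "x < L1" "x div A1 = m1" "y < L2" "y div A2 = m2" using J1 J2 xy True by auto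
    define xs where "xs i = f (c1 x ! i) (c2 y ! i)" for i
    \<comment> \<open>Passing from the outcome of the word \<open>x\<close> to the outcome of its
      bin can only lower the error.\<close>
    have s1: "etr (words n) (compl_op (\<Lambda> m1)) (\<lambda>a b. \<Prod>i<n. ptrace fst snd (\<rho> (xs i)) (a ! i) (b ! i)) \<le> e1 c1 c2 x y"
      (is "etr _ _ ?R \<le> _")
    proof -
      have "e1 c1 c2 x y - etr (words n) (compl_op (\<Lambda> m1)) ?R = etr (words n) (\<lambda>a b. \<Lambda> m1 a b - D1 c1 x a b) ?R"
        unfolding e1_def xs_def[symmetric] etr_diff[symmetric] by (rule etr_cong) (auto simp: compl_op_def)
      moreover have "0 \<le> etr (words n) (\<lambda>a b. \<Lambda> m1 a b - D1 c1 x a b) ?R"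
        using L(4)[OF lt(1)] unfolding lt(2) by (rule etr_nonneg[OF _ psd_on_product[OF \<sigma>1]])
      ultimately show ?thesis by simp
    qed
    have s2: "etr (words n) (compl_op (\<Gamma> m2)) (\<lambda>a b. \<Prod>i<n. ptrace snd fst (\<rho> (xs i)) (a ! i) (b ! i)) \<le> e2 c1 c2 x y"
      (is "etr _ _ ?R \<le> _")
    proof -
      have "e2 c1 c2 x y - etr (words n) (compl_op (\<Gamma> m2)) ?R = etr (words n) (\<lambda>a b. \<Gamma> m2 a b - D2 c2 y a b) ?R"
        unfolding e2_def xs_def[symmetric] etr_diff[symmetric] by (rule etr_cong) (auto simp: compl_op_def)
      moreover have "0 \<le> etr (words n) (\<lambda>a b. \<Gamma> m2 a b - D2 c2 y a b) ?R"
        using G(4)[OF lt(3)] unfolding lt(4) by (rule etr_nonneg[OF _ psd_on_product[OF \<sigma>2]])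
      ultimately show ?thesis by simp
    qed
    have "err_prob n (\<Lambda> m1) (\<Gamma> m2) (chan_n \<rho> n xs) \<le> B m1 m2 c1 c2"
      using err_prob_le[where \<rho> = \<rho> and xs = xs, OF \<rho> L(2)[OF conjunct1[OF True]] G(2)[OF conjunct2[OF True]]] s1 s2 le by linarith
    then show ?thesis by blast
  qed simp
  then have "\<forall>m1 m2. \<exists>xs. m1 < M1 \<longrightarrow> m2 < M2 \<longrightarrow> err_prob n (\<Lambda> m1) (\<Gamma> m2) (chan_n \<rho> n xs) \<le> B m1 m2 c1 c2"
    by blast
  then obtain c where c: "\<And>m1 m2. m1 < M1 \<Longrightarrow> m2 < M2 \<Longrightarrow>
      err_prob n (\<Lambda> m1) (\<Gamma> m2) (chan_n \<rho> n (c m1 m2)) \<le> B m1 m2 c1 c2"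
    unfolding choice_iff by blast
  have "povm_on (words n) {..<M1} \<Lambda>"
    unfolding povm_on_def by (auto intro: gram_imp_psd_on L(1) simp: L(3))
  moreover have "povm_on (words n) {..<M2} \<Gamma>"
    unfolding povm_on_def by (auto intro: gram_imp_psd_on G(1) simp: G(3))
  moreover have "(\<Sum>m1<M1. \<Sum>m2<M2. err_prob n (\<Lambda> m1) (\<Gamma> m2) (chan_n \<rho> n (c m1 m2))) \<le> S c1 c2"
    unfolding S_def using c by (intro sum_mono) auto
  ultimately show ?thesis using SB by (intro exI[of _ c] exI[of _ \<Lambda>] exI[of _ \<Gamma>]) auto
qed

section \<open>Marginals of the state theta and their mutual informations\<close>

lemma ptrace_reindex:
  fixes g :: "'k::finite \<times> 't::finite \<Rightarrow> 'i::finite"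
  assumes g: "\<And>i. g (keep i, trc i) = i" and k: "\<And>z. keep (g z) = fst z" "\<And>z. trc (g z) = snd z"
  shows "ptrace keep trc A k k' = (\<Sum>t\<in>UNIV. A (g (k, t)) (g (k', t)))"
proof -
  have bij: "bij_betw g UNIV UNIV"
    by (rule bij_betw_byWitness[where f' = "\<lambda>i. (keep i, trc i)"]) (auto simp: g k)
  have "ptrace keep trc A k k' = ptrace fst snd (\<lambda>z z'. A (g z) (g z')) k k'"
    unfolding ptrace_def by (simp add: k flip: sum.reindex_bij_betw[OF bij])
  then show ?thesis by (simp add: ptrace_fst)
qed

text \<open>The factorisation \<open>p = p1 * r1\<close> identifies the effective channel of
  receiver 1: on input \<open>u\<close> it outputs the local states averaged with the conditional
  distribution \<open>r1 u\<close>.\<close>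

lemma theta_U1B1_eq_cq_state:
  fixes p :: "'u1::finite \<times> 'u2::finite \<Rightarrow> real" and \<rho> :: "'x \<Rightarrow> ('b1::finite \<times> 'b2::finite) op"
  assumes "\<And>u v. p1 u * r1 u v = p (u, v)"
  shows "theta_U1B1 p f \<rho>
    = cq_state p1 (\<lambda>u a b. \<Sum>v\<in>UNIV. complex_of_real (r1 u v) * ptrace fst snd (\<rho> (f u v)) a b)"
proof (intro ext)
  fix k k' :: "'u1 \<times> 'b1"
  have "theta_U1B1 p f \<rho> k k' = (\<Sum>t\<in>UNIV. theta_state p f \<rho> (fst k, fst t, snd k, snd t) (fst k', fst t, snd k', snd t))"
    unfolding theta_U1B1_def
    by (subst ptrace_reindex[where g = "\<lambda>(k, t). (fst k, fst t, snd k, snd t)"]) auto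
  also have "\<dots> = (if fst k = fst k' then \<Sum>v\<in>UNIV. \<Sum>b\<in>UNIV.
      complex_of_real (p (fst k, v)) * \<rho> (f (fst k) v) (snd k, b) (snd k', b) else 0)"
    by (simp add: theta_state_def sum_UNIV_Times)
  also have "\<dots> = (if fst k = fst k' then complex_of_real (p1 (fst k)) *
      (\<Sum>v\<in>UNIV. complex_of_real (r1 (fst k) v) * ptrace fst snd (\<rho> (f (fst k) v)) (snd k) (snd k')) else 0)"
    by (simp add: ptrace_fst sum_distrib_left flip: assms mult.assoc)
  finally show "theta_U1B1 p f \<rho> k k'
      = cq_state p1 (\<lambda>u a b. \<Sum>v\<in>UNIV. complex_of_real (r1 u v) * ptrace fst snd (\<rho> (f u v)) a b) k k'"
    by (simp add: cq_state_def case_prod_unfold)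
qed

lemma theta_U2B2_eq_cq_state:
  fixes p :: "'u1::finite \<times> 'u2::finite \<Rightarrow> real" and \<rho> :: "'x \<Rightarrow> ('b1::finite \<times> 'b2::finite) op"
  assumes "\<And>u v. p2 v * r2 v u = p (u, v)"
  shows "theta_U2B2 p f \<rho>
    = cq_state p2 (\<lambda>v a b. \<Sum>u\<in>UNIV. complex_of_real (r2 v u) * ptrace snd fst (\<rho> (f u v)) a b)"
proof (intro ext)
  fix k k' :: "'u2 \<times> 'b2"
  have "theta_U2B2 p f \<rho> k k' = (\<Sum>t\<in>UNIV. theta_state p f \<rho> (fst t, fst k, snd t, snd k) (fst t, fst k', snd t, snd k'))"
    unfolding theta_U2B2_def
    by (subst ptrace_reindex[where g = "\<lambda>(k, t). (fst t, fst k, snd t, snd k)"]) auto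
  also have "\<dots> = (if fst k = fst k' then \<Sum>u\<in>UNIV. \<Sum>b\<in>UNIV.
      complex_of_real (p (u, fst k)) * \<rho> (f u (fst k)) (b, snd k) (b, snd k') else 0)"
    by (simp add: theta_state_def sum_UNIV_Times)
  also have "\<dots> = (if fst k = fst k' then complex_of_real (p2 (fst k)) *
      (\<Sum>u\<in>UNIV. complex_of_real (r2 (fst k) u) * ptrace snd fst (\<rho> (f u (fst k))) (snd k) (snd k')) else 0)"
    by (simp add: ptrace_snd sum_distrib_left flip: assms mult.assoc)
  finally show "theta_U2B2 p f \<rho> k k'
      = cq_state p2 (\<lambda>v a b. \<Sum>u\<in>UNIV. complex_of_real (r2 v u) * ptrace snd fst (\<rho> (f u v)) a b) k k'"
    by (simp add: cq_state_def case_prod_unfold)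
qed

lemma theta_U1U2_eq_diag_op:
  fixes p :: "'u1::finite \<times> 'u2::finite \<Rightarrow> real" and \<rho> :: "'x \<Rightarrow> ('b1::finite \<times> 'b2::finite) op"
  assumes \<rho>: "\<And>x. density_op (\<rho> x)"
  shows "theta_U1U2 p f \<rho> = diag_op p"
proof (intro ext)
  fix k k' :: "'u1 \<times> 'u2"
  have "theta_U1U2 p f \<rho> k k' = (\<Sum>t\<in>UNIV. theta_state p f \<rho> (fst k, snd k, t) (fst k', snd k', t))"
    unfolding theta_U1U2_def
    by (subst ptrace_reindex[where g = "\<lambda>(k, t). (fst k, snd k, t)"]) auto
  also have "\<dots> = (if k = k' then complex_of_real (p k) * trace_on UNIV (\<rho> (f (fst k) (snd k))) else 0)"
  proof (cases "k = k'")
    case True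
    then show ?thesis by (simp add: theta_state_def trace_on_def sum_distrib_left)
  next
    case False
    then have "fst k \<noteq> fst k' \<or> snd k \<noteq> snd k'" by (auto simp: prod_eq_iff)
    then show ?thesis using False by (auto simp: theta_state_def intro!: sum.neutral)
  qed
  finally show "theta_U1U2 p f \<rho> k k' = diag_op p k k'"
    using \<rho> by (simp add: diag_op_def density_op_def)
qed

text \<open>Exhibits the mutual information as the mean logarithm of the weight under
  \<open>p\<close>, the form required by \<open>iid_tail_tendsto_0\<close>. Where
  \<open>p z > 0\<close> both marginals are positive and the logarithm splits; elsewhere the term is
  0.\<close>

lemma qmutual_info_diag_op_log:
  fixes p :: "'a::finite \<times> 'b::finite \<Rightarrow> real"
  assumes p: "\<And>z. 0 \<le> p z" and p1: "\<And>u. p1 u = (\<Sum>v\<in>UNIV. p (u, v))" and p2: "\<And>v. p2 v = (\<Sum>u\<in>UNIV. p (u, v))"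
  shows "qmutual_info (diag_op p) = (\<Sum>z\<in>UNIV. p z * log 2 (p z / (p1 (fst z) * p2 (snd z))))"
proof -
  have p10: "0 \<le> p1 u" and p20: "0 \<le> p2 v" for u v by (simp_all add: p1 p2 p sum_nonneg)
  have eta: "eta y = - y * log 2 y" if "0 \<le> y" for y
    using that by (auto simp: eta_def)
  have "p (u, v) * log 2 (p (u, v) / (p1 u * p2 v))
      = p (u, v) * log 2 (p (u, v)) - p (u, v) * log 2 (p1 u) - p (u, v) * log 2 (p2 v)" for u v
  proof (cases "p (u, v) = 0")
    case False
    then have "0 < p (u, v)" using p[of "(u, v)"] by simp
    moreover have "p (u, v) \<le> p1 u" unfolding p1 by (rule member_le_sum) (auto simp: p)
    moreover have "p (u, v) \<le> p2 v" unfolding p2 by (rule member_le_sum) (auto simp: p)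
    ultimately show ?thesis by (simp add: log_divide log_mult algebra_simps)
  qed simp
  then have "(\<Sum>z\<in>UNIV. p z * log 2 (p z / (p1 (fst z) * p2 (snd z))))
      = (\<Sum>u\<in>UNIV. \<Sum>v\<in>UNIV. p (u, v) * log 2 (p (u, v))) - (\<Sum>u\<in>UNIV. \<Sum>v\<in>UNIV. p (u, v) * log 2 (p1 u))
        - (\<Sum>u\<in>UNIV. \<Sum>v\<in>UNIV. p (u, v) * log 2 (p2 v))"
    by (simp add: sum_UNIV_Times sum_subtractf)
  also have "(\<Sum>u\<in>UNIV. \<Sum>v\<in>UNIV. p (u, v) * log 2 (p (u, v))) = - (\<Sum>z\<in>UNIV. eta (p z))"
    by (simp add: sum_UNIV_Times eta p sum_negf)
  also have "(\<Sum>u\<in>UNIV. \<Sum>v\<in>UNIV. p (u, v) * log 2 (p1 u)) = - (\<Sum>u\<in>UNIV. eta (p1 u))"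
  proof -
    have "(\<Sum>v\<in>UNIV. p (u, v) * log 2 (p1 u)) = p1 u * log 2 (p1 u)" for u
      by (simp only: p1[of u] sum_distrib_right)
    then show ?thesis by (simp add: eta p10 sum_negf)
  qed
  also have "(\<Sum>u\<in>UNIV. \<Sum>v\<in>UNIV. p (u, v) * log 2 (p2 v)) = - (\<Sum>v\<in>UNIV. eta (p2 v))"
  proof -
    have "(\<Sum>u\<in>UNIV. p (u, v) * log 2 (p2 v)) = p2 v * log 2 (p2 v)" for v
      by (simp only: p2[of v] sum_distrib_right)
    then show ?thesis by (subst sum.swap) (simp add: eta p20 sum_negf)
  qed
  finally show ?thesis by (simp add: qmutual_info_diag_op p1 p2)
qed

section \<open>Numbers of messages and sizes of bins\<close>

lemma msg_num_pos: "0 < msg_num n r"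
  by (simp add: msg_num_def)

text \<open>The ceiling of a number in (0, 1] is 1. In particular the common rate
  \<open>0 - \<delta>\<close> leaves a single common message.\<close>

lemma msg_num_nonpos_rate:
  assumes "r \<le> 0"
  shows "msg_num n r = 1"
proof -
  have "2 powr (real n * r) \<le> 2 powr 0"
    using assms by (intro powr_mono) (auto simp: mult_nonneg_nonpos)
  then have "\<lceil>2 powr (real n * r)\<rceil> = 1"
    by (intro ceiling_unique) auto
  then show ?thesis by (simp add: msg_num_def)
qed

lemma msg_num_le: "real (msg_num n r) \<le> 2 powr (real n * r) + 1"
  using ceiling_correct[of "2 powr (real n * r)"] by (simp add: msg_num_def)

text \<open>At a negative rate there is still one message, so estimates have to use the rate clipped
  at 0.\<close>

lemma msg_num_le_max: "real (msg_num n r) \<le> 2 * 2 powr (real n * max r 0)"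
proof -
  have "2 powr (real n * r) \<le> 2 powr (real n * max r 0)"
    by (intro powr_mono mult_left_mono) auto
  moreover have "1 \<le> 2 powr (real n * max r 0)"
    by (rule ge_one_powr_ge_zero) auto
  ultimately show ?thesis using msg_num_le[of n r] by linarith
qed

text \<open>With \<open>X = 2 powr (n * s)\<close>, rounding up \<open>A\<close> adds at most the
  number of messages to the number of codewords, which gives at most \<open>X + msg_num n r\<close>,
  and \<open>msg_num n r \<le> X + 1\<close>. Subtracting 1 absorbs this last 1; without that, the
  bound would fail for \<open>X < 1 / 2\<close>, where one codeword is left.\<close>

lemma bin_size:
  assumes r: "r \<le> s" and A_def: "A = nat \<lceil>2 powr (real n * s) / real (msg_num n r)\<rceil>"
  shows "0 < A" "2 powr (real n * s) / real (msg_num n r) \<le> real A"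
    "real (msg_num n r * A - 1) \<le> 2 * 2 powr (real n * s)"
proof -
  let ?X = "2 powr (real n * s)" and ?M = "real (msg_num n r)"
  have M: "0 < ?M" using msg_num_pos by simp
  show A: "0 < A" using M by (simp add: A_def)
  show "?X / ?M \<le> real A" by (simp add: A_def real_nat_ceiling_ge)
  have "real A \<le> ?X / ?M + 1"
    using ceiling_correct[of "?X / ?M"] M by (simp add: A_def)
  then have "?M * real A \<le> ?M * (?X / ?M + 1)" using M by (intro mult_left_mono) auto
  also have "\<dots> = ?X + ?M" using M by (simp add: field_simps)
  finally have "?M * real A - 1 \<le> ?X + ?M - 1" by (rule diff_right_mono)
  also have "\<dots> \<le> ?X + 2 powr (real n * r)" using msg_num_le[of n r] by simp
  also have "\<dots> \<le> ?X + ?X" using r by (intro add_left_mono powr_mono mult_left_mono) auto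
  also have "?M * real A - 1 = real (msg_num n r * A - 1)"
    using A msg_num_pos[of n r] by (simp add: of_nat_diff Suc_le_eq)
  finally show "real (msg_num n r * A - 1) \<le> 2 * ?X" by simp
qed

lemma is_code_no_common:
  fixes \<rho> :: "'x \<Rightarrow> ('b1 \<times> 'b2) op"
  assumes \<Lambda>: "povm_on (words n) {..<msg_num n R1} \<Lambda>" and \<Gamma>: "povm_on (words n) {..<msg_num n R2} \<Gamma>"
    and R: "R \<le> 0"
    and err: "(\<Sum>m1<msg_num n R1. \<Sum>m2<msg_num n R2. err_prob n (\<Lambda> m1) (\<Gamma> m2) (chan_n \<rho> n (c m1 m2)))
      \<le> real (msg_num n R1 * msg_num n R2) * \<epsilon>"
  shows "is_code \<rho> n R1 R R2 \<epsilon>"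
proof -
  let ?M1 = "msg_num n R1" and ?M2 = "msg_num n R2"
  have s: "{..<1} = {0::nat}" by auto
  have "povm_on (words n) ({..<?M1} \<times> {..<1}) (\<lambda>(m1, m :: nat). \<Lambda> m1)"
    using \<Lambda> by (auto simp: povm_on_def s sum.cartesian_product')
  moreover have "povm_on (words n) ({..<1} \<times> {..<?M2}) (\<lambda>(m :: nat, m2). \<Gamma> m2)"
    using \<Gamma> by (auto simp: povm_on_def s sum.cartesian_product')
  moreover have "(\<Sum>m1<?M1. \<Sum>m<1. \<Sum>m2<?M2. err_prob n ((\<lambda>(m1, m :: nat). \<Lambda> m1) (m1, m))
      ((\<lambda>(m :: nat, m2). \<Gamma> m2) (m, m2)) (chan_n \<rho> n (c m1 m2))) / real (?M1 * 1 * ?M2) \<le> \<epsilon>"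
    using err msg_num_pos[of n R1] msg_num_pos[of n R2]
    by (simp add: pos_divide_le_eq mult.commute)
  ultimately show ?thesis
    unfolding is_code_def Let_def msg_num_nonpos_rate[OF R]
    by (intro exI[of _ "\<lambda>m1 m m2. c m1 m2"] exI conjI)
qed

lemma psd_on_identity: "finite C \<Longrightarrow> psd_on C (\<lambda>a b. if a = b then 1 else 0)"
  by (rule gram_imp_psd_on, rule gram_cong[OF gram_cinner[of C C ket]]) (simp_all add: cinner_ket)

text \<open>With one message of each kind the identity measurement never errs, whatever is
  sent.\<close>

lemma is_code_trivial:
  fixes \<rho> :: "'x \<Rightarrow> ('b1::finite \<times> 'b2::finite) op"
  assumes R: "R1 \<le> 0" "R \<le> 0" "R2 \<le> 0" and \<epsilon>: "0 \<le> \<epsilon>"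
  shows "is_code \<rho> n R1 R R2 \<epsilon>"
proof -
  let ?I = "\<lambda>(m :: nat) a b. if a = b then 1 else 0 :: complex"
  have povm: "povm_on (words n) {..<msg_num n R1} (?I :: nat \<Rightarrow> 'b1 list op)"
    "povm_on (words n) {..<msg_num n R2} (?I :: nat \<Rightarrow> 'b2 list op)"
    by (auto simp: povm_on_def msg_num_nonpos_rate R psd_on_identity)
  have err: "err_prob n (?I m1) (?I m2) X = 0" for m1 m2 and X :: "('b1 list \<times> 'b2 list) op"
    unfolding err_prob_def by (subst sum.neutral) (auto intro!: sum.neutral)
  show ?thesis
    by (rule is_code_no_common[where c = "\<lambda>_ _. undefined", OF povm R(2)])
      (use R \<epsilon> in \<open>simp add: msg_num_nonpos_rate err\<close>)
qed

theorem theorem6p2: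
  fixes \<rho> :: "'x::finite \<Rightarrow> (('b1::finite) \<times> ('b2::finite)) op"
    and p :: "('u1::finite) \<times> ('u2::finite) \<Rightarrow> real"
    and f :: "'u1 \<Rightarrow> 'u2 \<Rightarrow> 'x"
    and R1 R2 :: real
  assumes "\<And>x. density_op (\<rho> x)"
    and "\<And>u. p u \<ge> 0" and "(\<Sum>u\<in>UNIV. p u) = 1"
    and "R1 \<ge> 0" and "R2 \<ge> 0"
    and "R1 \<le> qmutual_info (theta_U1B1 p f \<rho>)"
    and "R2 \<le> qmutual_info (theta_U2B2 p f \<rho>)"
    and "R1 + R2 \<le> qmutual_info (theta_U1B1 p f \<rho>) + qmutual_info (theta_U2B2 p f \<rho>)
                   - qmutual_info (theta_U1U2 p f \<rho>)"
  shows "achievable \<rho> R1 0 R2"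
proof -
  note \<rho> = assms(1) and p = assms(2,3)
  define p1 where "p1 u = (\<Sum>v\<in>UNIV. p (u, v))" for u
  define p2 where "p2 v = (\<Sum>u\<in>UNIV. p (u, v))" for v
  \<comment> \<open>The conditional distribution of the second letter given the first. On inputs of
    probability 0 it defaults to \<open>p2\<close>, so that every \<open>\<omega>1 u\<close> is a
    density operator; the product with \<open>p1\<close> is \<open>p\<close> in both cases.\<close>
  define r1 where "r1 u v = (if p1 u = 0 then p2 v else p (u, v) / p1 u)" for u v
  define r2 where "r2 v u = (if p2 v = 0 then p1 u else p (u, v) / p2 v)" for v u
  define \<omega>1 where "\<omega>1 u a b = (\<Sum>v\<in>UNIV. complex_of_real (r1 u v) * ptrace fst snd (\<rho> (f u v)) a b)" for u a b
  define \<omega>2 where "\<omega>2 v a b = (\<Sum>u\<in>UNIV. complex_of_real (r2 v u) * ptrace snd fst (\<rho> (f u v)) a b)" for v a b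
  have p10: "0 \<le> p1 u" and p20: "0 \<le> p2 v" for u v by (simp_all add: p1_def p2_def p sum_nonneg)
  have p1s: "(\<Sum>u\<in>UNIV. p1 u) = 1" using p(2) by (simp add: p1_def sum_UNIV_Times)
  have p2s: "(\<Sum>v\<in>UNIV. p2 v) = 1" unfolding p2_def using p(2) by (subst sum.swap) (simp add: sum_UNIV_Times)
  have le: "p (u, v) \<le> p1 u" "p (u, v) \<le> p2 v" for u v
    unfolding p1_def p2_def by (rule member_le_sum; auto simp: p)+
  have pz: "p (u, v) = 0" if "p1 u = 0 \<or> p2 v = 0" for u v
    using that le[of u v] p(1)[of "(u, v)"] by linarith
  have r1s: "(\<Sum>v\<in>UNIV. r1 u v) = 1" for u
    by (cases "p1 u = 0") (simp_all add: r1_def p2s flip: sum_divide_distrib p1_def)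
  have r2s: "(\<Sum>u\<in>UNIV. r2 v u) = 1" for v
    by (cases "p2 v = 0") (simp_all add: r2_def p1s flip: sum_divide_distrib p2_def)
  have r1: "0 \<le> r1 u v" "(\<Sum>v\<in>UNIV. r1 u v) = 1" "p1 u * r1 u v = p (u, v)"
    "p2 v * (p (u, v) / (p1 u * p2 v)) \<le> r1 u v" for u v
    using p p10 p20 pz r1s by (auto simp: r1_def)
  have r2: "0 \<le> r2 v u" "(\<Sum>u\<in>UNIV. r2 v u) = 1" "p2 v * r2 v u = p (u, v)"
    "p1 u * (p (u, v) / (p1 u * p2 v)) \<le> r2 v u" for u v
    using p p10 p20 pz r2s by (auto simp: r2_def)
  have \<omega>1: "density_op (\<omega>1 u)" for u
    unfolding \<omega>1_def[abs_def] by (rule density_op_mixture[OF r1(1,2) density_op_ptrace_fst[OF \<rho>]])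
  have \<omega>2: "density_op (\<omega>2 v)" for v
    unfolding \<omega>2_def[abs_def] by (rule density_op_mixture[OF r2(1,2) density_op_ptrace_snd[OF \<rho>]])
  define I1 where "I1 = qmutual_info (cq_state p1 \<omega>1)"
  define I2 where "I2 = qmutual_info (cq_state p2 \<omega>2)"
  define I12 where "I12 = qmutual_info (diag_op p)"
  have R: "0 \<le> R1" "0 \<le> R2" "R1 \<le> I1" "R2 \<le> I2" "R1 + R2 \<le> I1 + I2 - I12"
    using assms(4-8)
    unfolding theta_U1B1_eq_cq_state[where p = p and ?p1.0 = p1 and ?r1.0 = r1, OF r1(3)]
      theta_U2B2_eq_cq_state[where p = p and ?p2.0 = p2 and ?r2.0 = r2, OF r2(3)] theta_U1U2_eq_diag_op[OF \<rho>]
    by (simp_all add: I1_def I2_def I12_def \<omega>1_def[abs_def] \<omega>2_def[abs_def])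
  show ?thesis
    unfolding achievable_def
  proof (intro allI impI)
    fix \<epsilon> \<delta> :: real assume \<epsilon>: "0 < \<epsilon>" and \<delta>: "0 < \<delta>"
    show "\<exists>N. \<forall>n\<ge>N. is_code \<rho> n (R1 - \<delta>) (0 - \<delta>) (R2 - \<delta>) \<epsilon>"
    proof (cases "R1 \<le> \<delta> \<and> R2 \<le> \<delta>")
      \<comment> \<open>Here both lowered rates are at most 0 and clip to 0, while
        \<open>I1 + I2 - I12\<close> may be 0 as well, so lowering the rates need not leave any
        slack for binning.\<close>
      case True
      then show ?thesis using \<epsilon> \<delta> by (auto intro!: is_code_trivial)
    next
      case False
      define d where "d = \<delta> / 4"
      have d: "0 < d" using \<delta> by (simp add: d_def)
      \<comment> \<open>If both lowered rates are positive, the slack is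
        \<open>2 * \<delta>\<close>. If only one is, the other rate is nonnegative and can be added
        back, so that \<open>\<delta> = 4 * d\<close> remains.\<close>
      have rates: "max (R1 - \<delta>) 0 + max (R2 - \<delta>) 0 \<le> I1 + I2 - I12 - 4 * d"
        using False R \<delta> by (auto simp: d_def max_def)
      define h where "h z = p z / (p1 (fst z) * p2 (snd z))" for z
      define t where "t n = (\<Sum>z\<in>words n. if 2 powr (real n * (I12 + d)) < (\<Prod>i<n. h (z ! i)) then \<Prod>i<n. p (z ! i) else 0)" for n
      have "t \<longlonglongrightarrow> 0"
        unfolding t_def
      proof (rule iid_tail_tendsto_0[OF p])
        show "I12 = (\<Sum>z\<in>UNIV. p z * log 2 (h z))"
          unfolding I12_def h_def by (rule qmutual_info_diag_op_log[OF p(1) p1_def p2_def])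
        show "0 \<le> h z" for z by (simp add: h_def p p10 p20)
        show "0 < h z" if "0 < p z" for z
          using that le[of "fst z" "snd z"] by (simp add: h_def)
      qed (rule d)
      moreover have "(\<lambda>n. 2 powr (- real n * d)) \<longlonglongrightarrow> 0"
      proof -
        have "(\<lambda>n. (2 powr (- d)) ^ n) \<longlonglongrightarrow> 0"
          using d by (intro LIMSEQ_realpow_zero) (auto simp: powr_less_one)
        then show ?thesis by (simp add: powr_power mult.commute)
      qed
      ultimately have "(\<lambda>n. 16 * t n + 32 * 2 powr (- real n * d)) \<longlonglongrightarrow> 16 * 0 + 32 * 0"
        by (intro tendsto_intros)
      then have "eventually (\<lambda>n. 16 * t n + 32 * 2 powr (- real n * d) < \<epsilon> / 2) sequentially"
        using \<epsilon> by (intro order_tendstoD(2)) auto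
      then obtain N0 where N0: "\<And>n. n \<ge> N0 \<Longrightarrow> 16 * t n + 32 * 2 powr (- real n * d) < \<epsilon> / 2"
        by (auto simp: eventually_sequentially)
      have \<epsilon>8: "0 < \<epsilon> / 8" using \<epsilon> by simp
      obtain N1 where N1: "\<forall>n\<ge>N1. \<forall>L. real (L - 1) \<le> 2 * 2 powr (real n * (I1 - d)) \<longrightarrow>
          (\<exists>D. random_decoder n L p1 \<omega>1 (\<epsilon> / 8) D)"
        using hsw_packing[OF p10 p1s \<omega>1 \<epsilon>8 d] unfolding I1_def by (rule exE)
      obtain N2 where N2: "\<forall>n\<ge>N2. \<forall>L. real (L - 1) \<le> 2 * 2 powr (real n * (I2 - d)) \<longrightarrow>
          (\<exists>D. random_decoder n L p2 \<omega>2 (\<epsilon> / 8) D)"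
        using hsw_packing[OF p20 p2s \<omega>2 \<epsilon>8 d] unfolding I2_def by (rule exE)
      show ?thesis
      proof (intro exI[of _ "max N0 (max N1 N2)"] allI impI)
        fix n assume n: "max N0 (max N1 N2) \<le> n"
        let ?M1 = "msg_num n (R1 - \<delta>)" and ?M2 = "msg_num n (R2 - \<delta>)"
        \<comment> \<open>The bins are as large as receiver 1 tolerates: all of them together
          contain about \<open>2 powr (n * (I1 - d))\<close> codewords.\<close>
        define A1 where "A1 = nat \<lceil>2 powr (real n * (I1 - d)) / real ?M1\<rceil>"
        define A2 where "A2 = nat \<lceil>2 powr (real n * (I2 - d)) / real ?M2\<rceil>"
        define K where "K = 2 powr (real n * (I12 + d))"
        have "R1 - \<delta> \<le> I1 - d" "R2 - \<delta> \<le> I2 - d" using R \<delta> by (auto simp: d_def)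
        note A1 = bin_size[OF this(1) A1_def] and A2 = bin_size[OF this(2) A2_def]
        have K0: "0 \<le> K" by (simp add: K_def)
        \<comment> \<open>The exponent of the quotient is \<open>I12 + d\<close> plus the clipped
          rates minus \<open>I1 - d\<close> and \<open>I2 - d\<close>, which is at most
          \<open>3 * d - 4 * d\<close>. The factor 4 comes from the two roundings in the numbers of
          messages.\<close>
        have KA: "K / (real A1 * real A2) \<le> 4 * 2 powr (- real n * d)"
        proof -
          let ?X1 = "2 powr (real n * (I1 - d))" and ?X2 = "2 powr (real n * (I2 - d))"
          let ?Y1 = "2 powr (real n * max (R1 - \<delta>) 0)" and ?Y2 = "2 powr (real n * max (R2 - \<delta>) 0)"
          have M: "0 < real ?M1" "0 < real ?M2" using msg_num_pos by simp_all
          have a1: "?X1 / (2 * ?Y1) \<le> real A1"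
            using A1(2) by (rule order_trans[rotated]) (intro divide_left_mono msg_num_le_max mult_pos_pos M, auto)
          have a2: "?X2 / (2 * ?Y2) \<le> real A2"
            using A2(2) by (rule order_trans[rotated]) (intro divide_left_mono msg_num_le_max mult_pos_pos M, auto)
          have "K / (real A1 * real A2) \<le> K / ((?X1 / (2 * ?Y1)) * (?X2 / (2 * ?Y2)))"
            using a1 a2 A1(1) A2(1) K0 by (intro divide_left_mono mult_mono mult_pos_pos) auto
          also have "\<dots> = 4 * (K * ?Y1 * ?Y2 / (?X1 * ?X2))" by (simp add: field_simps)
          also have "K * ?Y1 * ?Y2 / (?X1 * ?X2) = 2 powr (real n * (I12 + d) + real n * max (R1 - \<delta>) 0
              + real n * max (R2 - \<delta>) 0 - (real n * (I1 - d) + real n * (I2 - d)))"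
            by (simp only: K_def powr_add powr_diff)
          also have "real n * (I12 + d) + real n * max (R1 - \<delta>) 0
              + real n * max (R2 - \<delta>) 0 - (real n * (I1 - d) + real n * (I2 - d))
            = real n * (I12 + (max (R1 - \<delta>) 0 + max (R2 - \<delta>) 0) + 3 * d - I1 - I2)"
            by (simp add: algebra_simps)
          also have "2 powr \<dots> \<le> 2 powr (real n * (- d))"
            using rates by (intro powr_mono mult_left_mono) auto
          finally show ?thesis by simp
        qed
        \<comment> \<open>The decoders contribute \<open>\<epsilon> / 2\<close>. The rest is at most
          \<open>16 * t n + 8 * 4 * 2 powr (- n * d)\<close>, the quantity that \<open>N0\<close>
          keeps below \<open>\<epsilon> / 2\<close>.\<close>
        have bound: "4 * (\<epsilon> / 8) + 8 * (2 * t n + K / (real A1 * real A2)) \<le> \<epsilon>"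
          using N0[of n] KA n by simp
        obtain D1 where D1: "random_decoder n (?M1 * A1) p1 \<omega>1 (\<epsilon> / 8) D1"
          using N1[rule_format, OF _ A1(3)] n unfolding max.bounded_iff by blast
        obtain D2 where D2: "random_decoder n (?M2 * A2) p2 \<omega>2 (\<epsilon> / 8) D2"
          using N2[rule_format, OF _ A2(3)] n unfolding max.bounded_iff by blast
        have "\<exists>(c :: nat \<Rightarrow> nat \<Rightarrow> nat \<Rightarrow> 'x) \<Lambda> \<Gamma>. povm_on (words n) {..<?M1} \<Lambda> \<and> povm_on (words n) {..<?M2} \<Gamma> \<and>
          (\<Sum>m1<?M1. \<Sum>m2<?M2. err_prob n (\<Lambda> m1) (\<Gamma> m2) (chan_n \<rho> n (c m1 m2)))
            \<le> real (?M1 * ?M2) * (4 * (\<epsilon> / 8) + 8 * (2 * t n + K / (real A1 * real A2)))"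
          by (rule marton_block[where f = f and ?D1.0 = D1 and ?D2.0 = D2 and K = K and t = "t n" and \<epsilon> = "\<epsilon> / 8",
              OF \<rho> p p1_def p2_def r1(4,2) r2(4,2) \<omega>1_def \<omega>2_def msg_num_pos A1(1) msg_num_pos A2(1) D1 D2 K0])
            (simp_all add: t_def K_def h_def)
        then obtain c :: "nat \<Rightarrow> nat \<Rightarrow> nat \<Rightarrow> 'x" and \<Lambda> :: "nat \<Rightarrow> 'b1 list op" and \<Gamma> :: "nat \<Rightarrow> 'b2 list op"
          where code: "povm_on (words n) {..<?M1} \<Lambda>" "povm_on (words n) {..<?M2} \<Gamma>"
            and err: "(\<Sum>m1<?M1. \<Sum>m2<?M2. err_prob n (\<Lambda> m1) (\<Gamma> m2) (chan_n \<rho> n (c m1 m2)))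
              \<le> real (?M1 * ?M2) * (4 * (\<epsilon> / 8) + 8 * (2 * t n + K / (real A1 * real A2)))"
          by blast
        have "(\<Sum>m1<?M1. \<Sum>m2<?M2. err_prob n (\<Lambda> m1) (\<Gamma> m2) (chan_n \<rho> n (c m1 m2))) \<le> real (?M1 * ?M2) * \<epsilon>"
          using err by (rule order_trans) (intro mult_left_mono bound, simp)
        then show "is_code \<rho> n (R1 - \<delta>) (0 - \<delta>) (R2 - \<delta>) \<epsilon>"
          using \<delta> by (intro is_code_no_common[OF code]) auto
      qed
    qed
  qed
qed

end
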